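(* Let $\nu\in\mathbb N_+\cup\{\infty\}$ and $\mathcal H=\mathcal H_\nu$. The specialization at $\hbar=1$ of the Hopf $\Bbbk[\hbar]$-algebra $(\mathcal H_\hbar^\vee)'$ is $\mathcal H$: that is, $$(\mathcal H_\hbar^\vee)'\big|_{\hbar=1}:=(\mathcal H_\hbar^\vee)'\big/(\hbar-1)(\mathcal H_\hbar^\vee)'\;\cong\;\mathcal H$$ as Hopf $\Bbbk$-algebras, where the class of $\tilde{\mathbf x}_n=\mathbf a_n\in(\mathcal H_\hbar^\vee)'$ corresponds to the generator $\mathbf a_n$ of $\mathcal H$ for every $n\in\mathbb N_\nu$.
   Context: $\Bbbk$ is a field of characteristic zero, $\mathbb N=\{0,1,2,\dots\}$, $\mathbb N_+=\mathbb N\setminus\{0\}$, $\mathbb N_\nu=\{1,\dots,\nu\}$ for $\nu\in\mathbb N_+$, $\mathbb N_\infty=\mathbb N_+$. $\mathcal H_\nu$: the free associative algebra $\Bbbk\langle\mathbf a_n\mid n\in\mathbb N_\nu\rangle$ with $\Delta(\mathbf a_n)=\mathbf a_n\otimes1+1\otimes\mathbf a_n+\sum_{m=1}^{n-1}\mathbf a_m\otimes Q^m_{n-m}(\mathbf a_* )$, $\epsilon(\mathbf a_n)=0$, $S(\mathbf a_n)=-\mathbf a_n-\sum_{m=1}^{n-1}S(\mathbf a_m)Q^m_{n-m}(\mathbf a_* )$ (recursively), where $Q^\ell_t(\mathbf a_* )=\sum_{k=1}^t\binom{\ell+1}{k}P^{(k)}_t(\mathbf a_* )$, $P^{(k)}_t(\mathbf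 a_* )=\sum_{j_1,\dots,j_k>0,\,j_1+\cdots+j_k=t}\mathbf a_{j_1}\cdots\mathbf a_{j_k}$. $\mathcal H(\hbar)=\Bbbk(\hbar)\otimes_\Bbbk\mathcal H$, $J=\operatorname{Ker}(\epsilon:\mathcal H\to\Bbbk)$, $\mathcal H_\hbar^\vee=\sum_{n\ge0}\Bbbk[\hbar]\hbar^{-n}J^n\subseteq\mathcal H(\hbar)$, $\mathbf x_n=\hbar^{-1}\mathbf a_n$, $\tilde{\mathbf x}_n=\hbar\,\mathbf x_n=\mathbf a_n$. With $\delta_0=\epsilon$, $\delta_n=(\mathrm{id}-u\circ\epsilon)^{\otimes n}\circ\Delta^n$ ($u$ the unit map, $\Delta^n$ the iterated coproduct into the $n$-fold tensor power, $\Delta^1=\mathrm{id}$), one sets $(\mathcal H_\hbar^\vee)'=\{\eta\in\mathcal H_\hbar^\vee\mid\delta_n(\eta)\in\hbar^n(\mathcal H_\hbar^\vee)^{\otimes n}\ \forall n\in\mathbb N\}$, a Hopf $\Bbbk[\hbar]$-subalgebra of $\mathcal H_\hbar^\vee$. *)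

theory Defs
  imports
    "HOL-Library.Poly_Mapping"
    "HOL-Library.Extended_Nat"
    "HOL-Computational_Algebra.Polynomial"
    "HOL-Computational_Algebra.Polynomial_Factorial"
    "HOL-Algebra.QuotRing"
    "HOL-Algebra.Ideal_Product"
    "HOL-Algebra.Algebraic_Closure_Type"
begin

section \<open>Tensor powers\<close>

text \<open>
  A tensor in the \<open>n\<close>-th tensor power of an \<open>R\<close>-module \<open>M\<close> is given by a formal \<open>R\<close>-linear
  combination of \<open>n\<close>-tuples of elements of \<open>M\<close>; two formal combinations are the same tensor iff
  they are congruent modulo the multilinearity relations (\<open>tensor_eq\<close> below).
  The tuple \<open>[x\<^sub>1, \<dots>, x\<^sub>n]\<close> stands for the pure tensor of \<open>x\<^sub>1, \<dots>, x\<^sub>n\<close>.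
  Scalars are taken from a type of class \<open>comm_ring_1\<close>, viewed as a ring record through
  \<open>ring_of_type_algebra\<close> when needed.
\<close>

definition scale :: "'r::comm_ring_1 \<Rightarrow> ('b \<Rightarrow>\<^sub>0 'r) \<Rightarrow> ('b \<Rightarrow>\<^sub>0 'r)" where
  "scale c = Poly_Mapping.map ((*) c)"

definition tuples :: "'a set \<Rightarrow> nat \<Rightarrow> 'a list set" where
  "tuples L n = {xs. length xs = n \<and> set xs \<subseteq> L}"

definition tensors :: "'a set \<Rightarrow> nat \<Rightarrow> ('a list \<Rightarrow>\<^sub>0 'r::comm_ring_1) set" where
  "tensors L n = {s. Poly_Mapping.keys s \<subseteq> tuples L n}"

definition multilinear_relators ::
  "('r::comm_ring_1, 'a, 'm) module_scheme \<Rightarrow> nat \<Rightarrow> ('a list \<Rightarrow>\<^sub>0 'r) set" where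
  "multilinear_relators M n =
     {Poly_Mapping.single (xs[i := x \<oplus>\<^bsub>M\<^esub> y]) 1
        - Poly_Mapping.single (xs[i := x]) 1 - Poly_Mapping.single (xs[i := y]) 1
      | xs i x y. xs \<in> tuples (carrier M) n \<and> i < n \<and> x \<in> carrier M \<and> y \<in> carrier M}
   \<union> {Poly_Mapping.single (xs[i := c \<odot>\<^bsub>M\<^esub> x]) 1 - Poly_Mapping.single (xs[i := x]) c
      | xs i x c. xs \<in> tuples (carrier M) n \<and> i < n \<and> x \<in> carrier M}"

definition tensor_eq ::
  "('r::comm_ring_1, 'a, 'm) module_scheme \<Rightarrow> nat \<Rightarrow> ('a list \<Rightarrow>\<^sub>0 'r) \<Rightarrow> ('a list \<Rightarrow>\<^sub>0 'r) \<Rightarrow> bool"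
where
  "tensor_eq M n s t \<longleftrightarrow> s - t \<in> Modules.module.span scale (multilinear_relators M n)"

text \<open>Apply \<open>g\<close> to all coefficients and \<open>f\<close> to all tensor factors.\<close>

definition map_tensor ::
  "('r::comm_ring_1 \<Rightarrow> 's::comm_ring_1) \<Rightarrow> ('a \<Rightarrow> 'b) \<Rightarrow> ('a list \<Rightarrow>\<^sub>0 'r) \<Rightarrow> ('b list \<Rightarrow>\<^sub>0 's)" where
  "map_tensor g f s =
     (\<Sum>xs\<in>Poly_Mapping.keys s. Poly_Mapping.single (map f xs) (g (Poly_Mapping.lookup s xs)))"

text \<open>The product of a tensor power of an algebra with multiplication \<open>m\<close>.\<close>

definition tensor_mult ::
  "('a \<Rightarrow> 'a \<Rightarrow> 'a) \<Rightarrow> ('a list \<Rightarrow>\<^sub>0 'r::comm_ring_1) \<Rightarrow> ('a list \<Rightarrow>\<^sub>0 'r) \<Rightarrow> ('a list \<Rightarrow>\<^sub>0 'r)" where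
  "tensor_mult m s t =
     (\<Sum>xs\<in>Poly_Mapping.keys s. \<Sum>ys\<in>Poly_Mapping.keys t.
        Poly_Mapping.single (map2 m xs ys) (Poly_Mapping.lookup s xs * Poly_Mapping.lookup t ys))"


section \<open>Hopf algebras\<close>

text \<open>The value of \<open>comult\<close> is a representative of the coproduct, relevant up to \<open>tensor_eq\<close>.\<close>

record (overloaded) ('r::comm_ring_1, 'a) hopf = "('r, 'a) module" +
  comult :: "'a \<Rightarrow> ('a list \<Rightarrow>\<^sub>0 'r)"
  counit :: "'a \<Rightarrow> 'r"
  antipode :: "'a \<Rightarrow> 'a"

text \<open>Apply the coproduct to the \<open>i\<close>-th tensor factor (counting from 0).\<close>

definition comult_at ::
  "('r::comm_ring_1, 'a, 'm) hopf_scheme \<Rightarrow> nat \<Rightarrow> ('a list \<Rightarrow>\<^sub>0 'r) \<Rightarrow> ('a list \<Rightarrow>\<^sub>0 'r)" where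
  "comult_at A i s =
     (\<Sum>xs\<in>Poly_Mapping.keys s. \<Sum>ys\<in>Poly_Mapping.keys (comult A (xs ! i)).
        Poly_Mapping.single (take i xs @ ys @ drop (Suc i) xs)
          (Poly_Mapping.lookup s xs * Poly_Mapping.lookup (comult A (xs ! i)) ys))"

locale hopf_algebra =
  ring A + module "ring_of_type_algebra :: 'r ring" A
  for A :: "('r::comm_ring_1, 'a, 'm) hopf_scheme" (structure) +
  assumes smult_mult_left:
      "\<And>c x y. x \<in> carrier A \<Longrightarrow> y \<in> carrier A \<Longrightarrow> (c \<odot> x) \<otimes> y = c \<odot> (x \<otimes> y)"
    and smult_mult_right:
      "\<And>c x y. x \<in> carrier A \<Longrightarrow> y \<in> carrier A \<Longrightarrow> x \<otimes> (c \<odot> y) = c \<odot> (x \<otimes> y)"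
    and comult_closed: "\<And>x. x \<in> carrier A \<Longrightarrow> comult A x \<in> tensors (carrier A) 2"
    and comult_add: "\<And>x y. x \<in> carrier A \<Longrightarrow> y \<in> carrier A \<Longrightarrow>
      tensor_eq A 2 (comult A (x \<oplus> y)) (comult A x + comult A y)"
    and comult_smult: "\<And>c x. x \<in> carrier A \<Longrightarrow>
      tensor_eq A 2 (comult A (c \<odot> x)) (scale c (comult A x))"
    and comult_one: "tensor_eq A 2 (comult A \<one>) (Poly_Mapping.single [\<one>, \<one>] 1)"
    and comult_mult: "\<And>x y. x \<in> carrier A \<Longrightarrow> y \<in> carrier A \<Longrightarrow>
      tensor_eq A 2 (comult A (x \<otimes> y)) (tensor_mult (monoid.mult A) (comult A x) (comult A y))"
    and counit_ring_hom: "counit A \<in> ring_hom A ring_of_type_algebra"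
    and counit_smult: "\<And>c x. x \<in> carrier A \<Longrightarrow> counit A (c \<odot> x) = c * counit A x"
    and coassociative: "\<And>x. x \<in> carrier A \<Longrightarrow>
      tensor_eq A 3 (comult_at A 0 (comult A x)) (comult_at A 1 (comult A x))"
    and counit_left: "\<And>x. x \<in> carrier A \<Longrightarrow>
      (\<Oplus>xs\<in>Poly_Mapping.keys (comult A x).
         (Poly_Mapping.lookup (comult A x) xs * counit A (xs ! 0)) \<odot> (xs ! 1)) = x"
    and counit_right: "\<And>x. x \<in> carrier A \<Longrightarrow>
      (\<Oplus>xs\<in>Poly_Mapping.keys (comult A x).
         (Poly_Mapping.lookup (comult A x) xs * counit A (xs ! 1)) \<odot> (xs ! 0)) = x"
    and antipode_closed: "\<And>x. x \<in> carrier A \<Longrightarrow> antipode A x \<in> carrier A"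
    and antipode_add: "\<And>x y. x \<in> carrier A \<Longrightarrow> y \<in> carrier A \<Longrightarrow>
      antipode A (x \<oplus> y) = antipode A x \<oplus> antipode A y"
    and antipode_smult: "\<And>c x. x \<in> carrier A \<Longrightarrow> antipode A (c \<odot> x) = c \<odot> antipode A x"
    and antipode_left: "\<And>x. x \<in> carrier A \<Longrightarrow>
      (\<Oplus>xs\<in>Poly_Mapping.keys (comult A x).
         Poly_Mapping.lookup (comult A x) xs \<odot> (antipode A (xs ! 0) \<otimes> (xs ! 1)))
      = counit A x \<odot> \<one>"
    and antipode_right: "\<And>x. x \<in> carrier A \<Longrightarrow>
      (\<Oplus>xs\<in>Poly_Mapping.keys (comult A x).
         Poly_Mapping.lookup (comult A x) xs \<odot> ((xs ! 0) \<otimes> antipode A (xs ! 1)))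
      = counit A x \<odot> \<one>"

definition hopf_iso ::
  "('r::comm_ring_1, 'a) hopf \<Rightarrow> ('r, 'b) hopf \<Rightarrow> ('a \<Rightarrow> 'b) set" where
  "hopf_iso A B = {\<phi> \<in> ring_iso A B. \<forall>x\<in>carrier A.
      (\<forall>c. \<phi> (c \<odot>\<^bsub>A\<^esub> x) = c \<odot>\<^bsub>B\<^esub> \<phi> x)
    \<and> tensor_eq B 2 (comult B (\<phi> x)) (map_tensor id \<phi> (comult A x))
    \<and> counit B (\<phi> x) = counit A x
    \<and> antipode B (\<phi> x) = \<phi> (antipode A x)}"


section \<open>The Hopf algebra of non-commutative formal diffeomorphisms\<close>

text \<open>
  The free associative \<open>R\<close>-algebra on the letters \<open>\<nat>\<close> is the monoid algebra of the free monoid of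
  words, i.e. of lists under concatenation.
\<close>

instantiation list :: (type) monoid_add
begin
definition zero_list :: "'a list" where "zero_list = []"
definition plus_list :: "'a list \<Rightarrow> 'a list \<Rightarrow> 'a list" where "plus_list u v = u @ v"
instance by standard (simp_all add: zero_list_def plus_list_def)
end

type_synonym 'r free_alg = "nat list \<Rightarrow>\<^sub>0 'r"

definition letters :: "enat \<Rightarrow> nat set" where
  "letters \<nu> = {n. 1 \<le> n \<and> enat n \<le> \<nu>}"

definition gen :: "nat \<Rightarrow> 'r::comm_ring_1 free_alg" where
  "gen n = Poly_Mapping.single [n] 1"

definition P_poly :: "nat \<Rightarrow> nat \<Rightarrow> 'r::comm_ring_1 free_alg" where
  "P_poly k t = (\<Sum>js\<in>{js. length js = k \<and> (\<forall>j\<in>set js. j > 0) \<and> sum_list js = t}.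
                    prod_list (map gen js))"

definition Q_poly :: "nat \<Rightarrow> nat \<Rightarrow> 'r::comm_ring_1 free_alg" where
  "Q_poly l t = (\<Sum>k=1..t. of_nat ((l + 1) choose k) * P_poly k t)"

definition comult_gen :: "nat \<Rightarrow> ('r::comm_ring_1 free_alg list \<Rightarrow>\<^sub>0 'r)" where
  "comult_gen n = Poly_Mapping.single [gen n, 1] 1 + Poly_Mapping.single [1, gen n] 1
     + (\<Sum>m\<in>{1..<n}. Poly_Mapping.single [gen m, Q_poly m (n - m)] 1)"

primrec comult_word :: "nat list \<Rightarrow> ('r::comm_ring_1 free_alg list \<Rightarrow>\<^sub>0 'r)" where
  "comult_word [] = Poly_Mapping.single [1, 1] 1"
| "comult_word (n # w) = tensor_mult (*) (comult_gen n) (comult_word w)"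

function antipode_gen :: "nat \<Rightarrow> 'r::comm_ring_1 free_alg" where
  "antipode_gen n = - gen n - (\<Sum>m\<in>{1..<n}. antipode_gen m * Q_poly m (n - m))"
  by auto
termination by (relation "Wellfounded.measure id") auto

declare antipode_gen.simps [simp del]

text \<open>The antipode reverses products.\<close>

primrec antipode_word :: "nat list \<Rightarrow> 'r::comm_ring_1 free_alg" where
  "antipode_word [] = 1"
| "antipode_word (n # w) = antipode_word w * antipode_gen n"

text \<open>
  The counit is the coefficient of the empty word, as it is the algebra morphism killing all
  generators.
\<close>

definition nc_diff :: "enat \<Rightarrow> ('r::comm_ring_1, 'r free_alg) hopf" where
  "nc_diff \<nu> =
    \<lparr> carrier = {f. \<forall>w\<in>Poly_Mapping.keys f. set w \<subseteq> letters \<nu>},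
      monoid.mult = (*), monoid.one = 1, ring.zero = 0, ring.add = (+), module.smult = scale,
      comult = (\<lambda>f. \<Sum>w\<in>Poly_Mapping.keys f. scale (Poly_Mapping.lookup f w) (comult_word w)),
      counit = (\<lambda>f. Poly_Mapping.lookup f []),
      antipode = (\<lambda>f. \<Sum>w\<in>Poly_Mapping.keys f. scale (Poly_Mapping.lookup f w) (antipode_word w)) \<rparr>"


section \<open>Quantization\<close>

definition hbar :: "'k::field poly fract" where
  "hbar = to_fract [:0, 1:]"

definition aug_ideal :: "('r::comm_ring_1, 'a, 'm) hopf_scheme \<Rightarrow> 'a set" where
  "aug_ideal A = {x \<in> carrier A. counit A x = 0}"

primrec ideal_power :: "('a, 'm) ring_scheme \<Rightarrow> 'a set \<Rightarrow> nat \<Rightarrow> 'a set" where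
  "ideal_power A I 0 = carrier A"
| "ideal_power A I (Suc n) = ideal_prod A I (ideal_power A I n)"

text \<open>
  The extension of scalars of \<open>nc_diff \<nu>\<close> from \<open>k\<close> to \<open>k(\<hbar>)\<close> is \<open>nc_diff \<nu>\<close> over \<open>k(\<hbar>)\<close>,
  with the following embedding \<open>x \<mapsto> 1 \<otimes> x\<close>.
\<close>

definition base_change :: "'k::field free_alg \<Rightarrow> 'k poly fract free_alg" where
  "base_change = Poly_Mapping.map (\<lambda>c. to_fract [:c:])"

definition H_vee :: "enat \<Rightarrow> 'k::field poly fract free_alg set" where
  "H_vee \<nu> = Modules.module.span (\<lambda>p :: 'k poly. scale (to_fract p))
     (\<Union>n. (\<lambda>x. scale (inverse hbar ^ n) (base_change x))
              ` ideal_power (nc_diff \<nu>) (aug_ideal (nc_diff \<nu>)) n)"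

fun iter_comult ::
  "('r::comm_ring_1, 'a, 'm) hopf_scheme \<Rightarrow> nat \<Rightarrow> 'a \<Rightarrow> ('a list \<Rightarrow>\<^sub>0 'r)" where
  "iter_comult A 0 x = Poly_Mapping.single [] (counit A x)"
| "iter_comult A (Suc 0) x = Poly_Mapping.single [x] 1"
| "iter_comult A (Suc (Suc n)) x = comult_at A 0 (iter_comult A (Suc n) x)"

definition delta ::
  "('r::comm_ring_1, 'a, 'm) hopf_scheme \<Rightarrow> nat \<Rightarrow> 'a \<Rightarrow> ('a list \<Rightarrow>\<^sub>0 'r)" where
  "delta A n x = map_tensor id (\<lambda>y. y \<ominus>\<^bsub>A\<^esub> (counit A y \<odot>\<^bsub>A\<^esub> \<one>\<^bsub>A\<^esub>)) (iter_comult A n x)"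

text \<open>
  For a \<open>k[\<hbar>]\<close>-submodule \<open>L\<close> of a \<open>k(\<hbar>)\<close>-Hopf algebra \<open>A\<close>, the tensor power of \<open>L\<close> over \<open>k[\<hbar>]\<close>
  is regarded inside that of \<open>A\<close> over \<open>k(\<hbar>)\<close> (it embeds there, as \<open>L\<close> is torsion-free over a
  principal ideal domain).
\<close>

definition drinfeld_prime ::
  "('k::field poly fract, 'a, 'm) hopf_scheme \<Rightarrow> 'a set \<Rightarrow> 'a set" where
  "drinfeld_prime A L = {\<eta> \<in> L. \<forall>n. \<exists>s :: 'a list \<Rightarrow>\<^sub>0 'k poly.
     s \<in> tensors L n \<and> tensor_eq A n (delta A n \<eta>) (scale (hbar ^ n) (map_tensor to_fract id s))}"

text \<open>
  The Hopf \<open>k[\<hbar>]\<close>-algebra structure on a Hopf \<open>k[\<hbar>]\<close>-subalgebra \<open>L\<close>: the coproduct of an element is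
  its coproduct in \<open>A\<close>, written as a tensor over \<open>k[\<hbar>]\<close> of elements of \<open>L\<close>.
\<close>

definition hopf_restrict ::
  "('k::field poly fract, 'a) hopf \<Rightarrow> 'a set \<Rightarrow> ('k poly, 'a) hopf" where
  "hopf_restrict A L =
    \<lparr> carrier = L, monoid.mult = monoid.mult A, monoid.one = monoid.one A,
      ring.zero = ring.zero A, ring.add = ring.add A,
      module.smult = (\<lambda>p. module.smult A (to_fract p)),
      comult = (\<lambda>x. SOME s. s \<in> tensors L 2 \<and>
                   tensor_eq A 2 (comult A x) (map_tensor to_fract id s)),
      counit = (\<lambda>x. THE p. to_fract p = counit A x),
      antipode = antipode A \<rparr>"

definition H_vee_prime :: "enat \<Rightarrow> ('k::field poly, 'k poly fract free_alg) hopf" where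
  "H_vee_prime \<nu> = hopf_restrict (nc_diff \<nu>) (drinfeld_prime (nc_diff \<nu>) (H_vee \<nu>))"


section \<open>Specialization\<close>

text \<open>
  Specialization of a Hopf \<open>k[\<hbar>]\<close>-algebra \<open>A\<close> at \<open>\<hbar> = a\<close>: the quotient by \<open>(\<hbar> - a) A\<close>, with the induced
  structure maps; \<open>k[\<hbar>] / (\<hbar> - a)\<close> is identified with \<open>k\<close> by evaluation at \<open>a\<close>.
\<close>

definition spec_ideal :: "'k::field \<Rightarrow> ('k poly, 'a) hopf \<Rightarrow> 'a set" where
  "spec_ideal a A = (\<lambda>x. [:- a, 1:] \<odot>\<^bsub>A\<^esub> x) ` carrier A"

definition spec_class :: "'k::field \<Rightarrow> ('k poly, 'a) hopf \<Rightarrow> 'a \<Rightarrow> 'a set" where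
  "spec_class a A x = spec_ideal a A +>\<^bsub>A\<^esub> x"

definition specialization :: "'k::field \<Rightarrow> ('k poly, 'a) hopf \<Rightarrow> ('k, 'a set) hopf" where
  "specialization a A = (let Q = A Quot spec_ideal a A; rep = (\<lambda>K. SOME x. x \<in> K) in
    \<lparr> carrier = carrier Q, monoid.mult = monoid.mult Q, monoid.one = monoid.one Q,
      ring.zero = ring.zero Q, ring.add = ring.add Q,
      module.smult = (\<lambda>c K. spec_class a A ([:c:] \<odot>\<^bsub>A\<^esub> rep K)),
      comult = (\<lambda>K. map_tensor (\<lambda>p. poly p a) (spec_class a A) (comult A (rep K))),
      counit = (\<lambda>K. poly (counit A (rep K)) a),
      antipode = (\<lambda>K. spec_class a A (antipode A (rep K))) \<rparr>)"

end

(*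
  Coassociativity and the antipode: with a_0 = 1 and A = \<Sum> a_n t^(n+1), the coproduct of the generators is
  \<Delta>(A) = \<Sum> a_m \<otimes> A^(m+1), hence \<Delta>(A^p) = \<Sum> [t^m] A^p \<otimes> A^m.  A left antipode inverts a unitriangular
  matrix on one side, therefore on both.

  Integral form: let M be the smallest k[\<hbar>]-subalgebra containing the generators and closed under
  \<hbar>^(-1)[x, y].  Then \<Delta>(M) \<subseteq> M \<otimes> M, because M is commutative modulo \<hbar>, and M \<subseteq> k[\<hbar>] + \<hbar> H^v;
  so M is contained in (H^v)'.  Conversely the shortest homogeneous part of an element of (H^v)' satisfies
  the conditions on \<delta>_n for the primitive coproduct, and the Dynkin operator writes it as a combination
  of products of Lie words that lie in M.  Thus (H^v)' = M, which is a Hopf subalgebra.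

  Specialization: H[\<hbar>] \<subseteq> M \<subseteq> H[\<hbar>, \<hbar>^(-1)], so evaluation at \<hbar> = 1 maps M onto H.  If it kills x = (\<hbar> - 1) y,
  then \<hbar>^N y \<in> M for large N, and (\<hbar>^N - 1) y is a multiple of x; therefore y \<in> M.
*)
theory Submission
  imports Defs "HOL-Library.Product_Plus" "HOL-Computational_Algebra.Formal_Power_Series"
begin

text \<open>The bracket divided by \<hbar> comes from the generators \<open>x_n\<close> of H^v:
  \<hbar> times an iterated bracket of l of them equals l - 1 nested brackets \<hbar>^(-1)[ , ] of
  the corresponding generators of H. The obstacle to the converse inclusion is that \<Delta> is not
  homogeneous: it adds longer words to the primitive part. Since H^v is free over k[\<hbar>] on the
  \<hbar>^(-|w|) w, the conditions on \<delta>_n become divisibility of single coefficients, and a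
  coefficient of total length p receives nothing from words longer than p. This is what isolates the
  shortest part. Dividing by p in the Dynkin identity is where characteristic zero enters. The other
  obstacle is formal: coproducts are representatives modulo multilinearity, and those of the
  specialization result from choices. So the Hopf axioms are proved once, in
  \<open>nc_diff_model\<close>, for any structure with a bijection onto the free algebra under which
  the coordinates of all operations are the expected ones. H and the specialization are two
  instances.\<close>

abbreviation "lookup \<equiv> Poly_Mapping.lookup"
abbreviation "single \<equiv> Poly_Mapping.single"
abbreviation "keys \<equiv> Poly_Mapping.keys"

type_synonym 'k qfree = "'k poly fract free_alg"

section \<open>Linear maps between free modules\<close>

lemma lookup_scale [simp]: "lookup (scale c f) w = c * lookup f w"
  by (simp add: scale_def Poly_Mapping.map.rep_eq when_def)

lemma scale_conv_mult: "scale c f = single 0 c * f"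
  by (simp add: scale_def mult_map_scale_conv_mult)

lemma scale_zero_left [simp]: "scale 0 f = 0"
  and scale_zero_right [simp]: "scale c 0 = 0"
  and scale_one [simp]: "scale 1 f = f"
  and scale_scale [simp]: "scale c (scale d f) = scale (c * d) f"
  and scale_minus_left: "scale (- c) f = - scale c f"
  and scale_add_right: "scale c (f + g) = scale c f + scale c g"
  and scale_add_left: "scale (c + d) f = scale c f + scale d f"
  and scale_diff_right: "scale c (f - g) = scale c f - scale c g"
  and scale_diff_left: "scale (c - d) f = scale c f - scale d f"
  and scale_single [simp]: "scale c (single w d) = single w (c * d)"
  by (rule poly_mapping_eqI; simp add: lookup_add lookup_minus algebra_simps lookup_single when_def)+

lemma scale_sum: "scale c (\<Sum>i\<in>I. f i) = (\<Sum>i\<in>I. scale c (f i))"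
  by (induction I rule: infinite_finite_induct) (simp_all add: scale_add_right)

lemma keys_scale_subset: "keys (scale c f) \<subseteq> keys f"
  by (auto simp: in_keys_iff)

lemma poly_mapping_sum_single:
  fixes f :: "'b \<Rightarrow>\<^sub>0 'r::comm_monoid_add"
  shows "(\<Sum>w\<in>keys f. single w (lookup f w)) = f"
  by (rule poly_mapping_eqI) (auto simp: lookup_sum lookup_single when_def in_keys_iff)

text \<open>Serves identities that hold only for supports inside \<open>S\<close>, such as tuples
  over a carrier; in the additive case both summands keep that support.\<close>

lemma poly_mapping_keys_induct [consumes 1, case_names zero add single]:
  fixes f :: "'b \<Rightarrow>\<^sub>0 'r::comm_monoid_add"
  assumes "keys f \<subseteq> S" and "P 0"
    and "\<And>f g. keys f \<subseteq> S \<Longrightarrow> keys g \<subseteq> S \<Longrightarrow> P f \<Longrightarrow> P g \<Longrightarrow> P (f + g)"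
    and "\<And>w c. w \<in> S \<Longrightarrow> P (single w c)"
  shows "P f"
proof -
  have "\<lbrakk>finite K; K \<subseteq> S\<rbrakk> \<Longrightarrow>
      P (\<Sum>w\<in>K. single w (lookup f w)) \<and>
      keys (\<Sum>w\<in>K. single w (lookup f w)) \<subseteq> S" for K
  proof (induction K rule: finite_induct)
    case (insert w K)
    let ?x = "single w (lookup f w)"
    let ?y = "\<Sum>w\<in>K. single w (lookup f w)"
    have "keys ?x \<subseteq> S"
      using insert.prems by simp
    moreover have "keys (?x + ?y) \<subseteq> keys ?x \<union> keys ?y"
      by (rule Poly_Mapping.keys_add)
    ultimately show ?case
      using insert assms(3)[of ?x ?y] assms(4) by auto
  qed (use assms(2) in auto)
  from this[of "keys f"] show ?thesis
    using assms(1) by (simp add: poly_mapping_sum_single)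
qed

lemma poly_mapping_linear_induct [case_names zero add single]:
  fixes f :: "'b \<Rightarrow>\<^sub>0 'r::comm_monoid_add"
  assumes "P 0" "\<And>f g. P f \<Longrightarrow> P g \<Longrightarrow> P (f + g)" "\<And>w c. P (single w c)"
  shows "P f"
  by (rule poly_mapping_keys_induct[where S = UNIV]) (use assms in auto)

text \<open>The structure maps of the free algebra and of its tensor powers get this shape:
  \<open>lin_lin\<close> then computes composites on basis elements, and \<open>linear_ext\<close>
  reduces identities to them.\<close>

definition lin :: "('b \<Rightarrow> ('c \<Rightarrow>\<^sub>0 'r)) \<Rightarrow> ('b \<Rightarrow>\<^sub>0 'r) \<Rightarrow> ('c \<Rightarrow>\<^sub>0 'r::comm_ring_1)" where
  "lin g f = (\<Sum>w\<in>keys f. scale (lookup f w) (g w))"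

lemma lin_superset:
  assumes "finite S" "keys f \<subseteq> S"
  shows "lin g f = (\<Sum>w\<in>S. scale (lookup f w) (g w))"
  unfolding lin_def by (rule sum.mono_neutral_left) (use assms in \<open>auto simp: in_keys_iff\<close>)

lemma lin_0 [simp]: "lin g 0 = 0"
  by (simp add: lin_def)

lemma lin_add: "lin g (x + y) = lin g x + lin g y"
proof -
  let ?S = "keys x \<union> keys y"
  have "lin g (x + y) = (\<Sum>w\<in>?S. scale (lookup (x + y) w) (g w))"
    by (rule lin_superset) (use Poly_Mapping.keys_add[of x y] in auto)
  also have "\<dots> = lin g x + lin g y"
    by (simp add: lin_superset[of ?S x] lin_superset[of ?S y] lookup_add scale_add_left sum.distrib)
  finally show ?thesis .
qed

lemma lin_single [simp]: "lin g (single w c) = scale c (g w)"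
  by (cases "c = 0") (simp_all add: lin_def)

lemma lin_scale: "lin g (scale c x) = scale c (lin g x)"
  by (induction x rule: poly_mapping_linear_induct)
    (simp_all add: scale_add_right lin_add)

lemma lin_minus: "lin g (- x) = - lin g x"
  using lin_scale[of g "-1" x] by (simp add: scale_minus_left)

lemma lin_diff: "lin g (x - y) = lin g x - lin g y"
  using lin_add[of g x "- y"] by (simp add: lin_minus)

lemma lin_sum: "lin g (\<Sum>i\<in>I. f i) = (\<Sum>i\<in>I. lin g (f i))"
  by (induction I rule: infinite_finite_induct) (simp_all add: lin_add)

lemma lin_lin: "lin h (lin g x) = lin (\<lambda>w. lin h (g w)) x"
  by (induction x rule: poly_mapping_linear_induct) (simp_all add: lin_add lin_scale)

lemma lin_id [simp]: "lin (\<lambda>w. single w 1) x = x"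
  by (induction x rule: poly_mapping_linear_induct) (simp_all add: lin_add)

lemma lin_plus_fun: "lin (\<lambda>w. g w + h w) x = lin g x + lin h x"
  by (simp add: lin_def scale_add_right sum.distrib)

lemma lin_scale_fun: "lin (\<lambda>w. scale c (g w)) x = scale c (lin g x)"
  by (simp add: lin_def scale_sum mult.commute)

lemma lin_0_fun [simp]: "lin (\<lambda>w. 0) x = 0"
  by (simp add: lin_def)

lemma lin_commute: "lin (\<lambda>u. lin (\<lambda>v. h u v) y) x = lin (\<lambda>v. lin (\<lambda>u. h u v) x) y"
  by (induction x rule: poly_mapping_linear_induct)
    (simp_all add: lin_add lin_plus_fun lin_scale_fun)

lemma lin_cong: "(\<And>w. w \<in> keys x \<Longrightarrow> g w = h w) \<Longrightarrow> lin g x = lin h x"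
  by (simp add: lin_def)

lemma keys_lin: "keys (lin g x) \<subseteq> (\<Union>w\<in>keys x. keys (g w))"
proof -
  have "keys (lin g x) \<subseteq>
      (\<Union>w\<in>keys x. keys (scale (lookup x w) (g w)))"
    unfolding lin_def by (rule Poly_Mapping.keys_sum)
  also have "\<dots> \<subseteq> (\<Union>w\<in>keys x. keys (g w))"
    using keys_scale_subset by fastforce
  finally show ?thesis .
qed

lemma linear_ext:
  assumes "\<And>x y. F (x + y) = F x + F y" "\<And>c x. F (scale c x) = scale c (F x)"
    and "\<And>x y. G (x + y) = G x + G y" "\<And>c x. G (scale c x) = scale c (G x)"
    and "\<And>w. F (single w (1::'r::comm_ring_1)) = G (single w 1)"
  shows "F x = G x"
proof (induction x rule: poly_mapping_linear_induct)
  case zero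
  show ?case using assms(2)[of 0 0] assms(4)[of 0 0] by simp
next
  case (single w c)
  show ?case
    using assms(2)[of c "single w 1"] assms(4)[of c "single w 1"] assms(5)
    by simp
qed (simp add: assms)

lemma scale_mult_left: "scale c (x :: 'b::monoid_add \<Rightarrow>\<^sub>0 'r::comm_ring_1) * y = scale c (x * y)"
  by (simp add: scale_conv_mult mult.assoc)

lemma scale_mult_right: "x * scale c (y :: 'b::monoid_add \<Rightarrow>\<^sub>0 'r::comm_ring_1) = scale c (x * y)"
proof (induction x rule: poly_mapping_linear_induct)
  case (single w d)
  show ?case
    by (induction y rule: poly_mapping_linear_induct)
      (simp_all add: scale_add_right distrib_left mult_single ac_simps)
qed (simp_all add: scale_add_right distrib_right)

lemma lin_mult:
  fixes g :: "'b::monoid_add \<Rightarrow> ('c::monoid_add \<Rightarrow>\<^sub>0 'r::comm_ring_1)"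
  assumes "\<And>u v. g (u + v) = g u * g v"
  shows "lin g (x * y) = lin g x * lin g y"
proof (induction x rule: poly_mapping_linear_induct)
  case (single w d)
  show ?case
    by (induction y rule: poly_mapping_linear_induct)
      (simp_all add: lin_add distrib_left mult_single assms scale_mult_left scale_mult_right mult.commute)
qed (simp_all add: distrib_right lin_add)

lemma lin_antimult:
  fixes g :: "'b::monoid_add \<Rightarrow> ('c::monoid_add \<Rightarrow>\<^sub>0 'r::comm_ring_1)"
  assumes "\<And>u v. g (u + v) = g v * g u"
  shows "lin g (x * y) = lin g y * lin g x"
proof (induction x rule: poly_mapping_linear_induct)
  case (single w d)
  show ?case
    by (induction y rule: poly_mapping_linear_induct)
      (simp_all add: lin_add distrib_right distrib_left scale_add_right mult_single assms scale_mult_left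
        scale_mult_right mult.commute)
qed (simp_all add: distrib_right lin_add distrib_left)

section \<open>Tensor products of free modules\<close>

text \<open>The tensor product of two free modules is free on pairs of basis elements. Pairs of
  words add componentwise, so the convolution product on this type is already the product of the
  tensor product algebra (\<open>tens2_mult\<close>).\<close>

definition tens2 :: "('b \<Rightarrow>\<^sub>0 'r) \<Rightarrow> ('c \<Rightarrow>\<^sub>0 'r) \<Rightarrow> ('b \<times> 'c \<Rightarrow>\<^sub>0 'r::comm_ring_1)" (infixr \<open>\<otimes>\<^sub>T\<close> 72) where
  "f \<otimes>\<^sub>T g = lin (\<lambda>u. lin (\<lambda>v. single (u, v) 1) g) f"

lemma tens2_add_left: "(f + f') \<otimes>\<^sub>T g = f \<otimes>\<^sub>T g + f' \<otimes>\<^sub>T g"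
  and tens2_add_right: "f \<otimes>\<^sub>T (g + g') = f \<otimes>\<^sub>T g + f \<otimes>\<^sub>T g'"
  and tens2_scale_left: "scale c f \<otimes>\<^sub>T g = scale c (f \<otimes>\<^sub>T g)"
  and tens2_scale_right: "f \<otimes>\<^sub>T scale c g = scale c (f \<otimes>\<^sub>T g)"
  and tens2_zero_left [simp]: "0 \<otimes>\<^sub>T g = 0"
  and tens2_zero_right [simp]: "f \<otimes>\<^sub>T 0 = 0"
  by (simp_all add: tens2_def lin_add lin_plus_fun lin_scale lin_scale_fun)

lemma tens2_single [simp]:
  "single u c \<otimes>\<^sub>T single v d = single (u, v) (c * d)"
  by (simp add: tens2_def)

lemma tens2_minus_left: "(- f) \<otimes>\<^sub>T g = - (f \<otimes>\<^sub>T g)"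
  using tens2_scale_left[of "-1" f g] by (simp add: scale_minus_left)

lemma tens2_minus_right: "f \<otimes>\<^sub>T (- g) = - (f \<otimes>\<^sub>T g)"
  using tens2_scale_right[of f "-1" g] by (simp add: scale_minus_left)

lemma tens2_diff_left: "(f - f') \<otimes>\<^sub>T g = f \<otimes>\<^sub>T g - f' \<otimes>\<^sub>T g"
  using tens2_add_left[of f "- f'" g] by (simp add: tens2_minus_left)

lemma tens2_diff_right: "f \<otimes>\<^sub>T (g - g') = f \<otimes>\<^sub>T g - f \<otimes>\<^sub>T g'"
  using tens2_add_right[of f g "- g'"] by (simp add: tens2_minus_right)

lemma tens2_sum_left: "(\<Sum>i\<in>I. f i) \<otimes>\<^sub>T g = (\<Sum>i\<in>I. f i \<otimes>\<^sub>T g)"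
  by (induction I rule: infinite_finite_induct) (simp_all add: tens2_add_left)

lemma tens2_sum_right: "g \<otimes>\<^sub>T (\<Sum>i\<in>I. f i) = (\<Sum>i\<in>I. g \<otimes>\<^sub>T f i)"
  by (induction I rule: infinite_finite_induct) (simp_all add: tens2_add_right)

lemma tens2_one [simp]: "(1 :: 'b::monoid_add \<Rightarrow>\<^sub>0 'r) \<otimes>\<^sub>T (1 :: 'c::monoid_add \<Rightarrow>\<^sub>0 'r::comm_ring_1) = 1"
  by (simp flip: single_one add: zero_prod_def)

lemma tens2_mult:
  fixes f f' :: "'b::monoid_add \<Rightarrow>\<^sub>0 'r::comm_ring_1" and g g' :: "'c::monoid_add \<Rightarrow>\<^sub>0 'r"
  shows "(f \<otimes>\<^sub>T g) * (f' \<otimes>\<^sub>T g') = (f * f') \<otimes>\<^sub>T (g * g')"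
proof (induction f rule: poly_mapping_linear_induct)
  case (single u c)
  show ?case
  proof (induction f' rule: poly_mapping_linear_induct)
    case (single u' c')
    show ?case
    proof (induction g rule: poly_mapping_linear_induct)
      case (single v d)
      show ?case
        by (induction g' rule: poly_mapping_linear_induct)
          (simp_all add: tens2_add_right distrib_left mult_single ac_simps)
    qed (simp_all add: tens2_add_right distrib_right)
  qed (simp_all add: tens2_add_left distrib_left)
qed (simp_all add: tens2_add_left distrib_right)

lemma lookup_tens2 [simp]:
  "lookup (f \<otimes>\<^sub>T g) (u, v) = lookup f u * lookup g v"
proof (induction f rule: poly_mapping_linear_induct)
  case (single w c)
  show ?case
    by (induction g rule: poly_mapping_linear_induct)
      (auto simp: tens2_add_right lookup_add algebra_simps lookup_single when_def)
qed (simp_all add: tens2_add_left lookup_add algebra_simps)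

lemma lin_tens2: "lin h (f \<otimes>\<^sub>T g) = lin (\<lambda>u. lin (\<lambda>v. h (u, v)) g) f"
  by (simp add: tens2_def lin_lin)


section \<open>The coproduct in a basis\<close>

lemma single_Nil [simp]: "single [] 1 = (1 :: 'r::comm_ring_1 free_alg)"
  by (simp flip: single_one add: zero_list_def)

lemma single_Cons: "single (n # w) 1 = (gen n * single w 1 :: 'r::comm_ring_1 free_alg)"
  by (simp add: gen_def mult_single plus_list_def)

lemma single_append: "single (u @ v) 1 =
    (single u 1 * single v 1 :: 'r::comm_ring_1 free_alg)"
  by (simp add: mult_single plus_list_def)

definition eps :: "'r::comm_ring_1 free_alg \<Rightarrow> 'r" where
  "eps f = lookup f []"

lemma eps_add [simp]: "eps (f + g) = eps f + eps g"
  and eps_diff [simp]: "eps (f - g) = eps f - eps g"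
  and eps_minus [simp]: "eps (- f) = - eps f"
  and eps_scale [simp]: "eps (scale c f) = c * eps f"
  and eps_zero [simp]: "eps 0 = 0"
  and eps_single [simp]: "eps (single w c) = (if w = [] then c else 0)"
  by (auto simp: eps_def lookup_add lookup_minus lookup_single when_def)

lemma eps_one [simp]: "eps 1 = 1"
  by (simp flip: single_Nil)

lemma eps_gen [simp]: "eps (gen n) = 0"
  by (simp add: gen_def)

lemma eps_mult [simp]: "eps (f * g) = eps f * eps g"
proof (induction f rule: poly_mapping_linear_induct)
  case (single w d)
  show ?case
    by (induction g rule: poly_mapping_linear_induct)
      (auto simp: distrib_left mult_single plus_list_def)
qed (simp_all add: distrib_right)

lemma eps_sum: "eps (\<Sum>i\<in>I. f i) = (\<Sum>i\<in>I. eps (f i))"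
  by (induction I rule: infinite_finite_induct) simp_all

text \<open>Replaces a formal tensor, meaningful only up to \<open>tensor_eq\<close>, by its
  coordinates on pairs of words. The parameter \<open>\<phi>\<close> lets the same map serve H and
  its specialization.\<close>

definition pair_of :: "('a \<Rightarrow> 'r::comm_ring_1 free_alg) \<Rightarrow> ('a list \<Rightarrow>\<^sub>0 'r) \<Rightarrow> (nat list \<times> nat list \<Rightarrow>\<^sub>0 'r)" where
  "pair_of \<phi> = lin (\<lambda>xs. \<phi> (xs ! 0) \<otimes>\<^sub>T \<phi> (xs ! 1))"

lemma pair_of_single [simp]: "pair_of \<phi> (single [f, g] c) = scale c (\<phi> f \<otimes>\<^sub>T \<phi> g)"
  by (simp add: pair_of_def)

lemma tensor_mult_lin:
  "tensor_mult m s t = lin (\<lambda>xs. lin (\<lambda>ys. single (map2 m xs ys) 1) t) s"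
  by (simp add: tensor_mult_def lin_def scale_sum)

lemma tensors_add: "s \<in> tensors L n \<Longrightarrow> t \<in> tensors L n \<Longrightarrow> s + t \<in> tensors L n"
  using Poly_Mapping.keys_add[of s t] by (auto simp: tensors_def)

lemma tensors_zero [simp]: "0 \<in> tensors L n"
  by (simp add: tensors_def)

lemma tensors_sum: "(\<And>i. i \<in> I \<Longrightarrow> s i \<in> tensors L n) \<Longrightarrow> (\<Sum>i\<in>I. s i) \<in> tensors L n"
  by (induction I rule: infinite_finite_induct) (simp_all add: tensors_add)

lemma tensors_single: "xs \<in> tuples L n \<Longrightarrow> single xs c \<in> tensors L n"
  by (simp add: tensors_def)

lemma tensors_lin:
  "(\<And>x. x \<in> keys s \<Longrightarrow> g x \<in> tensors L n) \<Longrightarrow> lin g s \<in> tensors L n"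
  using keys_lin[of g s] by (fastforce simp: tensors_def)

lemma tensors_scale: "s \<in> tensors L n \<Longrightarrow> scale c s \<in> tensors L n"
  using keys_scale_subset[of c s] by (auto simp: tensors_def)

lemma tuples_2E:
  assumes "xs \<in> tuples L 2"
  obtains x y where "xs = [x, y]" "x \<in> L" "y \<in> L"
proof -
  have "length xs = Suc (Suc 0)" "set xs \<subseteq> L" using assms by (auto simp: tuples_def)
  moreover from this obtain x y where "xs = [x, y]" unfolding length_Suc_conv by auto
  ultimately show ?thesis using that by simp
qed

lemma tensors_mult:
  assumes "s \<in> tensors L n" "t \<in> tensors L n" "\<And>x y. x \<in> L \<Longrightarrow> y \<in> L \<Longrightarrow> m x y \<in> L"
  shows "tensor_mult m s t \<in> tensors L n"
  unfolding tensor_mult_lin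
proof (intro tensors_lin tensors_single)
  fix xs ys assume "xs \<in> keys s" "ys \<in> keys t"
  then have "xs \<in> tuples L n" "ys \<in> tuples L n"
    using assms(1,2) by (auto simp: tensors_def)
  then show "map2 m xs ys \<in> tuples L n"
    using assms(3) by (force simp: tuples_def set_zip)
qed

lemma pair_of_tensor_mult:
  assumes "s \<in> tensors L 2" "t \<in> tensors L 2"
    and m: "\<And>x y. x \<in> L \<Longrightarrow> y \<in> L \<Longrightarrow> \<phi> (m x y) = \<phi> x * \<phi> y"
  shows "pair_of \<phi> (tensor_mult m s t) = pair_of \<phi> s * pair_of \<phi> t"
proof -
  have s: "keys s \<subseteq> tuples L 2" and t: "keys t \<subseteq> tuples L 2"
    using assms by (auto simp: tensors_def)
  from s show ?thesis
  proof (induction s rule: poly_mapping_keys_induct)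
    case zero
    show ?case by (simp add: tensor_mult_lin pair_of_def)
  next
    case (add f g)
    then show ?case
      by (simp add: tensor_mult_lin pair_of_def lin_add distrib_right)
  next
    case (single xs c)
    note xs = single
    from t show ?case
    proof (induction t rule: poly_mapping_keys_induct)
      case (single ys d)
      obtain x y where "xs = [x, y]" "x \<in> L" "y \<in> L" using xs by (auto elim: tuples_2E)
      moreover obtain x' y' where "ys = [x', y']" "x' \<in> L" "y' \<in> L" using single by (auto elim: tuples_2E)
      ultimately show ?case
        by (simp add: tensor_mult_lin scale_mult_left scale_mult_right tens2_mult m mult.commute)
    qed (simp_all add: tensor_mult_lin pair_of_def lin_add distrib_left scale_add_right)
  qed
qed

definition Delta_word :: "nat list \<Rightarrow> (nat list \<times> nat list \<Rightarrow>\<^sub>0 'r::comm_ring_1)" where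
  "Delta_word w = pair_of id (comult_word w)"

abbreviation Delta :: "'r::comm_ring_1 free_alg \<Rightarrow> (nat list \<times> nat list \<Rightarrow>\<^sub>0 'r)" where
  "Delta \<equiv> lin Delta_word"

abbreviation antip :: "'r::comm_ring_1 free_alg \<Rightarrow> 'r free_alg" where
  "antip \<equiv> lin antipode_word"

section \<open>Elements supported on words in the admissible letters\<close>

definition words :: "enat \<Rightarrow> 'r::comm_ring_1 free_alg set" where
  "words \<nu> = {f. \<forall>w\<in>keys f. set w \<subseteq> letters \<nu>}"

lemma words_0 [simp]: "0 \<in> words \<nu>" and words_1 [simp]: "1 \<in> words \<nu>"
  and words_gen: "n \<in> letters \<nu> \<Longrightarrow> gen n \<in> words \<nu>"
  by (simp_all add: words_def gen_def keys_one zero_list_def)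

lemma words_single: "set w \<subseteq> letters \<nu> \<Longrightarrow> single w c \<in> words \<nu>"
  by (simp add: words_def)

lemma words_add: "f \<in> words \<nu> \<Longrightarrow> g \<in> words \<nu> \<Longrightarrow> f + g \<in> words \<nu>"
  using Poly_Mapping.keys_add[of f g] by (auto simp: words_def)

lemma words_mult: "f \<in> words \<nu> \<Longrightarrow> g \<in> words \<nu> \<Longrightarrow> f * g \<in> words \<nu>"
  using Poly_Mapping.keys_mult[of f g] by (fastforce simp: words_def plus_list_def)

lemma words_scale: "f \<in> words \<nu> \<Longrightarrow> scale c f \<in> words \<nu>"
  using keys_scale_subset[of c f] by (auto simp: words_def)

lemma words_minus: "f \<in> words \<nu> \<Longrightarrow> - f \<in> words \<nu>"
  using words_scale[of f \<nu> "-1"] by (simp add: scale_minus_left)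

lemma words_diff: "f \<in> words \<nu> \<Longrightarrow> g \<in> words \<nu> \<Longrightarrow> f - g \<in> words \<nu>"
  using words_add[of f \<nu> "- g"] words_minus[of g] by simp

lemma words_sum: "(\<And>i. i \<in> I \<Longrightarrow> f i \<in> words \<nu>) \<Longrightarrow> (\<Sum>i\<in>I. f i) \<in> words \<nu>"
  by (induction I rule: infinite_finite_induct) (simp_all add: words_add)

lemma words_lin:
  assumes "f \<in> words \<nu>" "\<And>w. set w \<subseteq> letters \<nu> \<Longrightarrow> g w \<in> words \<nu>"
  shows "lin g f \<in> words \<nu>"
  unfolding lin_def by (intro words_sum words_scale assms(2)) (use assms(1) in \<open>auto simp: words_def\<close>)

lemma words_prod_list: "(\<And>x. x \<in> set xs \<Longrightarrow> f x \<in> words \<nu>) \<Longrightarrow> prod_list (map f xs) \<in> words \<nu>"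
  by (induction xs) (simp_all add: words_mult)

lemma words_of_nat: "of_nat n \<in> words \<nu>"
  by (induction n) (simp_all add: words_add)

lemma letters_le: "n \<in> letters \<nu> \<Longrightarrow> 1 \<le> m \<Longrightarrow> m \<le> n \<Longrightarrow> m \<in> letters \<nu>"
  unfolding letters_def using order_trans[of "enat m" "enat n" \<nu>] by simp

lemma words_P_poly:
  assumes "n \<in> letters \<nu>" "t \<le> n"
  shows "P_poly k t \<in> words \<nu>"
  unfolding P_poly_def
proof (intro words_sum words_prod_list words_gen, clarify)
  fix js :: "nat list" and j
  assume "\<forall>j\<in>set js. 0 < j" "t = sum_list js" "j \<in> set js"
  moreover from this have "j \<le> sum_list js" by (simp add: member_le_sum_list)
  ultimately show "j \<in> letters \<nu>"
    using assms letters_le[of n \<nu> j] by auto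
qed

lemma words_Q_poly: "n \<in> letters \<nu> \<Longrightarrow> t \<le> n \<Longrightarrow> Q_poly l t \<in> words \<nu>"
  unfolding Q_poly_def by (intro words_sum words_mult words_of_nat words_P_poly)

lemma comult_gen_closed: "n \<in> letters \<nu> \<Longrightarrow> comult_gen n \<in> tensors (words \<nu>) 2"
  unfolding comult_gen_def
  by (intro tensors_add tensors_sum tensors_single)
    (auto simp: tuples_def words_gen letters_le[of n] words_Q_poly)

lemma comult_word_closed: "set w \<subseteq> letters \<nu> \<Longrightarrow> comult_word w \<in> tensors (words \<nu>) 2"
  by (induction w) (auto simp: comult_gen_closed words_mult tuples_def intro!: tensors_mult tensors_single)

lemma antipode_gen_closed: "n \<in> letters \<nu> \<Longrightarrow> antipode_gen n \<in> words \<nu>"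
proof (induction n rule: antipode_gen.induct)
  case (1 n)
  show ?case
    unfolding antipode_gen.simps[of n]
    by (intro words_diff words_minus words_gen words_sum words_mult 1 words_Q_poly[of n])
      (use 1 letters_le in auto)
qed

lemma antipode_word_closed: "set w \<subseteq> letters \<nu> \<Longrightarrow> antipode_word w \<in> words \<nu>"
  by (induction w) (simp_all add: words_mult antipode_gen_closed)

lemma antip_closed: "f \<in> words \<nu> \<Longrightarrow> antip f \<in> words \<nu>"
  by (rule words_lin) (auto intro: antipode_word_closed)

lemma comult_gen_tensor: "comult_gen n \<in> tensors UNIV 2"
  unfolding comult_gen_def by (intro tensors_add tensors_sum tensors_single) (auto simp: tuples_def)

lemma comult_word_tensor: "comult_word w \<in> tensors UNIV 2"
  by (induction w) (auto simp: comult_gen_tensor tuples_def intro!: tensors_mult tensors_single)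

lemma Delta_word_Nil [simp]: "Delta_word [] = 1"
  by (simp add: Delta_word_def pair_of_def)

lemma Delta_word_Cons: "Delta_word (n # w) = pair_of id (comult_gen n) * Delta_word w"
  unfolding Delta_word_def comult_word.simps
  by (rule pair_of_tensor_mult[OF comult_gen_tensor comult_word_tensor]) simp

lemma Delta_word_append: "Delta_word (u + v) = Delta_word u * Delta_word v"
  by (induction u) (simp_all add: Delta_word_Cons plus_list_def mult.assoc)

lemma Delta_mult: "Delta (f * g) = Delta f * Delta g"
  by (rule lin_mult) (rule Delta_word_append)

lemma Delta_one [simp]: "Delta 1 = 1"
  by (simp flip: single_Nil)

lemma Delta_gen: "Delta (gen n) = pair_of id (comult_gen n)"
  by (simp add: gen_def Delta_word_Cons)

lemma antipode_word_append: "antipode_word (u + v) = antipode_word v * antipode_word u"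
  by (induction u) (simp_all add: plus_list_def mult.assoc)

lemma antip_mult: "antip (f * g) = antip g * antip f"
  by (rule lin_antimult) (rule antipode_word_append)

lemma antip_one [simp]: "antip 1 = 1"
  by (simp flip: single_Nil)

lemma antip_gen: "antip (gen n) = antipode_gen n"
  by (simp add: gen_def)

section \<open>The generating series of the generators\<close>

text \<open>The constant term 1 plays the role of \<open>a_0\<close>; it merges the two primitive
  terms of the coproduct of a generator with the remaining sum into the uniform formula
  \<open>Delta_gen0\<close>.\<close>

definition gser :: "'r::comm_ring_1 free_alg fps" where
  "gser = Abs_fps (\<lambda>n. if n = 0 then 1 else gen n)"

definition Cf :: "nat \<Rightarrow> nat \<Rightarrow> 'r::comm_ring_1 free_alg" where
  "Cf p t = fps_nth (gser ^ p) t"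

lemma Cf_0 [simp]: "Cf 0 t = (if t = 0 then 1 else 0)"
  by (simp add: Cf_def)

lemma Cf_1: "Cf (Suc 0) t = (if t = 0 then 1 else gen t)"
  by (simp add: Cf_def gser_def)

lemma Cf_add: "Cf (p + q) t = (\<Sum>i\<le>t. Cf p i * Cf q (t - i))"
  by (simp add: Cf_def power_add fps_mult_nth atMost_atLeast0)

lemma Cf_Suc: "Cf (Suc p) t = (\<Sum>i\<le>t. Cf (Suc 0) i * Cf p (t - i))"
  using Cf_add[of 1 p t] by simp

lemma Cf_zero [simp]: "Cf p 0 = 1"
proof (induction p)
  case (Suc p)
  then show ?case by (simp add: Cf_Suc[of p] Cf_1)
qed simp

lemma eps_Cf: "eps (Cf p t :: 'r::comm_ring_1 free_alg) = (if t = 0 then 1 else 0)"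
proof (induction p arbitrary: t)
  case (Suc p)
  have "eps (Cf (Suc p) t :: 'r free_alg) = (\<Sum>i\<le>t. eps (Cf (Suc 0) i) * eps (Cf p (t - i)))"
    by (simp add: Cf_Suc[of p] eps_sum)
  also have "\<dots> = (\<Sum>i\<le>t. if i = 0 then if t = 0 then 1 else 0 else 0)"
    by (intro sum.cong) (auto simp: Cf_1 Suc)
  finally show ?case by simp
qed simp

text \<open>The ring need not be commutative, but 1 commutes with \<open>B\<close>.\<close>

lemma binomial_expansion_1:
  fixes B :: "'b::ring_1"
  shows "(1 + B) ^ p = (\<Sum>k\<le>p. of_nat (p choose k) * B ^ k)"
proof (induction p)
  case (Suc p)
  define s where "s = (\<Sum>k\<le>p. of_nat (p choose k) * B ^ k)"
  have s: "s = 1 + (\<Sum>k\<le>p. of_nat (p choose Suc k) * B ^ Suc k)"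
  proof -
    have "s = (\<Sum>k\<le>Suc p. of_nat (p choose k) * B ^ k)"
      by (simp add: s_def binomial_eq_0)
    then show ?thesis
      by (simp only: sum.atMost_Suc_shift) simp
  qed
  have "(\<Sum>k\<le>Suc p. of_nat (Suc p choose k) * B ^ k) =
      1 + (\<Sum>k\<le>p. of_nat (p choose k) * B ^ Suc k) + (\<Sum>k\<le>p. of_nat (p choose Suc k) * B ^ Suc k)"
    by (simp only: sum.atMost_Suc_shift) (simp add: sum.distrib distrib_right add.assoc)
  also have "\<dots> = s + s * B"
    by (subst (2) s_def) (simp add: s sum_distrib_right mult.assoc power_commutes)
  also have "\<dots> = (1 + B) ^ Suc p"
    using Suc by (simp add: s_def[symmetric] power_Suc2 distrib_left del: power_Suc)
  finally show ?case by simp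
qed simp

lemma P_poly_0: "P_poly 0 t = (if t = 0 then 1 else 0)"
proof -
  have "{js. length js = 0 \<and> (\<forall>j\<in>set js. j > 0) \<and> sum_list js = t} = (if t = 0 then {[]} else {})"
    by auto
  then show ?thesis by (simp add: P_poly_def)
qed

text \<open>A composition of \<open>t\<close> into \<open>k + 1\<close> positive parts is a first
  part \<open>j\<close> followed by a composition of \<open>t - j\<close> into \<open>k\<close>
  parts.\<close>

lemma P_poly_Suc: "(P_poly (Suc k) t :: 'r::comm_ring_1 free_alg) = (\<Sum>j\<in>{1..t}. gen j * P_poly k (t - j))"
proof -
  let ?A = "\<lambda>k t. {js. length js = k \<and> (\<forall>j\<in>set js. j > 0) \<and> sum_list js = (t::nat)}"
  have fin: "finite (?A k t)" for k t
  proof (rule finite_subset)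
    show "?A k t \<subseteq> {js. set js \<subseteq> {..t} \<and> length js = k}"
      using member_le_sum_list by fastforce
  qed (rule finite_lists_length_eq, simp)
  have "(\<Sum>j\<in>{1..t}. gen j * (P_poly k (t - j) :: 'r free_alg)) =
      (\<Sum>(j, js)\<in>Sigma {1..t} (\<lambda>j. ?A k (t - j)). gen j * prod_list (map gen js))"
    unfolding P_poly_def sum_distrib_left by (subst sum.Sigma) (use fin in auto)
  also have "\<dots> = (\<Sum>js\<in>?A (Suc k) t. prod_list (map gen js))"
    by (rule sum.reindex_bij_witness[where i = "\<lambda>js. (hd js, tl js)" and j = "\<lambda>(j, js). j # js"])
      (auto simp: length_Suc_conv)
  finally show ?thesis by (simp add: P_poly_def)
qed

lemma P_poly_eq_0: "t < k \<Longrightarrow> P_poly k t = 0"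
  by (induction k arbitrary: t) (auto simp: P_poly_Suc intro!: sum.neutral)

lemma P_poly_fps: "fps_nth ((gser - 1 :: 'r::comm_ring_1 free_alg fps) ^ k) t = P_poly k t"
proof (induction k arbitrary: t)
  case (Suc k)
  have "fps_nth ((gser - 1 :: 'r free_alg fps) ^ Suc k) t = (\<Sum>j=0..t. fps_nth (gser - 1) j * P_poly k (t - j))"
    by (simp add: fps_mult_nth Suc)
  also have "\<dots> = (\<Sum>j\<in>{1..t}. gen j * P_poly k (t - j))"
    by (rule sum.mono_neutral_cong_right) (auto simp: gser_def)
  finally show ?case by (simp add: P_poly_Suc)
qed (simp add: P_poly_0)

text \<open>Expand \<open>gser ^ (l + 1)\<close> around 1: \<open>P_poly k\<close> gives the
  coefficients of \<open>(gser - 1) ^ k\<close>. The term k = 0 lives in degree 0 only, hence the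
  condition \<open>t \<ge> 1\<close>.\<close>

lemma Q_poly_eq_Cf:
  assumes "t \<ge> 1"
  shows "(Q_poly l t :: 'r::comm_ring_1 free_alg) = Cf (Suc l) t"
proof -
  have of_nat_fps: "fps_nth (of_nat n * f) t = of_nat n * fps_nth f t" for n and f :: "'r free_alg fps"
    by (induction n) (simp_all add: distrib_right)
  have "(Cf (Suc l) t :: 'r free_alg) = fps_nth ((1 + (gser - 1)) ^ Suc l) t"
    by (simp add: Cf_def)
  also have "\<dots> = (\<Sum>k\<le>Suc l. of_nat (Suc l choose k) * P_poly k t)"
    unfolding binomial_expansion_1 by (simp only: fps_sum_nth of_nat_fps P_poly_fps)
  \<comment> \<open>An index range containing both cut-offs: the binomials vanish beyond
    \<open>l + 1\<close>, and \<open>P_poly k t\<close> vanishes for k beyond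
    \<open>t\<close>.\<close>
  also have "\<dots> = (\<Sum>k\<in>{1..Suc l + t}. of_nat (Suc l choose k) * P_poly k t)"
    by (rule sum.mono_neutral_cong) (use assms in \<open>auto simp: P_poly_0 not_le binomial_eq_0\<close>)
  also have "\<dots> = (\<Sum>k=1..t. of_nat (Suc l choose k) * P_poly k t)"
    by (rule sum.mono_neutral_right) (auto simp: P_poly_eq_0)
  finally show ?thesis by (simp add: Q_poly_def)
qed


section \<open>Hopf algebra identities on generators\<close>

definition gen0 :: "nat \<Rightarrow> 'r::comm_ring_1 free_alg" where
  "gen0 n = Cf (Suc 0) n"

lemma gen0_simps [simp]: "gen0 0 = 1" "n \<noteq> 0 \<Longrightarrow> gen0 n = gen n"
  by (simp_all add: gen0_def Cf_1)

lemma Cf_Suc_right: "Cf (Suc p) t = (\<Sum>i\<le>t. Cf p i * gen0 (t - i))"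
  using Cf_add[of p 1 t] by (simp add: gen0_def)

text \<open>The term \<open>m = 0\<close> is \<open>1 \<otimes> a_n\<close>, and since
  \<open>Cf p 0 = 1\<close> the term \<open>m = n\<close> is \<open>a_n \<otimes> 1\<close>.\<close>

lemma Delta_gen0:
  "Delta (gen0 n :: 'r::comm_ring_1 free_alg) = (\<Sum>m\<le>n. gen0 m \<otimes>\<^sub>T Cf (Suc m) (n - m))"
proof (cases "n = 0")
  case False
  have "Delta (gen0 n :: 'r free_alg) = gen n \<otimes>\<^sub>T 1 + 1 \<otimes>\<^sub>T gen n + (\<Sum>m\<in>{1..<n}. gen m \<otimes>\<^sub>T Q_poly m (n - m))"
    using False by (simp add: Delta_gen comult_gen_def pair_of_def lin_add lin_sum)
  also have "(\<Sum>m\<in>{1..<n}. gen m \<otimes>\<^sub>T (Q_poly m (n - m) :: 'r free_alg)) = (\<Sum>m\<in>{1..<n}. gen0 m \<otimes>\<^sub>T Cf (Suc m) (n - m))"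
    by (intro sum.cong) (auto simp: Q_poly_eq_Cf)
  also have "gen n \<otimes>\<^sub>T (1 :: 'r free_alg) + 1 \<otimes>\<^sub>T gen n + \<dots> = (\<Sum>m\<in>insert 0 (insert n {1..<n}). gen0 m \<otimes>\<^sub>T Cf (Suc m) (n - m))"
    using False by (simp add: Cf_1)
  also have "insert 0 (insert n {1..<n}) = {..n}" using False by auto
  finally show ?thesis .
qed simp

text \<open>Used for a product of two coproducts: \<open>i\<close> is the degree taken from the
  first of the two, of which \<open>m\<close> goes to the left tensor slot, and \<open>q\<close> is
  what the second one puts there. The new outer index \<open>M = m + q\<close> is the total degree
  of the left slot.\<close>

lemma sum_quad_reindex:
  fixes F :: "nat \<Rightarrow> nat \<Rightarrow> nat \<Rightarrow> nat \<Rightarrow> 'b::comm_monoid_add"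
  shows "(\<Sum>i\<le>t. \<Sum>m\<le>i. \<Sum>q\<le>t - i. F m q (i - m) (t - i - q)) =
    (\<Sum>M\<le>t. \<Sum>m\<le>M. \<Sum>r\<le>t - M. F m (M - m) r (t - M - r))"
proof -
  have "(\<Sum>i\<le>t. \<Sum>m\<le>i. \<Sum>q\<le>t - i. F m q (i - m) (t - i - q)) =
    (\<Sum>(i, m, q)\<in>(SIGMA i:{..t}. {..i} \<times> {..t - i}). F m q (i - m) (t - i - q))"
    by (simp add: sum.Sigma sum.cartesian_product)
  also have "\<dots> = (\<Sum>(M, m, r)\<in>(SIGMA M:{..t}. {..M} \<times> {..t - M}). F m (M - m) r (t - M - r))"
    by (rule sum.reindex_bij_witness[where i = "\<lambda>(M, m, r). (m + r, m, M - m)"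
          and j = "\<lambda>(i, m, q). (m + q, m, i - m)"])
      (auto simp: add.commute)
  also have "\<dots> = (\<Sum>M\<le>t. \<Sum>m\<le>M. \<Sum>r\<le>t - M. F m (M - m) r (t - M - r))"
    by (simp add: sum.Sigma sum.cartesian_product)
  finally show ?thesis .
qed

lemma sum_triangle_reindex:
  fixes F :: "nat \<Rightarrow> nat \<Rightarrow> 'b::comm_monoid_add"
  shows "(\<Sum>m\<le>n. \<Sum>l\<le>m. F l m) = (\<Sum>l\<le>n. \<Sum>j\<le>n - l. F l (l + j))"
proof -
  have "(\<Sum>m\<le>n. \<Sum>l\<le>m. F l m) = (\<Sum>(m, l)\<in>(SIGMA m:{..n}. {..m}). F l m)"
    by (simp add: sum.Sigma)
  also have "\<dots> = (\<Sum>(l, j)\<in>(SIGMA l:{..n}. {..n - l}). F l (l + j))"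
    by (rule sum.reindex_bij_witness[where i = "\<lambda>(l, j). (l + j, l)" and j = "\<lambda>(m, l). (l, m - l)"]) auto
  also have "\<dots> = (\<Sum>l\<le>n. \<Sum>j\<le>n - l. F l (l + j))"
    by (simp add: sum.Sigma)
  finally show ?thesis .
qed

text \<open>
  \<open>Cf p t\<close> is the coefficient of \<open>T\<^bsup>p+t\<^esup>\<close> in \<open>A\<^sup>p\<close>, where \<open>A = \<Sum> a\<^sub>n T\<^bsup>n+1\<^esup>\<close>. In these terms
  \<open>\<Delta> A = \<Sum> a\<^sub>m \<otimes> A\<^bsup>m+1\<^esup>\<close>, and as \<open>\<Delta>\<close> is multiplicative, \<open>\<Delta> (A\<^sup>p) = \<Sum> (A\<^sup>p)\<^sub>m \<otimes> A\<^sup>m\<close>.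
\<close>

lemma Delta_Cf:
  "Delta (Cf p t :: 'r::comm_ring_1 free_alg) = (\<Sum>m\<le>t. Cf p m \<otimes>\<^sub>T Cf (p + m) (t - m))"
proof (induction p arbitrary: t)
  case 0
  have "(\<Sum>m\<le>t. (Cf 0 m :: 'r free_alg) \<otimes>\<^sub>T (Cf (0 + m) (t - m) :: 'r free_alg)) =
      (\<Sum>m\<le>t. if m = 0 then 1 \<otimes>\<^sub>T Cf 0 t else 0)"
    by (rule sum.cong) auto
  then show ?case by auto
next
  case (Suc p)
  have "Delta (Cf (Suc p) t :: 'r free_alg) = (\<Sum>i\<le>t. Delta (Cf p i) * Delta (gen0 (t - i)))"
    by (simp add: Cf_Suc_right lin_sum Delta_mult)
  also have "\<dots> = (\<Sum>i\<le>t. \<Sum>m\<le>i. \<Sum>q\<le>t - i.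
      (Cf p m * gen0 q) \<otimes>\<^sub>T (Cf (p + m) (i - m) * Cf (Suc q) (t - i - q)))"
    by (simp add: Suc Delta_gen0 sum_product tens2_mult)
  also have "\<dots> = (\<Sum>M\<le>t. \<Sum>m\<le>M. \<Sum>r\<le>t - M.
      (Cf p m * gen0 (M - m)) \<otimes>\<^sub>T (Cf (p + m) r * Cf (Suc (M - m)) (t - M - r)))"
    by (rule sum_quad_reindex)
  also have "\<dots> = (\<Sum>M\<le>t. \<Sum>m\<le>M. (Cf p m * gen0 (M - m)) \<otimes>\<^sub>T Cf (Suc p + M) (t - M))"
  proof (intro sum.cong refl)
    fix M m :: nat assume "m \<in> {..M}"
    then have "Suc p + M = (p + m) + Suc (M - m)" by simp
    then show "(\<Sum>r\<le>t - M. (Cf p m * gen0 (M - m) :: 'r free_alg) \<otimes>\<^sub>T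
        (Cf (p + m) r * Cf (Suc (M - m)) (t - M - r) :: 'r free_alg)) =
        (Cf p m * gen0 (M - m)) \<otimes>\<^sub>T Cf (Suc p + M) (t - M)"
      unfolding tens2_sum_right[symmetric] by (simp only: Cf_add)
  qed
  also have "\<dots> = (\<Sum>M\<le>t. Cf (Suc p) M \<otimes>\<^sub>T Cf (Suc p + M) (t - M))"
    unfolding tens2_sum_left[symmetric] by (simp add: Cf_Suc_right)
  finally show ?case .
qed

section \<open>Coassociativity\<close>

definition assoc_left :: "(('a \<times> 'b) \<times> 'c \<Rightarrow>\<^sub>0 'r::comm_ring_1) \<Rightarrow> ('a \<times> 'b \<times> 'c \<Rightarrow>\<^sub>0 'r)" where
  "assoc_left = lin (\<lambda>((u, v), w). single (u, v, w) 1)"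

lemma assoc_left_tens: "assoc_left ((f \<otimes>\<^sub>T g) \<otimes>\<^sub>T h) = f \<otimes>\<^sub>T g \<otimes>\<^sub>T h"
  by (simp add: assoc_left_def tens2_def lin_lin)

lemma assoc_left_mult:
  "assoc_left (x * y :: ('a::monoid_add \<times> 'b::monoid_add) \<times> 'c::monoid_add \<Rightarrow>\<^sub>0 'r::comm_ring_1) =
     assoc_left x * assoc_left y"
  unfolding assoc_left_def by (rule lin_mult) (auto simp: mult_single)

text \<open>The maps \<open>\<Delta> \<otimes> id\<close> and \<open>id \<otimes> \<Delta>\<close>.\<close>

definition Delta_L :: "(nat list \<times> 'b \<Rightarrow>\<^sub>0 'r::comm_ring_1) \<Rightarrow> (nat list \<times> nat list \<times> 'b \<Rightarrow>\<^sub>0 'r)" where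
  "Delta_L = lin (\<lambda>(u, v). assoc_left (Delta_word u \<otimes>\<^sub>T single v 1))"

definition Delta_R :: "('b \<times> nat list \<Rightarrow>\<^sub>0 'r::comm_ring_1) \<Rightarrow> ('b \<times> nat list \<times> nat list \<Rightarrow>\<^sub>0 'r)" where
  "Delta_R = lin (\<lambda>(u, v). single u 1 \<otimes>\<^sub>T Delta_word v)"

lemma tens2_lin_left: "lin g f \<otimes>\<^sub>T h = lin (\<lambda>u. g u \<otimes>\<^sub>T h) f"
  by (simp add: tens2_def lin_lin)

lemma tens2_lin_right: "h \<otimes>\<^sub>T lin g f = lin (\<lambda>u. h \<otimes>\<^sub>T g u) f"
  unfolding tens2_def lin_lin by (rule lin_commute)

lemma assoc_left_lin: "assoc_left (lin g f) = lin (\<lambda>u. assoc_left (g u)) f"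
  by (simp add: assoc_left_def lin_lin)

lemma Delta_L_tens: "Delta_L (f \<otimes>\<^sub>T g) = assoc_left (Delta f \<otimes>\<^sub>T g)"
proof -
  have "lin (\<lambda>v. assoc_left (Delta_word u \<otimes>\<^sub>T single v 1)) g = assoc_left (Delta_word u \<otimes>\<^sub>T g)" for u
    by (simp flip: assoc_left_lin tens2_lin_right)
  then show ?thesis
    by (simp add: Delta_L_def lin_tens2 tens2_lin_left assoc_left_lin)
qed

lemma Delta_R_tens: "Delta_R (f \<otimes>\<^sub>T g) = f \<otimes>\<^sub>T Delta g"
proof -
  have "lin (\<lambda>v. single u 1 \<otimes>\<^sub>T Delta_word v) g = single u 1 \<otimes>\<^sub>T Delta g" for u :: 'a
    by (simp add: tens2_lin_right)
  then show ?thesis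
    by (simp add: Delta_R_def lin_tens2 flip: tens2_lin_left)
qed

lemma Delta_L_mult: "Delta_L (x * y) = Delta_L x * Delta_L (y :: nat list \<times> 'b::monoid_add \<Rightarrow>\<^sub>0 'r::comm_ring_1)"
  unfolding Delta_L_def
  by (rule lin_mult) (auto simp: Delta_word_append tens2_mult mult_single simp flip: assoc_left_mult)

lemma Delta_R_mult: "Delta_R (x * y) = Delta_R x * Delta_R (y :: 'b::monoid_add \<times> nat list \<Rightarrow>\<^sub>0 'r::comm_ring_1)"
  unfolding Delta_R_def
  by (rule lin_mult) (auto simp: Delta_word_append tens2_mult mult_single)

text \<open>With \<open>U l m = Cf (l + 1) (m - l)\<close>, the coproduct formula reads
  \<open>\<Delta>(U l n) = \<Sum> U l m \<otimes> U m n\<close>, so both sides are the sum of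
  \<open>U 0 l \<otimes> U l m \<otimes> U m n\<close> over
  \<open>l \<le> m \<le> n\<close>.\<close>

lemma coassoc_gen0: "Delta_L (Delta (gen0 n :: 'r::comm_ring_1 free_alg)) = Delta_R (Delta (gen0 n))"
proof -
  have add_L: "Delta_L (sum f I) = (\<Sum>i\<in>I. Delta_L (f i))"
    and add_R: "Delta_R (sum f I) = (\<Sum>i\<in>I. Delta_R (f i))"
    and add_A: "assoc_left (sum h I) = (\<Sum>i\<in>I. assoc_left (h i))"
    for f :: "nat \<Rightarrow> (nat list \<times> nat list \<Rightarrow>\<^sub>0 'r)"
      and h :: "nat \<Rightarrow> ((nat list \<times> nat list) \<times> nat list \<Rightarrow>\<^sub>0 'r)" and I
    by (simp_all add: Delta_L_def Delta_R_def assoc_left_def lin_sum)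
  have "Delta_L (Delta (gen0 n :: 'r free_alg)) =
      (\<Sum>m\<le>n. \<Sum>l\<le>m. gen0 l \<otimes>\<^sub>T Cf (Suc l) (m - l) \<otimes>\<^sub>T Cf (Suc m) (n - m))"
    by (simp add: Delta_gen0 add_L Delta_L_tens tens2_sum_left add_A assoc_left_tens)
  also have "\<dots> = (\<Sum>l\<le>n. \<Sum>j\<le>n - l. gen0 l \<otimes>\<^sub>T Cf (Suc l) j \<otimes>\<^sub>T Cf (Suc (l + j)) (n - l - j))"
    by (subst sum_triangle_reindex) simp
  also have "\<dots> = Delta_R (Delta (gen0 n))"
    by (simp add: Delta_gen0 add_R Delta_R_tens Delta_Cf tens2_sum_right)
  finally show ?thesis .
qed

text \<open>The letter 0 lies outside every \<open>letters \<nu>\<close>, but the Hopf identities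
  are proved on all words. As \<open>gen0 0\<close> is 1, the formulas for \<open>gen0\<close> do
  not cover \<open>gen 0\<close>, which is simply primitive.\<close>

lemma Delta_gen_0: "Delta (gen 0 :: 'r::comm_ring_1 free_alg) = gen 0 \<otimes>\<^sub>T 1 + 1 \<otimes>\<^sub>T gen 0"
  by (simp add: Delta_gen comult_gen_def pair_of_def lin_add)

lemma assoc_left_one [simp]:
  "assoc_left (1 :: ('a::monoid_add \<times> 'b::monoid_add) \<times> 'c::monoid_add \<Rightarrow>\<^sub>0 'r::comm_ring_1) = 1"
  using assoc_left_tens[of "1 :: 'a \<Rightarrow>\<^sub>0 'r" "1 :: 'b \<Rightarrow>\<^sub>0 'r" "1 :: 'c \<Rightarrow>\<^sub>0 'r"] by simp

lemma assoc_left_add: "assoc_left (x + y) = assoc_left x + assoc_left y"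
  by (simp add: assoc_left_def lin_add)

lemma Delta_L_add: "Delta_L (x + y) = Delta_L x + Delta_L y"
  and Delta_R_add: "Delta_R (z + w) = Delta_R z + Delta_R w"
  by (simp_all add: Delta_L_def Delta_R_def lin_add)

lemma coassoc_gen: "Delta_L (Delta (gen n :: 'r::comm_ring_1 free_alg)) = Delta_R (Delta (gen n))"
proof (cases "n = 0")
  case True
  then show ?thesis
    by (simp add: Delta_gen_0 Delta_L_add Delta_R_add Delta_L_tens Delta_R_tens tens2_add_left
        tens2_add_right assoc_left_tens assoc_left_add add.assoc flip: tens2_one)
next
  case False
  then show ?thesis using coassoc_gen0[of n] by simp
qed

lemma coassoc: "Delta_L (Delta f) = Delta_R (Delta (f :: 'r::comm_ring_1 free_alg))"
proof (rule linear_ext[where F = "\<lambda>f. Delta_L (Delta f)" and G = "\<lambda>f. Delta_R (Delta f)"])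
  fix w
  show "Delta_L (Delta (single w 1 :: 'r free_alg)) = Delta_R (Delta (single w 1))"
  proof (induction w)
    case Nil
    have "Delta_L (1 \<otimes>\<^sub>T 1 :: nat list \<times> nat list \<Rightarrow>\<^sub>0 'r) = 1" "Delta_R (1 \<otimes>\<^sub>T 1 :: nat list \<times> nat list \<Rightarrow>\<^sub>0 'r) = 1"
      by (simp_all only: Delta_L_tens Delta_R_tens Delta_one) simp_all
    then show ?case by simp
  next
    case (Cons n w)
    then show ?case
      by (simp only: single_Cons Delta_mult Delta_L_mult Delta_R_mult coassoc_gen)
  qed
qed (simp_all add: lin_add lin_scale Delta_L_def Delta_R_def)

section \<open>Counit and antipode\<close>

definition eps_L :: "(nat list \<times> 'b \<Rightarrow>\<^sub>0 'r::comm_ring_1) \<Rightarrow> ('b \<Rightarrow>\<^sub>0 'r)" where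
  "eps_L = lin (\<lambda>(u, v). if u = [] then single v 1 else 0)"

definition eps_R :: "('b \<times> nat list \<Rightarrow>\<^sub>0 'r::comm_ring_1) \<Rightarrow> ('b \<Rightarrow>\<^sub>0 'r)" where
  "eps_R = lin (\<lambda>(u, v). if v = [] then single u 1 else 0)"

lemma eps_L_tens: "eps_L (f \<otimes>\<^sub>T g) = scale (eps f) g"
  by (induction f rule: poly_mapping_linear_induct)
    (simp_all add: eps_L_def tens2_add_left lin_add scale_add_left lin_tens2)

lemma eps_R_tens: "eps_R (f \<otimes>\<^sub>T g) = scale (eps g) f"
proof (induction g rule: poly_mapping_linear_induct)
  case (single w c)
  then show ?case
    by (induction f rule: poly_mapping_linear_induct)
      (simp_all add: eps_R_def tens2_add_left lin_add scale_add_right mult.commute)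
qed (simp_all add: eps_R_def tens2_add_right lin_add scale_add_left)

lemma eps_L_mult: "eps_L (x * y) = eps_L x * eps_L (y :: nat list \<times> 'b::monoid_add \<Rightarrow>\<^sub>0 'r::comm_ring_1)"
  unfolding eps_L_def by (rule lin_mult) (auto simp: plus_list_def mult_single)

lemma eps_R_mult: "eps_R (x * y) = eps_R x * eps_R (y :: 'b::monoid_add \<times> nat list \<Rightarrow>\<^sub>0 'r::comm_ring_1)"
  unfolding eps_R_def by (rule lin_mult) (auto simp: plus_list_def mult_single)

lemma eps_L_sum: "eps_L (sum f I) = (\<Sum>i\<in>I. eps_L (f i))"
  and eps_R_sum: "eps_R (sum g I) = (\<Sum>i\<in>I. eps_R (g i))"
  by (simp_all add: eps_L_def eps_R_def lin_sum)

lemma eps_L_Delta_gen: "eps_L (Delta (gen n)) = (gen n :: 'r::comm_ring_1 free_alg)"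
proof (cases "n = 0")
  case True
  have "eps_L (gen 0 \<otimes>\<^sub>T 1 + 1 \<otimes>\<^sub>T gen 0) = (gen 0 :: 'r free_alg)"
    using eps_L_tens[of "gen 0" "1 :: 'r free_alg"] eps_L_tens[of 1 "gen 0 :: 'r free_alg"]
    by (simp add: eps_L_def lin_add)
  with True show ?thesis by (simp add: Delta_gen_0)
next
  case False
  have "eps_L (Delta (gen0 n :: 'r free_alg)) = (\<Sum>m\<le>n. if m = 0 then gen0 n else 0)"
    unfolding Delta_gen0 eps_L_sum by (rule sum.cong) (auto simp: eps_L_tens gen0_def eps_Cf)
  with False show ?thesis by simp
qed

lemma eps_R_Delta_gen: "eps_R (Delta (gen n)) = (gen n :: 'r::comm_ring_1 free_alg)"
proof (cases "n = 0")
  case True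
  have "eps_R (gen 0 \<otimes>\<^sub>T 1 + 1 \<otimes>\<^sub>T gen 0) = (gen 0 :: 'r free_alg)"
    using eps_R_tens[of "gen 0 :: 'r free_alg" 1] eps_R_tens[of "1 :: 'r free_alg" "gen 0"]
    by (simp add: eps_R_def lin_add)
  with True show ?thesis by (simp add: Delta_gen_0)
next
  case False
  have "eps_R (Delta (gen0 n :: 'r free_alg)) = (\<Sum>m\<le>n. if m = n then gen0 n else 0)"
    unfolding Delta_gen0 eps_R_sum by (rule sum.cong) (auto simp: eps_R_tens eps_Cf)
  with False show ?thesis by simp
qed

lemma eps_L_Delta [simp]: "eps_L (Delta f) = (f :: 'r::comm_ring_1 free_alg)"
proof (rule linear_ext[where G = "\<lambda>f. f"])
  fix w
  show "eps_L (Delta (single w 1)) = (single w 1 :: 'r free_alg)"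
  proof (induction w)
    case Nil
    show ?case using eps_L_tens[of 1 "1 :: 'r free_alg"] by simp
  qed (simp only: single_Cons Delta_mult eps_L_mult eps_L_Delta_gen)
qed (simp_all add: eps_L_def lin_add lin_scale)

lemma eps_R_Delta [simp]: "eps_R (Delta f) = (f :: 'r::comm_ring_1 free_alg)"
proof (rule linear_ext[where G = "\<lambda>f. f"])
  fix w
  show "eps_R (Delta (single w 1)) = (single w 1 :: 'r free_alg)"
  proof (induction w)
    case Nil
    show ?case using eps_R_tens[of "1 :: 'r free_alg" 1] by simp
  qed (simp only: single_Cons Delta_mult eps_R_mult eps_R_Delta_gen)
qed (simp_all add: eps_R_def lin_add lin_scale)

text \<open>The maps \<open>m (S \<otimes> id)\<close> and \<open>m (id \<otimes> S)\<close>.\<close>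

definition conv_L :: "(nat list \<times> nat list \<Rightarrow>\<^sub>0 'r::comm_ring_1) \<Rightarrow> 'r free_alg" where
  "conv_L = lin (\<lambda>(u, v). antipode_word u * single v 1)"

definition conv_R :: "(nat list \<times> nat list \<Rightarrow>\<^sub>0 'r::comm_ring_1) \<Rightarrow> 'r free_alg" where
  "conv_R = lin (\<lambda>(u, v). single u 1 * antipode_word v)"

lemma conv_L_add: "conv_L (x + y) = conv_L x + conv_L y"
  and conv_R_add: "conv_R (x + y) = conv_R x + conv_R y"
  and conv_L_scale: "conv_L (scale c x) = scale c (conv_L x)"
  and conv_R_scale: "conv_R (scale c x) = scale c (conv_R x)"
  and conv_L_sum: "conv_L (sum f I) = (\<Sum>i\<in>I. conv_L (f i))"
  and conv_R_sum: "conv_R (sum f I) = (\<Sum>i\<in>I. conv_R (f i))"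
  and conv_L_zero [simp]: "conv_L 0 = 0" and conv_R_zero [simp]: "conv_R 0 = 0"
  by (simp_all add: conv_L_def conv_R_def lin_add lin_sum lin_scale)

lemma mult_single_right: "x * single w c =
    scale c (x * single w (1 :: 'r::comm_ring_1) :: 'b::monoid_add \<Rightarrow>\<^sub>0 'r)"
  by (simp flip: scale_mult_right)

lemma mult_single_left: "single w c * x =
    scale c (single w (1 :: 'r::comm_ring_1) * x :: 'b::monoid_add \<Rightarrow>\<^sub>0 'r)"
  by (simp flip: scale_mult_left)

lemma conv_L_tens: "conv_L (f \<otimes>\<^sub>T g) = antip f * g"
proof (induction f rule: poly_mapping_linear_induct)
  case (single u c)
  show ?case
  proof (induction g rule: poly_mapping_linear_induct)
    case (single v d)
    show ?case
      by (subst mult_single_right) (simp add: conv_L_def scale_mult_left mult.commute)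
  qed (simp_all add: tens2_add_right conv_L_add distrib_left)
qed (simp_all add: tens2_add_left conv_L_add lin_add distrib_right)

lemma conv_R_tens: "conv_R (f \<otimes>\<^sub>T g) = f * antip g"
proof (induction g rule: poly_mapping_linear_induct)
  case (single u c)
  show ?case
  proof (induction f rule: poly_mapping_linear_induct)
    case (single v d)
    show ?case
      by (subst mult_single_left) (simp add: conv_R_def scale_mult_right mult.commute)
  qed (simp_all add: tens2_add_left conv_R_add distrib_right)
qed (simp_all add: tens2_add_right conv_R_add lin_add distrib_left)

lemma single_plus: "single (u + v) 1 =
    (single u 1 * single v 1 :: 'b::monoid_add \<Rightarrow>\<^sub>0 'r::comm_ring_1)"
  by (simp add: mult_single)

text \<open>\<open>antipode_word\<close> reverses products, so \<open>u\<close> leaves on the far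
  left and \<open>v\<close> on the far right, with \<open>conv_L x\<close> between them.\<close>

lemma conv_L_mult_single:
  "conv_L (x * single (u, v) 1) = antipode_word u * conv_L x * single v 1"
proof (induction x rule: poly_mapping_linear_induct)
  case (single w c)
  obtain a b where w: "w = (a, b)" by force
  have "conv_L (single w c * single (u, v) 1) =
      scale c (antipode_word (a + u) * single (b + v) 1)"
    by (simp add: w mult_single conv_L_def)
  also have "\<dots> = antipode_word u * conv_L (single w c) * single v 1"
    by (simp only: w antipode_word_append single_plus)
      (simp add: conv_L_def scale_mult_left scale_mult_right mult.assoc)
  finally show ?case .
qed (simp_all add: distrib_left distrib_right conv_L_add)

lemma conv_R_single_mult:
  "conv_R (single (u, v) 1 * x) = single u 1 * conv_R x * antipode_word v"
proof (induction x rule: poly_mapping_linear_induct)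
  case (single w c)
  obtain a b where w: "w = (a, b)" by force
  have "conv_R (single (u, v) 1 * single w c) =
      scale c (single (u + a) 1 * antipode_word (v + b))"
    by (simp add: w mult_single conv_R_def)
  also have "\<dots> = single u 1 * conv_R (single w c) * antipode_word v"
    by (simp only: w antipode_word_append single_plus)
      (simp add: conv_R_def scale_mult_left scale_mult_right mult.assoc)
  finally show ?case .
qed (simp_all add: distrib_left distrib_right conv_R_add)

text \<open>By \<open>conv_L_mult_single\<close> the kernel of \<open>conv_L\<close> is a right
  ideal. As \<Delta> is multiplicative, the left antipode identity on a word needs only its first
  letter; the kernel of \<open>conv_R\<close> is a left ideal, and there the last letter
  decides.\<close>

lemma conv_L_mult_zero:
  assumes "conv_L x = 0"
  shows "conv_L (x * y) = 0"
proof (induction y rule: poly_mapping_linear_induct)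
  case (single w c)
  obtain a b where w: "w = (a, b)" by force
  show ?case
    by (subst mult_single_right) (simp add: conv_L_scale w conv_L_mult_single assms)
qed (simp_all add: distrib_left conv_L_add)

lemma conv_R_mult_zero:
  assumes "conv_R x = 0"
  shows "conv_R (y * x) = 0"
proof (induction y rule: poly_mapping_linear_induct)
  case (single w c)
  obtain a b where w: "w = (a, b)" by force
  show ?case
    by (subst mult_single_left) (simp add: conv_R_scale w conv_R_single_mult assms)
qed (simp_all add: distrib_right conv_R_add)

lemma conv_one: "conv_L 1 = 1" "conv_R 1 = 1"
  by (simp_all add: conv_L_tens conv_R_tens flip: tens2_one)

lemma antip_gen_0: "antip (gen 0 :: 'r::comm_ring_1 free_alg) = - gen 0"
  by (simp add: antip_gen antipode_gen.simps[of 0])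

lemma conv_L_gen: "conv_L (Delta (gen n :: 'r::comm_ring_1 free_alg)) = 0"
proof (cases "n = 0")
  case True
  then show ?thesis
    by (simp add: Delta_gen_0 conv_L_add conv_L_tens antip_gen_0)
next
  case False
  have "conv_L (Delta (gen n :: 'r free_alg)) = antip (gen n) + gen n + (\<Sum>m\<in>{1..<n}. antip (gen m) * Q_poly m (n - m))"
    by (simp add: Delta_gen comult_gen_def pair_of_def lin_add lin_sum conv_L_add conv_L_sum conv_L_tens)
  also have "\<dots> = 0"
    by (simp add: antip_gen antipode_gen.simps[of n])
  finally show ?thesis .
qed

lemma conv_L_Delta: "conv_L (Delta f) = scale (eps f) (1 :: 'r::comm_ring_1 free_alg)"
proof (rule linear_ext[where F = "\<lambda>f. conv_L (Delta f)" and G = "\<lambda>f. scale (eps f) 1"])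
  fix w
  show "conv_L (Delta (single w 1)) = scale (eps (single w 1)) (1 :: 'r free_alg)"
  proof (cases w)
    case (Cons n v)
    have "conv_L (Delta (gen n * single v 1 :: 'r free_alg)) = 0"
      unfolding Delta_mult by (intro conv_L_mult_zero conv_L_gen)
    with Cons show ?thesis by (simp flip: single_Cons)
  qed (simp add: conv_one)
qed (simp_all add: lin_add lin_scale scale_add_left conv_L_add conv_L_scale)

text \<open>
  The matrix \<open>U\<^sub>l\<^sub>m\<close> of the coefficients of \<open>T\<^bsup>m+1\<^esup>\<close> in \<open>A\<^bsup>l+1\<^esup>\<close> is unitriangular, and by the left antipode
  identity \<open>S(U) U = 1\<close>; hence \<open>U S(U) = 1\<close>, whose first row is the right antipode identity on generators.
\<close>

lemma conv_R_gen0: "conv_R (Delta (gen0 n :: 'r::comm_ring_1 free_alg)) = (if n = 0 then 1 else 0)"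
proof (induction n rule: less_induct)
  case (less p)
  define U :: "nat \<Rightarrow> nat \<Rightarrow> 'r free_alg" where "U = (\<lambda>l m. Cf (Suc l) (m - l))"
  define W where "W = (\<lambda>n. \<Sum>m\<le>n. U 0 m * antip (U m n))"
  have W: "conv_R (Delta (gen0 n :: 'r free_alg)) = W n" for n
    by (simp add: Delta_gen0 conv_R_sum conv_R_tens W_def U_def flip: gen0_def)
  have YX: "(\<Sum>j\<le>n - m. antip (U m (m + j)) * U (m + j) n) = (if m = n then 1 else 0)" if "m \<le> n" for m n
  proof -
    have "(\<Sum>j\<le>n - m. antip (U m (m + j)) * U (m + j) n) = conv_L (Delta (U m n))"
      using that by (simp add: U_def Delta_Cf conv_L_sum conv_L_tens)
    also have "\<dots> = (if m = n then 1 else 0)"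
      using that by (simp add: conv_L_Delta U_def eps_Cf)
    finally show ?thesis .
  qed
  have "(\<Sum>n\<le>p. W n * U n p) = (\<Sum>n\<le>p. \<Sum>m\<le>n. U 0 m * (antip (U m n) * U n p))"
    by (simp add: W_def sum_distrib_right mult.assoc)
  also have "\<dots> = (\<Sum>m\<le>p. U 0 m * (\<Sum>j\<le>p - m. antip (U m (m + j)) * U (m + j) p))"
    by (subst sum_triangle_reindex) (simp add: sum_distrib_left)
  also have "\<dots> = (\<Sum>m\<le>p. if m = p then U 0 p else 0)"
    by (rule sum.cong) (auto simp: YX)
  also have "\<dots> = U 0 p" by simp
  finally have sum_W: "(\<Sum>n\<le>p. W n * U n p) = U 0 p" .
  show ?case
  proof (cases "p = 0")
    case True
    then show ?thesis using sum_W W[of 0] by (simp add: U_def)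
  next
    case False
    have "(\<Sum>n\<le>p. W n * U n p) = (\<Sum>n<p. W n * U n p) + W p"
      by (simp add: U_def flip: lessThan_Suc_atMost)
    also have "(\<Sum>n<p. W n * U n p) = (\<Sum>n<p. if n = 0 then U 0 p else 0)"
      by (rule sum.cong) (use less W in auto)
    also have "\<dots> = U 0 p" using False by simp
    finally show ?thesis using sum_W W[of p] False by simp
  qed
qed

lemma conv_R_gen: "conv_R (Delta (gen n :: 'r::comm_ring_1 free_alg)) = 0"
proof (cases "n = 0")
  case True
  then show ?thesis
    by (simp add: Delta_gen_0 conv_R_add conv_R_tens antip_gen_0)
next
  case False
  then show ?thesis using conv_R_gen0[of n] by simp
qed

lemma conv_R_Delta: "conv_R (Delta f) = scale (eps f) (1 :: 'r::comm_ring_1 free_alg)"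
proof (rule linear_ext[where F = "\<lambda>f. conv_R (Delta f)" and G = "\<lambda>f. scale (eps f) 1"])
  fix w
  show "conv_R (Delta (single w 1)) = scale (eps (single w 1)) (1 :: 'r free_alg)"
  proof (induction w rule: rev_induct)
    case (snoc n w)
    have *: "single (w @ [n]) 1 = (single w 1 * gen n :: 'r free_alg)"
      by (simp only: single_append gen_def)
    have "conv_R (Delta (single w 1 * gen n :: 'r free_alg)) = 0"
      unfolding Delta_mult by (intro conv_R_mult_zero conv_R_gen)
    then show ?case by (simp flip: *)
  qed (simp add: conv_one)
qed (simp_all add: lin_add lin_scale scale_add_left conv_R_add conv_R_scale)


section \<open>Tensors in a basis\<close>

lemma module_scale: "Modules.module (scale :: 'r::comm_ring_1 \<Rightarrow> ('b \<Rightarrow>\<^sub>0 'r) \<Rightarrow> _)"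
  by unfold_locales (simp_all add: scale_add_right scale_add_left)

lemma tensor_eq_refl [simp]: "tensor_eq M n s s"
  by (simp add: tensor_eq_def Modules.module.span_zero[OF module_scale])

lemma tensor_eq_sym: "tensor_eq M n s t \<Longrightarrow> tensor_eq M n t s"
  unfolding tensor_eq_def using Modules.module.span_neg[OF module_scale] by fastforce

lemma tensor_eq_trans [trans]: "tensor_eq M n s t \<Longrightarrow> tensor_eq M n t u \<Longrightarrow> tensor_eq M n s u"
  unfolding tensor_eq_def using Modules.module.span_add[OF module_scale, of "s - t" _ "t - u"] by simp

lemma tensor_eq_add: "tensor_eq M n s t \<Longrightarrow> tensor_eq M n s' t' \<Longrightarrow> tensor_eq M n (s + s') (t + t')"
  unfolding tensor_eq_def using Modules.module.span_add[OF module_scale, of "s - t" _ "s' - t'"]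
  by (simp add: algebra_simps)

lemma tensor_eq_scale: "tensor_eq M n s t \<Longrightarrow> tensor_eq M n (scale c s) (scale c t)"
  unfolding tensor_eq_def using Modules.module.span_scale[OF module_scale, of "s - t" _ c]
  by (simp add: scale_diff_right)

lemma tensor_eq_sum:
  "(\<And>i. i \<in> I \<Longrightarrow> tensor_eq M n (f i) (g i)) \<Longrightarrow> tensor_eq M n (sum f I) (sum g I)"
  by (induction I rule: infinite_finite_induct) (simp_all add: tensor_eq_add)

lemma tensor_eq_lin:
  "(\<And>w. w \<in> keys x \<Longrightarrow> tensor_eq M n (g w) (h w)) \<Longrightarrow> tensor_eq M n (lin g x) (lin h x)"
  unfolding lin_def by (intro tensor_eq_sum tensor_eq_scale) simp

lemma tensor_eq_single_add:
  assumes "set (pre @ rest) \<subseteq> carrier M" "length (pre @ rest) + 1 = n" "x \<in> carrier M" "y \<in> carrier M"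
  shows "tensor_eq M n (single (pre @ (x \<oplus>\<^bsub>M\<^esub> y) # rest) 1)
    (single (pre @ x # rest) 1 + single (pre @ y # rest) 1)"
proof -
  let ?xs = "pre @ x # rest"
  have "single (?xs[length pre := x \<oplus>\<^bsub>M\<^esub> y]) 1
      - single (?xs[length pre := x]) 1 - single (?xs[length pre := y]) 1
      \<in> multilinear_relators M n"
    unfolding multilinear_relators_def
    by (rule UnI1, rule CollectI, intro exI[of _ ?xs] exI[of _ "length pre"] exI[of _ x] exI[of _ y])
      (use assms in \<open>auto simp: tuples_def\<close>)
  from Modules.module.span_base[OF module_scale this] show ?thesis
    by (simp add: tensor_eq_def diff_diff_eq)
qed

lemma tensor_eq_single_smult:
  assumes "set (pre @ rest) \<subseteq> carrier M" "length (pre @ rest) + 1 = n" "x \<in> carrier M"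
  shows "tensor_eq M n (single (pre @ (c \<odot>\<^bsub>M\<^esub> x) # rest) 1)
    (single (pre @ x # rest) c)"
proof -
  let ?xs = "pre @ x # rest"
  have "single (?xs[length pre := c \<odot>\<^bsub>M\<^esub> x]) 1
      - single (?xs[length pre := x]) c \<in> multilinear_relators M n"
    unfolding multilinear_relators_def
    by (rule UnI2, rule CollectI, intro exI[of _ ?xs] exI[of _ "length pre"] exI[of _ x] exI[of _ c])
      (use assms in \<open>auto simp: tuples_def\<close>)
  from Modules.module.span_base[OF module_scale this] show ?thesis
    by (simp add: tensor_eq_def)
qed

definition cons_tens :: "('b \<times> 'b list \<Rightarrow>\<^sub>0 'r::comm_ring_1) \<Rightarrow> ('b list \<Rightarrow>\<^sub>0 'r)" where
  "cons_tens = lin (\<lambda>(w, ws). single (w # ws) 1)"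

primrec wtens :: "('b \<Rightarrow>\<^sub>0 'r::comm_ring_1) list \<Rightarrow> ('b list \<Rightarrow>\<^sub>0 'r)" where
  "wtens [] = single [] 1"
| "wtens (f # fs) = cons_tens (f \<otimes>\<^sub>T wtens fs)"

lemma cons_tens_add: "cons_tens (x + y) = cons_tens x + cons_tens y"
  and cons_tens_scale: "cons_tens (scale c x) = scale c (cons_tens x)"
  and cons_tens_zero [simp]: "cons_tens 0 = 0"
  and cons_tens_single [simp]: "cons_tens (single (w, ws) c) = single (w # ws) c"
  by (simp_all add: cons_tens_def lin_add lin_scale)

lemma lookup_cons_tens [simp]:
  "lookup (cons_tens x) (w # ws) = lookup x (w, ws)"
  "lookup (cons_tens x) [] = 0"
  by (induction x rule: poly_mapping_linear_induct)
    (auto simp: cons_tens_add lookup_add lookup_single when_def split: if_splits)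

lemma lookup_wtens:
  "lookup (wtens fs) ws =
    (if length ws = length fs then prod_list (map2 lookup fs ws) else 0)"
proof (induction fs arbitrary: ws)
  case Nil
  then show ?case by (auto simp: lookup_single when_def)
next
  case (Cons f fs)
  then show ?case by (cases ws) auto
qed

lemma wtens_update_add:
  "i < length fs \<Longrightarrow> wtens (fs[i := f + g]) = wtens (fs[i := f]) + wtens (fs[i := g])"
  by (induction fs arbitrary: i)
    (auto split: nat.splits simp: tens2_add_left tens2_add_right cons_tens_add)

lemma wtens_update_scale: "i < length fs \<Longrightarrow> wtens (fs[i := scale c f]) = scale c (wtens (fs[i := f]))"
  by (induction fs arbitrary: i)
    (auto split: nat.splits simp: tens2_scale_left tens2_scale_right cons_tens_scale)

text \<open>Coordinates of a formal tensor on lists of words, the invariant that decides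
  \<open>tensor_eq\<close> (see \<open>tensor_eq_iff\<close>).\<close>

definition tvec :: "('a \<Rightarrow> ('b \<Rightarrow>\<^sub>0 'r)) \<Rightarrow> ('a list \<Rightarrow>\<^sub>0 'r) \<Rightarrow> ('b list \<Rightarrow>\<^sub>0 'r::comm_ring_1)" where
  "tvec \<phi> = lin (\<lambda>xs. wtens (map \<phi> xs))"

lemma tvec_add: "tvec \<phi> (s + t) = tvec \<phi> s + tvec \<phi> t"
  and tvec_diff: "tvec \<phi> (s - t) = tvec \<phi> s - tvec \<phi> t"
  and tvec_scale: "tvec \<phi> (scale c s) = scale c (tvec \<phi> s)"
  and tvec_zero [simp]: "tvec \<phi> 0 = 0"
  and tvec_single [simp]: "tvec \<phi> (single xs c) = scale c (wtens (map \<phi> xs))"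
  by (simp_all add: tvec_def lin_add lin_diff lin_scale)

definition list_of_pair :: "('b \<times> 'b \<Rightarrow>\<^sub>0 'r::comm_ring_1) \<Rightarrow> ('b list \<Rightarrow>\<^sub>0 'r)" where
  "list_of_pair = lin (\<lambda>(u, v). single [u, v] 1)"

definition list_of_triple :: "('b \<times> 'b \<times> 'b \<Rightarrow>\<^sub>0 'r::comm_ring_1) \<Rightarrow> ('b list \<Rightarrow>\<^sub>0 'r)" where
  "list_of_triple = lin (\<lambda>(u, v, w). single [u, v, w] 1)"

definition triple_of :: "('a \<Rightarrow> 'r::comm_ring_1 free_alg) \<Rightarrow> ('a list \<Rightarrow>\<^sub>0 'r) \<Rightarrow> (nat list \<times> nat list \<times> nat list \<Rightarrow>\<^sub>0 'r)" where
  "triple_of \<phi> = lin (\<lambda>xs. \<phi> (xs ! 0) \<otimes>\<^sub>T \<phi> (xs ! 1) \<otimes>\<^sub>T \<phi> (xs ! 2))"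

lemma lookup_list_of_pair: "lookup (list_of_pair x) [u, v] = lookup x (u, v)"
  by (induction x rule: poly_mapping_linear_induct)
    (auto simp: list_of_pair_def lin_add lookup_add lookup_single when_def split: if_splits)

lemma list_of_pair_inject: "list_of_pair x = list_of_pair y \<longleftrightarrow> x = y"
proof
  assume eq: "list_of_pair x = list_of_pair y"
  show "x = y"
  proof (rule poly_mapping_eqI)
    fix p
    show "lookup x p = lookup y p"
      by (cases p) (simp add: eq flip: lookup_list_of_pair)
  qed
qed simp

lemma wtens_2: "wtens [f, g] = list_of_pair (f \<otimes>\<^sub>T g)"
  by (simp add: list_of_pair_def cons_tens_def lin_tens2 lin_lin)

lemma wtens_3: "wtens [f, g, h] = list_of_triple (f \<otimes>\<^sub>T g \<otimes>\<^sub>T h)"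
  by (simp add: list_of_triple_def cons_tens_def lin_tens2 lin_lin)

lemma tvec_pair: "s \<in> tensors L 2 \<Longrightarrow> tvec \<phi> s = list_of_pair (pair_of \<phi> s)"
  unfolding tvec_def pair_of_def list_of_pair_def lin_lin
  by (rule lin_cong)
    (auto simp: tensors_def wtens_2 list_of_pair_def simp del: wtens.simps dest!: subsetD elim!: tuples_2E)

lemma tvec_triple: "s \<in> tensors L 3 \<Longrightarrow> tvec \<phi> s = list_of_triple (triple_of \<phi> s)"
  unfolding tvec_def triple_of_def list_of_triple_def lin_lin
proof (rule lin_cong)
  fix xs assume "s \<in> tensors L 3" "xs \<in> keys s"
  then have "length xs = Suc (Suc (Suc 0))" by (auto simp: tensors_def tuples_def)
  then obtain x y z where "xs = [x, y, z]" unfolding length_Suc_conv by auto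
  then show "wtens (map \<phi> xs) = lin (\<lambda>(u, v, w). single [u, v, w] 1)
      (\<phi> (xs ! 0) \<otimes>\<^sub>T \<phi> (xs ! 1) \<otimes>\<^sub>T \<phi> (xs ! 2))"
    using wtens_3[of "\<phi> x" "\<phi> y" "\<phi> z"] by (simp add: list_of_triple_def)
qed

text \<open>The hypotheses under which coordinates decide equality of tensors: a linear bijection
  onto a free module. The bijection is \<open>id\<close> for H and the map induced by evaluation at
  1 for the specialization.\<close>

locale free_module_model =
  fixes A :: "('r::comm_ring_1, 'a, 'm) module_scheme" and \<phi> :: "'a \<Rightarrow> 'r free_alg" and \<nu> :: enat
  assumes bij: "bij_betw \<phi> (carrier A) (words \<nu>)"
    and add_closed: "x \<in> carrier A \<Longrightarrow> y \<in> carrier A \<Longrightarrow> x \<oplus>\<^bsub>A\<^esub> y \<in> carrier A"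
    and smult_closed: "x \<in> carrier A \<Longrightarrow> c \<odot>\<^bsub>A\<^esub> x \<in> carrier A"
    and map_add: "x \<in> carrier A \<Longrightarrow> y \<in> carrier A \<Longrightarrow> \<phi> (x \<oplus>\<^bsub>A\<^esub> y) = \<phi> x + \<phi> y"
    and map_smult: "x \<in> carrier A \<Longrightarrow> \<phi> (c \<odot>\<^bsub>A\<^esub> x) = scale c (\<phi> x)"
begin

definition inv_map :: "'r free_alg \<Rightarrow> 'a" where
  "inv_map = inv_into (carrier A) \<phi>"

lemma map_closed: "x \<in> carrier A \<Longrightarrow> \<phi> x \<in> words \<nu>"
  using bij by (auto simp: bij_betw_def)

lemma inv_map_closed: "f \<in> words \<nu> \<Longrightarrow> inv_map f \<in> carrier A"
  using bij by (metis bij_betw_def inv_into_into inv_map_def)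

lemma map_inv_map: "f \<in> words \<nu> \<Longrightarrow> \<phi> (inv_map f) = f"
  using bij by (metis bij_betw_def f_inv_into_f inv_map_def)

lemma inv_map_map: "x \<in> carrier A \<Longrightarrow> inv_map (\<phi> x) = x"
  using bij by (simp add: bij_betw_inv_into_left inv_map_def)

lemma map_inject: "x \<in> carrier A \<Longrightarrow> y \<in> carrier A \<Longrightarrow> \<phi> x = \<phi> y \<Longrightarrow> x = y"
  using bij by (auto simp: bij_betw_def inj_on_def)

lemma inv_map_add: "f \<in> words \<nu> \<Longrightarrow> g \<in> words \<nu> \<Longrightarrow> inv_map (f + g) = inv_map f \<oplus>\<^bsub>A\<^esub> inv_map g"
  using inv_map_map[of "inv_map f \<oplus>\<^bsub>A\<^esub> inv_map g"]
  by (simp add: add_closed inv_map_closed map_add map_inv_map)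

lemma inv_map_scale: "f \<in> words \<nu> \<Longrightarrow> inv_map (scale c f) = c \<odot>\<^bsub>A\<^esub> inv_map f"
  using inv_map_map[of "c \<odot>\<^bsub>A\<^esub> inv_map f"]
  by (simp add: smult_closed inv_map_closed map_smult map_inv_map)

lemma tensor_eq_expand_at:
  assumes "set (pre @ rest) \<subseteq> carrier A" "length (pre @ rest) + 1 = n" "f \<in> words \<nu>"
  shows "tensor_eq A n (single (pre @ inv_map f # rest) 1)
    (lin (\<lambda>w. single (pre @ inv_map (single w 1) # rest) 1) f)"
proof -
  have "keys f \<subseteq> {w. set w \<subseteq> letters \<nu>}"
    using assms(3) by (auto simp: words_def)
  then show ?thesis
  proof (induction f rule: poly_mapping_keys_induct)
    case zero
    \<comment> \<open>The locale assumes nothing about a zero vector; \<open>inv_map 0\<close>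
      absorbs the scalar 0 instead.\<close>
    have "inv_map 0 = 0 \<odot>\<^bsub>A\<^esub> inv_map 0" using inv_map_scale[of 0 0] by simp
    then show ?case
      using tensor_eq_single_smult[OF assms(1,2), of "inv_map 0" 0] by (simp add: inv_map_closed)
  next
    case (add f g)
    then have fg: "f \<in> words \<nu>" "g \<in> words \<nu>" by (auto simp: words_def)
    have "tensor_eq A n (single (pre @ inv_map (f + g) # rest) 1)
        (single (pre @ inv_map f # rest) 1 + single (pre @ inv_map g # rest) 1)"
      unfolding inv_map_add[OF fg]
      by (intro tensor_eq_single_add assms inv_map_closed fg)
    also have "tensor_eq A n \<dots>
        (lin (\<lambda>w. single (pre @ inv_map (single w 1) # rest) 1) (f + g))"
      unfolding lin_add by (intro tensor_eq_add add)
    finally show ?case .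
  next
    case (single w c)
    then have w: "single w 1 \<in> words \<nu>" by (simp add: words_single)
    have "inv_map (single w c) = c \<odot>\<^bsub>A\<^esub> inv_map (single w 1)"
      using inv_map_scale[OF w, of c] by simp
    then show ?case
      using tensor_eq_single_smult[OF assms(1,2) inv_map_closed[OF w], of c] by simp
  qed
qed

text \<open>The factors are expanded in the basis one by one from the left; during the induction
  \<open>pre\<close> collects those already replaced by basis vectors.\<close>

lemma tensor_eq_expand:
  assumes "set (pre @ rest) \<subseteq> carrier A" "length (pre @ rest) = n"
  shows "tensor_eq A n (single (pre @ rest) 1)
    (lin (\<lambda>ws. single (pre @ map (\<lambda>w. inv_map (single w 1)) ws) 1) (wtens (map \<phi> rest)))"
  using assms
proof (induction rest arbitrary: pre)
  case (Cons x r)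
  let ?b = "\<lambda>w. inv_map (single w 1)"
  have "tensor_eq A n (single (pre @ inv_map (\<phi> x) # r) 1)
      (lin (\<lambda>w. single (pre @ ?b w # r) 1) (\<phi> x))"
    using Cons.prems by (intro tensor_eq_expand_at map_closed) auto
  also have "inv_map (\<phi> x) = x"
    using Cons.prems by (simp add: inv_map_map)
  also have "tensor_eq A n (lin (\<lambda>w. single (pre @ ?b w # r) 1) (\<phi> x))
      (lin (\<lambda>w. lin (\<lambda>ws. single ((pre @ [?b w]) @ map ?b ws) 1) (wtens (map \<phi> r))) (\<phi> x))"
  proof (rule tensor_eq_lin)
    fix w assume w: "w \<in> keys (\<phi> x)"
    have "\<phi> x \<in> words \<nu>" using Cons.prems by (simp add: map_closed)
    with w have "?b w \<in> carrier A"
      by (intro inv_map_closed words_single) (auto simp: words_def)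
    then show "tensor_eq A n (single (pre @ ?b w # r) 1)
        (lin (\<lambda>ws. single ((pre @ [?b w]) @ map ?b ws) 1) (wtens (map \<phi> r)))"
      using Cons.IH[of "pre @ [?b w]"] Cons.prems by simp
  qed
  finally show ?case
    by (simp add: cons_tens_def lin_tens2 lin_lin)
qed simp

text \<open>The coordinates kill the multilinearity relators; conversely every tensor is congruent
  to an expansion in basis tensors that depends on its coordinates only.\<close>

lemma tensor_eq_iff:
  assumes "s \<in> tensors (carrier A) n" "t \<in> tensors (carrier A) n"
  shows "tensor_eq A n s t \<longleftrightarrow> tvec \<phi> s = tvec \<phi> t"
proof
  assume "tensor_eq A n s t"
  then have "s - t \<in> Modules.module.span scale (multilinear_relators A n)"
    by (simp add: tensor_eq_def)
  moreover have "Modules.module.span scale (multilinear_relators A n) \<subseteq> {z. tvec \<phi> z = 0}"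
  proof (rule Modules.module.span_minimal[OF module_scale])
    show "Modules.module.subspace scale {z. tvec \<phi> z = 0}"
      unfolding Modules.module.subspace_def[OF module_scale] by (auto simp: tvec_add tvec_scale)
    show "multilinear_relators A n \<subseteq> {z. tvec \<phi> z = 0}"
    proof
      fix z assume "z \<in> multilinear_relators A n"
      then show "z \<in> {z. tvec \<phi> z = 0}"
        unfolding multilinear_relators_def
        by (auto simp: tvec_diff map_update map_add map_smult wtens_update_add wtens_update_scale tuples_def)
    qed
  qed
  ultimately show "tvec \<phi> s = tvec \<phi> t"
    by (auto simp: tvec_diff)
next
  assume eq: "tvec \<phi> s = tvec \<phi> t"
  let ?e = "lin (\<lambda>ws. single (map (\<lambda>w. inv_map (single w 1)) ws) 1)"
  have expand: "tensor_eq A n s (?e (tvec \<phi> s))" if "s \<in> tensors (carrier A) n" for s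
  proof -
    have "tensor_eq A n (lin (\<lambda>xs. single xs 1) s) (lin (\<lambda>xs. ?e (wtens (map \<phi> xs))) s)"
    proof (rule tensor_eq_lin)
      fix xs assume "xs \<in> keys s"
      with that show "tensor_eq A n (single xs 1) (?e (wtens (map \<phi> xs)))"
        using tensor_eq_expand[of "[]" xs n] by (auto simp: tensors_def tuples_def)
    qed
    then show ?thesis by (simp add: tvec_def lin_lin)
  qed
  show "tensor_eq A n s t"
    using tensor_eq_trans[OF expand[OF assms(1)]] tensor_eq_sym[OF expand[OF assms(2)]] eq by simp
qed

lemma tensor_eq_2_iff:
  assumes "s \<in> tensors (carrier A) 2" "t \<in> tensors (carrier A) 2"
  shows "tensor_eq A 2 s t \<longleftrightarrow> pair_of \<phi> s = pair_of \<phi> t"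
  using assms by (simp add: tensor_eq_iff tvec_pair list_of_pair_inject)

lemma tensor_eq_3I:
  assumes "s \<in> tensors (carrier A) 3" "t \<in> tensors (carrier A) 3" "triple_of \<phi> s = triple_of \<phi> t"
  shows "tensor_eq A 3 s t"
  using assms by (simp add: tensor_eq_iff tvec_triple)

end


section \<open>Models of the Hopf algebra of formal diffeomorphisms\<close>

lemma comult_at_lin:
  "comult_at A i s =
    lin (\<lambda>xs. lin (\<lambda>ys. single (take i xs @ ys @ drop (Suc i) xs) 1) (comult A (xs ! i))) s"
  by (simp add: comult_at_def lin_def scale_sum)

lemma map_tensor_id_lin: "map_tensor id f s = lin (\<lambda>xs. single (map f xs) 1) s"
  by (simp add: map_tensor_def lin_def)

lemma tensors_2E:
  assumes "s \<in> tensors L 2" "xs \<in> keys s"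
  obtains x y where "xs = [x, y]" "x \<in> L" "y \<in> L"
  by (rule tuples_2E[of xs L]) (use assms in \<open>auto simp: tensors_def\<close>)

lemma pair_of_add: "pair_of \<phi> (s + t) = pair_of \<phi> s + pair_of \<phi> t"
  and pair_of_scale: "pair_of \<phi> (scale c s) = scale c (pair_of \<phi> s)"
  by (simp_all add: pair_of_def lin_add lin_scale)

lemma comult_at_closed:
  assumes "\<And>x. x \<in> L \<Longrightarrow> comult A x \<in> tensors L 2" "s \<in> tensors L n" "i < n"
  shows "comult_at A i s \<in> tensors L (Suc n)"
  unfolding comult_at_lin
proof (intro tensors_lin tensors_single)
  fix xs ys assume xs: "xs \<in> keys s" and ys: "ys \<in> keys (comult A (xs ! i))"
  from xs assms(2) have xs': "length xs = n" "set xs \<subseteq> L" by (auto simp: tensors_def tuples_def)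
  with assms have "xs ! i \<in> L" by auto
  with assms(1) ys have "length ys = 2" "set ys \<subseteq> L" by (auto simp: tensors_def tuples_def)
  with xs' assms(3) show "take i xs @ ys @ drop (Suc i) xs \<in> tuples L (Suc n)"
    by (auto simp: tuples_def dest!: in_set_takeD in_set_dropD)
qed

text \<open>Only the coordinates of the coproduct are prescribed, not the representing tensor: in
  the specialization that tensor results from choices.\<close>

locale nc_diff_model = free_module_model A \<phi> \<nu> + ring A
  for A :: "('r::comm_ring_1, 'a) hopf" (structure) and \<phi> :: "'a \<Rightarrow> 'r free_alg" and \<nu> :: enat +
  assumes map_mult: "x \<in> carrier A \<Longrightarrow> y \<in> carrier A \<Longrightarrow> \<phi> (x \<otimes> y) = \<phi> x * \<phi> y"
    and map_one: "\<phi> \<one> = 1"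
    and comult_closed: "x \<in> carrier A \<Longrightarrow> comult A x \<in> tensors (carrier A) 2"
    and map_comult: "x \<in> carrier A \<Longrightarrow> pair_of \<phi> (comult A x) = Delta (\<phi> x)"
    and map_counit: "x \<in> carrier A \<Longrightarrow> counit A x = eps (\<phi> x)"
    and antipode_closed: "x \<in> carrier A \<Longrightarrow> antipode A x \<in> carrier A"
    and map_antipode: "x \<in> carrier A \<Longrightarrow> \<phi> (antipode A x) = antip (\<phi> x)"
begin

lemma map_zero: "\<phi> \<zero> = 0"
  using map_add[of \<zero> \<zero>] by simp

lemma map_finsum:
  "finite K \<Longrightarrow> (\<And>x. x \<in> K \<Longrightarrow> g x \<in> carrier A) \<Longrightarrow> \<phi> (\<Oplus>x\<in>K. g x) = (\<Sum>x\<in>K. \<phi> (g x))"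
proof (induction K rule: finite_induct)
  case (insert x K)
  then have "g \<in> K \<rightarrow> carrier A" by auto
  with insert show ?case by (simp add: finsum_insert map_add)
qed (simp add: map_zero)

lemma keys_comultE:
  assumes "x \<in> carrier A" "xs \<in> keys (comult A x)"
  obtains y z where "xs = [y, z]" "y \<in> carrier A" "z \<in> carrier A"
  using tensors_2E[OF comult_closed[OF assms(1)] assms(2)] .

text \<open>The counit and antipode axioms all have this form. As \<open>F\<close> is linear on
  coordinates, the sum over the representing tensor depends only on the coproduct itself.\<close>

lemma map_comult_sum:
  assumes "x \<in> carrier A"
    and closed: "\<And>y z. y \<in> carrier A \<Longrightarrow> z \<in> carrier A \<Longrightarrow> g [y, z] \<in> carrier A"
    and g: "\<And>y z. y \<in> carrier A \<Longrightarrow> z \<in> carrier A \<Longrightarrow> \<phi> (g [y, z]) = F (\<phi> y \<otimes>\<^sub>T \<phi> z)"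
    and F: "F = lin h"
  shows "\<phi> (\<Oplus>xs\<in>keys (comult A x). lookup (comult A x) xs \<odot> g xs)
    = F (Delta (\<phi> x))"
proof -
  let ?s = "comult A x"
  have "\<phi> (\<Oplus>xs\<in>keys ?s. lookup ?s xs \<odot> g xs)
      = (\<Sum>xs\<in>keys ?s. \<phi> (lookup ?s xs \<odot> g xs))"
    by (rule map_finsum) (auto elim!: keys_comultE[OF assms(1)] intro!: smult_closed closed)
  also have "\<dots> = (\<Sum>xs\<in>keys ?s. scale (lookup ?s xs) (F (\<phi> (xs ! 0) \<otimes>\<^sub>T \<phi> (xs ! 1))))"
    by (rule sum.cong) (auto elim!: keys_comultE[OF assms(1)] simp: map_smult closed g)
  also have "\<dots> = F (pair_of \<phi> ?s)"
    by (simp add: F pair_of_def lin_lin) (simp add: lin_def[of _ ?s])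
  finally show ?thesis by (simp add: map_comult assms(1))
qed

lemma tensors_mult_closed:
  "s \<in> tensors (carrier A) 2 \<Longrightarrow> t \<in> tensors (carrier A) 2 \<Longrightarrow> tensor_mult (\<otimes>) s t \<in> tensors (carrier A) 2"
  by (rule tensors_mult) auto

lemma triple_of_comult_at_0:
  assumes "s \<in> tensors (carrier A) 2"
  shows "triple_of \<phi> (comult_at A 0 s) = Delta_L (pair_of \<phi> s)"
proof -
  have "triple_of \<phi> (comult_at A 0 s) =
      lin (\<lambda>xs. lin (\<lambda>ys. triple_of \<phi> (single (ys @ drop 1 xs) 1)) (comult A (xs ! 0))) s"
    by (simp add: comult_at_lin triple_of_def lin_lin)
  also have "\<dots> = lin (\<lambda>xs. Delta_L (\<phi> (xs ! 0) \<otimes>\<^sub>T \<phi> (xs ! 1))) s"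
  proof (rule lin_cong)
    fix xs assume "xs \<in> keys s"
    with assms obtain x y where xs: "xs = [x, y]" "x \<in> carrier A" "y \<in> carrier A"
      by (rule tensors_2E)
    have "lin (\<lambda>ys. triple_of \<phi> (single (ys @ [y]) 1)) (comult A x) =
        lin (\<lambda>ys. assoc_left ((\<phi> (ys ! 0) \<otimes>\<^sub>T \<phi> (ys ! 1)) \<otimes>\<^sub>T \<phi> y)) (comult A x)"
      by (rule lin_cong) (auto elim!: keys_comultE[OF xs(2)] simp: triple_of_def assoc_left_tens)
    also have "\<dots> = assoc_left (Delta (\<phi> x) \<otimes>\<^sub>T \<phi> y)"
      by (simp add: pair_of_def tens2_lin_left assoc_left_lin flip: map_comult[OF xs(2)])
    finally show "lin (\<lambda>ys. triple_of \<phi> (single (ys @ drop 1 xs) 1)) (comult A (xs ! 0)) =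
        Delta_L (\<phi> (xs ! 0) \<otimes>\<^sub>T \<phi> (xs ! 1))"
      by (simp add: xs Delta_L_tens)
  qed
  also have "\<dots> = Delta_L (pair_of \<phi> s)"
    by (simp add: Delta_L_def pair_of_def lin_lin)
  finally show ?thesis .
qed

lemma triple_of_comult_at_1:
  assumes "s \<in> tensors (carrier A) 2"
  shows "triple_of \<phi> (comult_at A 1 s) = Delta_R (pair_of \<phi> s)"
proof -
  have "triple_of \<phi> (comult_at A 1 s) =
      lin (\<lambda>xs. lin (\<lambda>ys. triple_of \<phi> (single (take 1 xs @ ys @ drop 2 xs) 1)) (comult A (xs ! 1))) s"
    by (simp add: comult_at_lin triple_of_def lin_lin numeral_2_eq_2)
  also have "\<dots> = lin (\<lambda>xs. Delta_R (\<phi> (xs ! 0) \<otimes>\<^sub>T \<phi> (xs ! 1))) s"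
  proof (rule lin_cong)
    fix xs assume "xs \<in> keys s"
    with assms obtain x y where xs: "xs = [x, y]" "x \<in> carrier A" "y \<in> carrier A"
      by (rule tensors_2E)
    have "lin (\<lambda>ys. triple_of \<phi> (single (x # ys) 1)) (comult A y) =
        lin (\<lambda>ys. \<phi> x \<otimes>\<^sub>T \<phi> (ys ! 0) \<otimes>\<^sub>T \<phi> (ys ! 1)) (comult A y)"
      by (rule lin_cong) (auto elim!: keys_comultE[OF xs(3)] simp: triple_of_def)
    also have "\<dots> = \<phi> x \<otimes>\<^sub>T Delta (\<phi> y)"
      by (simp add: pair_of_def tens2_lin_right flip: map_comult[OF xs(3)])
    finally show "lin (\<lambda>ys. triple_of \<phi> (single (take 1 xs @ ys @ drop 2 xs) 1)) (comult A (xs ! 1)) =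
        Delta_R (\<phi> (xs ! 0) \<otimes>\<^sub>T \<phi> (xs ! 1))"
      by (simp add: xs Delta_R_tens)
  qed
  also have "\<dots> = Delta_R (pair_of \<phi> s)"
    by (simp add: Delta_R_def pair_of_def lin_lin)
  finally show ?thesis .
qed

lemma module_axioms: "module (ring_of_type_algebra :: 'r ring) A"
proof (rule moduleI)
  show "cring (ring_of_type_algebra :: 'r ring)" by (rule cring_from_type_algebra)
  show "abelian_group A" by (rule abelian_group_axioms)
qed (auto simp: ring_of_type_algebra_def smult_closed map_smult map_add scale_add_left scale_add_right intro!: map_inject)

lemma smult_smult: "x \<in> carrier A \<Longrightarrow> (c * d) \<odot> x = c \<odot> (d \<odot> x)"
  by (auto simp: smult_closed map_smult intro!: map_inject)

theorem hopf_algebra: "hopf_algebra A"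
proof (intro hopf_algebra.intro hopf_algebra_axioms.intro ring_axioms module_axioms)
  fix x y c assume x: "x \<in> carrier A" and y: "y \<in> carrier A"
  show "(c \<odot> x) \<otimes> y = c \<odot> (x \<otimes> y)" "x \<otimes> (c \<odot> y) = c \<odot> (x \<otimes> y)"
    using x y by (auto simp: smult_closed map_smult map_mult scale_mult_left scale_mult_right intro!: map_inject)
  show "tensor_eq A 2 (comult A (x \<oplus> y)) (comult A x + comult A y)"
    using x y by (subst tensor_eq_2_iff)
      (auto simp: map_comult comult_closed map_add lin_add pair_of_add intro!: tensors_add)
  show "tensor_eq A 2 (comult A (x \<otimes> y)) (tensor_mult (\<otimes>) (comult A x) (comult A y))"
    using x y by (subst tensor_eq_2_iff)
      (auto simp: map_comult comult_closed map_mult Delta_mult tensors_mult_closed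
        pair_of_tensor_mult[where L = "carrier A"])
  show "antipode A (x \<oplus> y) = antipode A x \<oplus> antipode A y"
    using x y by (auto simp: antipode_closed map_antipode map_add lin_add intro!: map_inject)
next
  fix x c assume x: "x \<in> carrier A"
  show "comult A x \<in> tensors (carrier A) 2" using x by (rule comult_closed)
  show "tensor_eq A 2 (comult A (c \<odot> x)) (scale c (comult A x))"
    using x by (subst tensor_eq_2_iff)
      (auto simp: map_comult comult_closed smult_closed tensors_scale map_smult lin_scale pair_of_scale)
  show "counit A (c \<odot> x) = c * counit A x"
    using x by (simp add: map_counit smult_closed map_smult)
  show "tensor_eq A 3 (comult_at A 0 (comult A x)) (comult_at A 1 (comult A x))"
  proof (rule tensor_eq_3I)
    have "comult_at A i (comult A x) \<in> tensors (carrier A) (Suc 2)" if "i < 2" for i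
      using comult_at_closed[OF comult_closed comult_closed[OF x] that] by simp
    from this[of 0] this[of 1]
    show "comult_at A 0 (comult A x) \<in> tensors (carrier A) 3" "comult_at A 1 (comult A x) \<in> tensors (carrier A) 3"
      by simp_all
    show "triple_of \<phi> (comult_at A 0 (comult A x)) = triple_of \<phi> (comult_at A 1 (comult A x))"
      by (simp add: triple_of_comult_at_0 triple_of_comult_at_1[simplified] comult_closed x map_comult coassoc)
  qed
  show "antipode A x \<in> carrier A" using x by (rule antipode_closed)
  show "antipode A (c \<odot> x) = c \<odot> antipode A x"
    using x by (auto simp: antipode_closed smult_closed map_antipode map_smult lin_scale intro!: map_inject)
  have "(\<Oplus>xs\<in>keys (comult A x). (lookup (comult A x) xs * counit A (xs ! 0)) \<odot> (xs ! 1))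
      = (\<Oplus>xs\<in>keys (comult A x). lookup (comult A x) xs \<odot> (counit A (xs ! 0) \<odot> xs ! 1))"
    by (rule finsum_cong') (auto elim!: keys_comultE[OF x] simp: smult_smult smult_closed)
  moreover have "\<phi> \<dots> = eps_L (Delta (\<phi> x))"
    by (rule map_comult_sum[OF x _ _ eps_L_def])
      (auto simp: smult_closed map_smult map_counit eps_L_tens)
  ultimately show "(\<Oplus>xs\<in>keys (comult A x).
      (lookup (comult A x) xs * counit A (xs ! 0)) \<odot> (xs ! 1)) = x"
    by (intro map_inject) (auto intro!: finsum_closed smult_closed elim!: keys_comultE[OF x] simp: x)
  have "(\<Oplus>xs\<in>keys (comult A x). (lookup (comult A x) xs * counit A (xs ! 1)) \<odot> (xs ! 0))
      = (\<Oplus>xs\<in>keys (comult A x). lookup (comult A x) xs \<odot> (counit A (xs ! 1) \<odot> xs ! 0))"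
    by (rule finsum_cong') (auto elim!: keys_comultE[OF x] simp: smult_smult smult_closed)
  moreover have "\<phi> \<dots> = eps_R (Delta (\<phi> x))"
    by (rule map_comult_sum[OF x _ _ eps_R_def])
      (auto simp: smult_closed map_smult map_counit eps_R_tens)
  ultimately show "(\<Oplus>xs\<in>keys (comult A x).
      (lookup (comult A x) xs * counit A (xs ! 1)) \<odot> (xs ! 0)) = x"
    by (intro map_inject) (auto intro!: finsum_closed smult_closed elim!: keys_comultE[OF x] simp: x)
  have "\<phi> (\<Oplus>xs\<in>keys (comult A x). lookup (comult A x) xs \<odot> (antipode A (xs ! 0) \<otimes> xs ! 1))
      = conv_L (Delta (\<phi> x))"
    by (rule map_comult_sum[OF x _ _ conv_L_def])
      (auto simp: antipode_closed map_mult map_antipode conv_L_tens)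
  also have "\<dots> = \<phi> (counit A x \<odot> \<one>)"
    by (simp add: conv_L_Delta map_smult map_counit x map_one)
  finally show "(\<Oplus>xs\<in>keys (comult A x).
      lookup (comult A x) xs \<odot> (antipode A (xs ! 0) \<otimes> xs ! 1)) = counit A x \<odot> \<one>"
    by (rule map_inject[rotated 2])
      (auto intro!: finsum_closed smult_closed elim!: keys_comultE[OF x] simp: antipode_closed)
  have "\<phi> (\<Oplus>xs\<in>keys (comult A x). lookup (comult A x) xs \<odot> (xs ! 0 \<otimes> antipode A (xs ! 1)))
      = conv_R (Delta (\<phi> x))"
    by (rule map_comult_sum[OF x _ _ conv_R_def])
      (auto simp: antipode_closed map_mult map_antipode conv_R_tens)
  also have "\<dots> = \<phi> (counit A x \<odot> \<one>)"
    by (simp add: conv_R_Delta map_smult map_counit x map_one)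
  finally show "(\<Oplus>xs\<in>keys (comult A x).
      lookup (comult A x) xs \<odot> (xs ! 0 \<otimes> antipode A (xs ! 1))) = counit A x \<odot> \<one>"
    by (rule map_inject[rotated 2])
      (auto intro!: finsum_closed smult_closed elim!: keys_comultE[OF x] simp: antipode_closed)
next
  show "tensor_eq A 2 (comult A \<one>) (single [\<one>, \<one>] 1)"
    by (subst tensor_eq_2_iff) (auto simp: comult_closed map_comult map_one tuples_def intro!: tensors_single)
  show "counit A \<in> ring_hom A ring_of_type_algebra"
    by (rule ring_hom_memI) (auto simp: ring_of_type_algebra_def map_counit map_mult map_add map_one)
qed

end


lemma nc_diff_sel [simp]:
  "carrier (nc_diff \<nu>) = words \<nu>" "monoid.mult (nc_diff \<nu>) = (*)" "monoid.one (nc_diff \<nu>) = 1"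
  "ring.zero (nc_diff \<nu>) = 0" "ring.add (nc_diff \<nu>) = (+)" "module.smult (nc_diff \<nu>) = scale"
  "comult (nc_diff \<nu>) = lin comult_word" "counit (nc_diff \<nu>) = eps" "antipode (nc_diff \<nu>) = antip"
  by (simp_all add: nc_diff_def words_def lin_def eps_def fun_eq_iff)

lemma ring_nc_diff: "ring (nc_diff \<nu> :: ('r::comm_ring_1, _) hopf)"
proof (rule ringI)
  show "abelian_group (nc_diff \<nu> :: ('r, _) hopf)"
  proof (rule abelian_groupI)
    fix x :: "'r free_alg" assume "x \<in> carrier (nc_diff \<nu>)"
    then show "\<exists>y\<in>carrier (nc_diff \<nu>). y \<oplus>\<^bsub>nc_diff \<nu>\<^esub> x = \<zero>\<^bsub>nc_diff \<nu>\<^esub>"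
      by (intro bexI[of _ "- x"]) (simp_all add: words_minus)
  qed (simp_all add: words_add algebra_simps)
  show "Group.monoid (nc_diff \<nu> :: ('r, _) hopf)"
    by (rule monoidI) (simp_all add: words_mult mult.assoc)
qed (simp_all add: algebra_simps)

lemma pair_of_lin: "pair_of \<phi> (lin g x) = lin (\<lambda>w. pair_of \<phi> (g w)) x"
  by (simp add: pair_of_def lin_lin)

lemma nc_diff_model_nc_diff: "nc_diff_model (nc_diff \<nu> :: ('r::comm_ring_1, _) hopf) id \<nu>"
proof (intro nc_diff_model.intro free_module_model.intro nc_diff_model_axioms.intro ring_nc_diff)
  fix x :: "'r free_alg" assume x: "x \<in> carrier (nc_diff \<nu>)"
  show "comult (nc_diff \<nu>) x \<in> tensors (carrier (nc_diff \<nu>)) 2"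
    unfolding nc_diff_sel by (rule tensors_lin) (use x in \<open>auto simp: words_def intro!: comult_word_closed[unfolded words_def]\<close>)
  show "pair_of id (comult (nc_diff \<nu>) x) = Delta (id x)"
    by (simp add: pair_of_lin Delta_word_def[abs_def])
qed (auto simp: words_add words_scale antip_closed)

interpretation nc: nc_diff_model "nc_diff \<nu> :: ('r::comm_ring_1, _) hopf" id \<nu> for \<nu>
  by (rule nc_diff_model_nc_diff)

lemma nc_diff_minus:
  assumes "x \<in> words \<nu>" "y \<in> words \<nu>"
  shows "x \<ominus>\<^bsub>nc_diff \<nu>\<^esub> y = x - (y :: 'r::comm_ring_1 free_alg)"
proof -
  have "\<ominus>\<^bsub>nc_diff \<nu>\<^esub> y = - y"
    using assms abelian_group.minus_equality[OF ring.is_abelian_group[OF ring_nc_diff[of \<nu>]], of "- y" y]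
    by (simp add: words_minus)
  then show ?thesis by (simp add: a_minus_def)
qed

section \<open>Iterated coproducts\<close>

definition cons2_tens :: "(('b \<times> 'b) \<times> 'b list \<Rightarrow>\<^sub>0 'r::comm_ring_1) \<Rightarrow> ('b list \<Rightarrow>\<^sub>0 'r)" where
  "cons2_tens = lin (\<lambda>((u, v), ws). single (u # v # ws) 1)"

definition cop0 :: "(nat list list \<Rightarrow>\<^sub>0 'r::comm_ring_1) \<Rightarrow> (nat list list \<Rightarrow>\<^sub>0 'r)" where
  "cop0 = lin (\<lambda>ws. case ws of [] \<Rightarrow> 0
     | w # ws' \<Rightarrow> cons2_tens (Delta_word w \<otimes>\<^sub>T single ws' 1))"

lemma cons2_tens_lin: "cons2_tens (lin g x) = lin (\<lambda>w. cons2_tens (g w)) x"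
  by (simp add: cons2_tens_def lin_lin)

lemma cop0_cons_tens: "cop0 (cons_tens (f \<otimes>\<^sub>T t)) = cons2_tens (Delta f \<otimes>\<^sub>T t)"
proof -
  have "cop0 (cons_tens (f \<otimes>\<^sub>T t)) =
      lin (\<lambda>w. lin (\<lambda>ws. cons2_tens (Delta_word w \<otimes>\<^sub>T single ws 1)) t) f"
    by (simp add: cop0_def cons_tens_def lin_tens2 lin_lin)
  also have "\<dots> = lin (\<lambda>w. cons2_tens (Delta_word w \<otimes>\<^sub>T t)) f"
    by (simp flip: cons2_tens_lin tens2_lin_right)
  finally show ?thesis by (simp add: tens2_lin_left cons2_tens_lin)
qed

lemma cons2_tens_tens: "cons2_tens ((f \<otimes>\<^sub>T g) \<otimes>\<^sub>T t) = cons_tens (f \<otimes>\<^sub>T cons_tens (g \<otimes>\<^sub>T t))"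
  by (simp add: cons2_tens_def cons_tens_def lin_tens2 lin_lin)

fun iter_cop :: "nat \<Rightarrow> 'r::comm_ring_1 free_alg \<Rightarrow> (nat list list \<Rightarrow>\<^sub>0 'r)" where
  "iter_cop 0 f = scale (eps f) (wtens [])"
| "iter_cop (Suc 0) f = wtens [f]"
| "iter_cop (Suc (Suc n)) f = cop0 (iter_cop (Suc n) f)"

lemma cop0_add: "cop0 (x + y) = cop0 x + cop0 y"
  and cop0_scale: "cop0 (scale c x) = scale c (cop0 x)"
  by (simp_all add: cop0_def lin_add lin_scale)

lemma iter_cop_add: "iter_cop n (f + g) = iter_cop n f + iter_cop n g"
  by (induction n "f + g" rule: iter_cop.induct)
    (simp_all add: cop0_add tens2_add_left cons_tens_add single_add)

lemma iter_cop_scale: "iter_cop n (scale c f) = scale c (iter_cop n f)"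
  by (induction n "scale c f" rule: iter_cop.induct)
    (simp_all add: cop0_scale tens2_scale_left cons_tens_scale)

lemma iter_cop_0 [simp]: "iter_cop n 0 = 0"
  using iter_cop_scale[of n 0 0] by simp

lemma iter_cop_lin: "iter_cop n f = lin (\<lambda>w. iter_cop n (single w 1)) f"
  by (rule linear_ext[where F = "iter_cop n"])
    (simp_all add: iter_cop_add iter_cop_scale lin_add lin_scale)

definition cons_iter :: "nat \<Rightarrow> (nat list \<times> nat list \<Rightarrow>\<^sub>0 'r::comm_ring_1) \<Rightarrow> (nat list list \<Rightarrow>\<^sub>0 'r)" where
  "cons_iter n = lin (\<lambda>(u, v). cons_tens (single u 1 \<otimes>\<^sub>T iter_cop n (single v 1)))"

lemma cons_tens_lin: "cons_tens (lin g x) = lin (\<lambda>w. cons_tens (g w)) x"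
  by (simp add: cons_tens_def lin_lin)

lemma cons_iter_tens: "cons_iter n (f \<otimes>\<^sub>T g) = cons_tens (f \<otimes>\<^sub>T iter_cop n g)"
proof -
  have "cons_iter n (f \<otimes>\<^sub>T g) = lin (\<lambda>u. cons_tens (single u 1 \<otimes>\<^sub>T
      lin (\<lambda>v. iter_cop n (single v 1)) g)) f"
    by (simp add: cons_iter_def lin_tens2 tens2_lin_right cons_tens_lin)
  also have "\<dots> = cons_tens (lin (\<lambda>u. single u 1) f \<otimes>\<^sub>T iter_cop n g)"
    by (simp only: iter_cop_lin[symmetric] tens2_lin_left cons_tens_lin)
  finally show ?thesis by simp
qed

text \<open>The definition always splits the first factor. Coassociativity allows one instead to
  split \<open>f\<close> once and iterate on the second factor, so that fixing the first word of a
  coefficient leaves an iterated coproduct of lower order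
  (\<open>lookup_iter_cop_Suc\<close>).\<close>

lemma iter_cop_Suc: "iter_cop (Suc n) f = cons_iter n (Delta f)"
proof (induction n arbitrary: f)
  case 0
  have "cons_iter 0 z = wtens [eps_R z]" for z :: "nat list \<times> nat list \<Rightarrow>\<^sub>0 'a"
    by (rule linear_ext[where F = "cons_iter 0" and G = "\<lambda>z. wtens [eps_R z]"])
      (auto simp: cons_iter_def eps_R_def lin_add lin_scale tens2_add_left tens2_scale_left cons_tens_add
        cons_tens_scale)
  then show ?case by (simp del: wtens.simps)
next
  case (Suc n)
  \<comment> \<open>\<open>h\<close> is \<open>id \<otimes> cons_iter n\<close>; both
    \<open>cop0 \<circ> cons_iter n\<close> and \<open>cons_iter (Suc n)\<close> factor through it,
    the former via \<Delta> \<otimes> id and the latter via id \<otimes> \<Delta>.\<close>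
  define h :: "(nat list \<times> nat list \<times> nat list \<Rightarrow>\<^sub>0 'a) \<Rightarrow> (nat list list \<Rightarrow>\<^sub>0 'a)" where
    "h = lin (\<lambda>(u, z). cons_tens (single u 1 \<otimes>\<^sub>T cons_iter n (single z 1)))"
  have h_tens: "h (f \<otimes>\<^sub>T z) = cons_tens (f \<otimes>\<^sub>T cons_iter n z)" for f z
  proof -
    have "h (f \<otimes>\<^sub>T z) = lin (\<lambda>u. cons_tens (single u 1 \<otimes>\<^sub>T
        lin (\<lambda>z. cons_iter n (single z 1)) z)) f"
      by (simp add: h_def lin_tens2 tens2_lin_right cons_tens_lin)
    also have "lin (\<lambda>z. cons_iter n (single z 1)) z = cons_iter n z"
      by (simp add: cons_iter_def)
    also have "lin (\<lambda>u. cons_tens (single u 1 \<otimes>\<^sub>T cons_iter n z)) f =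
        cons_tens (lin (\<lambda>u. single u 1) f \<otimes>\<^sub>T cons_iter n z)"
      by (simp only: tens2_lin_left cons_tens_lin)
    finally show ?thesis by simp
  qed
  have L: "cop0 (cons_iter n z) = h (Delta_L z)" for z
  proof (rule linear_ext[where F = "\<lambda>z. cop0 (cons_iter n z)" and G = "\<lambda>z. h (Delta_L z)"])
    fix w :: "nat list \<times> nat list"
    obtain u v where w: "w = (u, v)" by force
    let ?u = "single u (1 :: 'a)" and ?v = "single v (1 :: 'a)"
    have "cop0 (cons_iter n (?u \<otimes>\<^sub>T ?v)) = cons2_tens (Delta ?u \<otimes>\<^sub>T iter_cop n ?v)"
      by (simp only: cons_iter_tens cop0_cons_tens)
    also have "\<dots> = h (assoc_left (Delta ?u \<otimes>\<^sub>T ?v))"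
    proof (rule linear_ext[where F = "\<lambda>x. cons2_tens (x \<otimes>\<^sub>T iter_cop n ?v)" and G = "\<lambda>x. h (assoc_left (x \<otimes>\<^sub>T ?v))"])
      fix p :: "nat list \<times> nat list"
      obtain a b where p: "p = (a, b)" by force
      let ?a = "single a (1 :: 'a)" and ?b = "single b (1 :: 'a)"
      have "cons2_tens ((?a \<otimes>\<^sub>T ?b) \<otimes>\<^sub>T iter_cop n ?v) = h (assoc_left ((?a \<otimes>\<^sub>T ?b) \<otimes>\<^sub>T ?v))"
        by (simp only: cons2_tens_tens assoc_left_tens h_tens cons_iter_tens)
      then show "cons2_tens (single p 1 \<otimes>\<^sub>T iter_cop n ?v) =
          h (assoc_left (single p 1 \<otimes>\<^sub>T ?v))"
        by (simp add: p)
    qed (simp_all add: tens2_add_left tens2_scale_left cons2_tens_def assoc_left_def h_def lin_add lin_scale)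
    also have "\<dots> = h (Delta_L (?u \<otimes>\<^sub>T ?v))"
      by (simp only: Delta_L_tens)
    finally show "cop0 (cons_iter n (single w 1)) = h (Delta_L (single w 1))"
      by (simp add: w)
  qed (simp_all add: cop0_def cons_iter_def Delta_L_def h_def lin_add lin_scale)
  have R: "cons_iter (Suc n) z = h (Delta_R z)" for z
  proof (rule linear_ext[where F = "cons_iter (Suc n)" and G = "\<lambda>z. h (Delta_R z)"])
    fix w :: "nat list \<times> nat list"
    obtain u v where w: "w = (u, v)" by force
    let ?u = "single u (1 :: 'a)" and ?v = "single v (1 :: 'a)"
    have "cons_iter (Suc n) (?u \<otimes>\<^sub>T ?v) = h (Delta_R (?u \<otimes>\<^sub>T ?v))"
      by (simp only: cons_iter_tens Suc.IH h_tens Delta_R_tens)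
    then show "cons_iter (Suc n) (single w 1) = h (Delta_R (single w 1))"
      by (simp add: w)
  qed (simp_all add: cons_iter_def Delta_R_def h_def lin_add lin_scale)
  show ?case
    by (simp add: Suc.IH L R coassoc del: iter_cop.simps(2))
qed

lemma tvec_comult_at_0:
  assumes "s \<in> tensors (words \<nu>) (Suc n)"
  shows "tvec id (comult_at (nc_diff \<nu>) 0 s) = cop0 (tvec id (s :: 'r::comm_ring_1 free_alg list \<Rightarrow>\<^sub>0 'r))"
proof -
  have "tvec id (comult_at (nc_diff \<nu>) 0 s) =
      lin (\<lambda>xs. lin (\<lambda>ys. wtens (ys @ drop 1 xs)) (comult (nc_diff \<nu>) (xs ! 0))) s"
    by (simp add: comult_at_lin tvec_def lin_lin)
  also have "\<dots> = lin (\<lambda>xs. cop0 (wtens xs)) s"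
  proof (rule lin_cong)
    fix xs assume "xs \<in> keys s"
    with assms have "length xs = Suc n" "set xs \<subseteq> words \<nu>" by (auto simp: tensors_def tuples_def)
    then obtain x r where xs: "xs = x # r" "x \<in> words \<nu>" by (cases xs) auto
    have "lin (\<lambda>ys. wtens (ys @ r)) (comult (nc_diff \<nu>) x) =
        lin (\<lambda>ys. cons2_tens ((ys ! 0 \<otimes>\<^sub>T ys ! 1) \<otimes>\<^sub>T wtens r)) (comult (nc_diff \<nu>) x)"
      by (rule lin_cong) (use xs in \<open>auto elim!: nc.keys_comultE[of x, unfolded nc_diff_sel] simp: cons2_tens_tens\<close>)
    also have "\<dots> = cons2_tens (pair_of id (comult (nc_diff \<nu>) x) \<otimes>\<^sub>T wtens r)"
      by (simp add: pair_of_def tens2_lin_left cons2_tens_lin)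
    also have "\<dots> = cop0 (wtens xs)"
      using nc.map_comult[of x] xs by (simp add: cop0_cons_tens)
    finally show "lin (\<lambda>ys. wtens (ys @ drop 1 xs)) (comult (nc_diff \<nu>) (xs ! 0)) = cop0 (wtens xs)"
      by (simp add: xs)
  qed
  also have "\<dots> = cop0 (tvec id s)"
    by (simp add: tvec_def cop0_def lin_lin)
  finally show ?thesis .
qed

lemma iter_comult_closed:
  "(f :: 'r::comm_ring_1 free_alg) \<in> words \<nu> \<Longrightarrow> iter_comult (nc_diff \<nu>) n f \<in> tensors (words \<nu>) n"
proof (induction "nc_diff \<nu> :: ('r, _) hopf" n f rule: iter_comult.induct)
  case (3 n f)
  show ?case
    unfolding iter_comult.simps
    by (rule comult_at_closed) (use 3 nc.comult_closed in auto)
qed (auto intro!: tensors_single simp: tuples_def)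

lemma tvec_iter_comult: "f \<in> words \<nu> \<Longrightarrow> tvec id (iter_comult (nc_diff \<nu>) n f) = iter_cop n f"
proof (induction n f rule: iter_cop.induct)
  case (3 n f)
  then show ?case
    by (simp only: iter_comult.simps iter_cop.simps tvec_comult_at_0[OF iter_comult_closed])
qed simp_all

lemma delta_lin:
  assumes "f \<in> words \<nu>"
  shows "delta (nc_diff \<nu>) n f =
    lin (\<lambda>xs. single (map (\<lambda>y. y - scale (eps y) 1) xs) 1) (iter_comult (nc_diff \<nu>) n f)"
  unfolding delta_def map_tensor_id_lin
proof (rule lin_cong)
  fix xs assume "xs \<in> keys (iter_comult (nc_diff \<nu>) n f)"
  with iter_comult_closed[OF assms, of n] have "set xs \<subseteq> words \<nu>" by (auto simp: tensors_def tuples_def)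
  then have "map (\<lambda>y. y \<ominus>\<^bsub>nc_diff \<nu>\<^esub> counit (nc_diff \<nu>) y \<odot>\<^bsub>nc_diff \<nu>\<^esub> \<one>\<^bsub>nc_diff \<nu>\<^esub>) xs =
      map (\<lambda>y. y - scale (eps y) 1) xs"
    by (auto simp: nc_diff_minus words_scale)
  then show "single (map (\<lambda>y. y \<ominus>\<^bsub>nc_diff \<nu>\<^esub> counit (nc_diff \<nu>) y \<odot>\<^bsub>nc_diff \<nu>\<^esub> \<one>\<^bsub>nc_diff \<nu>\<^esub>) xs) 1 =
      single (map (\<lambda>y. y - scale (eps y) 1) xs) 1" by (simp only:)
qed

lemma delta_closed: "f \<in> words \<nu> \<Longrightarrow> delta (nc_diff \<nu>) n f \<in> tensors (words \<nu>) n"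
  unfolding delta_lin using iter_comult_closed[of f \<nu> n]
  by (intro tensors_lin tensors_single) (auto simp: tensors_def tuples_def intro!: words_diff words_scale)

text \<open>In the basis of words, id - u \<epsilon> removes the empty word, so its tensor power
  deletes every basis tensor with an empty factor.\<close>

definition reduce_tens :: "('b list list \<Rightarrow>\<^sub>0 'r::comm_ring_1) \<Rightarrow> ('b list list \<Rightarrow>\<^sub>0 'r)" where
  "reduce_tens = lin (\<lambda>ws. if [] \<in> set ws then 0 else single ws 1)"

lemma reduce_tens_zero [simp]: "reduce_tens 0 = 0"
  and reduce_tens_add: "reduce_tens (x + y) = reduce_tens x + reduce_tens y"
  and reduce_tens_scale: "reduce_tens (scale c x) = scale c (reduce_tens x)"
  by (simp_all add: reduce_tens_def lin_add lin_scale)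

lemma lookup_reduce_tens:
  "lookup (reduce_tens z) ws = (if [] \<in> set ws then 0 else lookup z ws)"
  by (induction z rule: poly_mapping_linear_induct)
    (auto simp: reduce_tens_def lin_add lookup_add lookup_single when_def split: if_splits)

lemma reduce_tens_wtens:
  "reduce_tens (wtens fs) = wtens (map (\<lambda>y. y - scale (eps y) 1) (fs :: 'r::comm_ring_1 free_alg list))"
proof (rule poly_mapping_eqI)
  fix ws
  have "prod_list (map2 lookup (map (\<lambda>y. y - scale (eps y) 1) fs) ws) =
      (if [] \<in> set ws then 0 else prod_list (map2 lookup fs ws))" if "length ws = length fs"
    using that
    by (induction fs ws rule: list_induct2') (auto simp: lookup_minus lookup_one zero_list_def eps_def)
  then show "lookup (reduce_tens (wtens fs)) ws =
      lookup (wtens (map (\<lambda>y. y - scale (eps y) 1) fs)) ws"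
    by (auto simp: lookup_reduce_tens lookup_wtens)
qed

lemma tvec_delta:
  assumes "f \<in> words \<nu>"
  shows "tvec id (delta (nc_diff \<nu>) n f) = reduce_tens (iter_cop n (f :: 'r::comm_ring_1 free_alg))"
proof -
  have "tvec id (delta (nc_diff \<nu>) n f) =
      lin (\<lambda>xs. reduce_tens (wtens xs)) (iter_comult (nc_diff \<nu>) n f)"
    by (simp add: delta_lin[OF assms] tvec_def lin_lin reduce_tens_wtens)
  also have "\<dots> = reduce_tens (tvec id (iter_comult (nc_diff \<nu>) n f))"
    by (simp add: tvec_def reduce_tens_def lin_lin)
  finally show ?thesis by (simp add: tvec_iter_comult assms)
qed


section \<open>Leading terms of the coproduct\<close>

text \<open>Filtration by total word length. With respect to it, \<Delta> differs from the coproduct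
  \<open>Delta0\<close> with primitive generators by terms of higher order.\<close>

definition len_ge :: "nat \<Rightarrow> (nat list \<times> nat list \<Rightarrow>\<^sub>0 'r::comm_ring_1) set" where
  "len_ge k = {z. \<forall>(u, v)\<in>keys z. k \<le> length u + length v}"

lemma len_ge_0 [simp]: "0 \<in> len_ge k"
  by (simp add: len_ge_def)

lemma len_ge_mono: "z \<in> len_ge k \<Longrightarrow> l \<le> k \<Longrightarrow> z \<in> len_ge l"
  by (fastforce simp: len_ge_def)

lemma len_ge_add: "y \<in> len_ge k \<Longrightarrow> z \<in> len_ge k \<Longrightarrow> y + z \<in> len_ge k"
  using Poly_Mapping.keys_add[of y z] by (fastforce simp: len_ge_def)

lemma len_ge_sum: "(\<And>i. i \<in> I \<Longrightarrow> f i \<in> len_ge k) \<Longrightarrow> sum f I \<in> len_ge k"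
  by (induction I rule: infinite_finite_induct) (simp_all add: len_ge_add)

lemma len_ge_mult: "y \<in> len_ge k \<Longrightarrow> z \<in> len_ge l \<Longrightarrow> y * z \<in> len_ge (k + l)"
  using Poly_Mapping.keys_mult[of y z] by (fastforce simp: len_ge_def plus_list_def)

lemma len_ge_tens:
  assumes "\<And>u. u \<in> keys f \<Longrightarrow> k \<le> length u" "\<And>v. v \<in> keys g \<Longrightarrow> l \<le> length v"
  shows "f \<otimes>\<^sub>T g \<in> len_ge (k + l)"
proof -
  have "u \<in> keys f \<and> v \<in> keys g" if "(u, v) \<in> keys (f \<otimes>\<^sub>T g)" for u v
    using that by (auto simp: in_keys_iff)
  then show ?thesis using assms by (fastforce simp: len_ge_def)
qed

lemma Q_poly_keys:
  assumes "w \<in> keys (Q_poly m t :: 'r::comm_ring_1 free_alg)" "1 \<le> t"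
  shows "1 \<le> length w"
proof (rule ccontr)
  assume "\<not> 1 \<le> length w"
  then have "w = []" by (cases w) auto
  then have "eps (Q_poly m t :: 'r free_alg) \<noteq> 0" using assms(1) by (simp add: eps_def in_keys_iff)
  with assms(2) show False by (simp add: Q_poly_eq_Cf eps_Cf)
qed

primrec Delta0_word :: "nat list \<Rightarrow> (nat list \<times> nat list \<Rightarrow>\<^sub>0 'r::comm_ring_1)" where
  "Delta0_word [] = 1"
| "Delta0_word (n # w) = (gen n \<otimes>\<^sub>T 1 + 1 \<otimes>\<^sub>T gen n) * Delta0_word w"

abbreviation Delta0 :: "'r::comm_ring_1 free_alg \<Rightarrow> (nat list \<times> nat list \<Rightarrow>\<^sub>0 'r)" where
  "Delta0 \<equiv> lin Delta0_word"

lemma primitive_gen_keys: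
  "keys (gen n \<otimes>\<^sub>T 1 + 1 \<otimes>\<^sub>T gen n :: _ \<Rightarrow>\<^sub>0 'r::comm_ring_1) \<subseteq> {([n], []), ([], [n])}"
  using Poly_Mapping.keys_add[of "gen n \<otimes>\<^sub>T (1 :: 'r free_alg)" "1 \<otimes>\<^sub>T gen n"]
  by (auto simp: gen_def simp flip: single_Nil)

lemma Delta0_word_keys:
  "(u, v) \<in> keys (Delta0_word w) \<Longrightarrow> length u + length v = length w \<and> set u \<union> set v \<subseteq> set w"
proof (induction w arbitrary: u v)
  case Nil
  then show ?case by (simp add: keys_one zero_prod_def zero_list_def split: if_splits)
next
  case (Cons n w)
  from Cons.prems obtain p q where
    "p \<in> keys (gen n \<otimes>\<^sub>T 1 + 1 \<otimes>\<^sub>T gen n :: _ \<Rightarrow>\<^sub>0 'a)"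
    "q \<in> keys (Delta0_word w :: _ \<Rightarrow>\<^sub>0 'a)" "(u, v) = p + q"
    using Poly_Mapping.keys_mult[of "gen n \<otimes>\<^sub>T 1 + 1 \<otimes>\<^sub>T gen n :: _ \<Rightarrow>\<^sub>0 'a" "Delta0_word w"] by auto
  moreover have "p \<in> {([n], []), ([], [n])}" using calculation(1) primitive_gen_keys by blast
  ultimately show ?case using Cons.IH[of "fst q" "snd q"] by (cases q) (auto simp: plus_list_def)
qed

lemma Delta0_word_len_ge: "Delta0_word w \<in> len_ge (length w)"
  using Delta0_word_keys by (force simp: len_ge_def)

lemma Delta_gen_leading:
  "pair_of id (comult_gen n) - (gen n \<otimes>\<^sub>T 1 + 1 \<otimes>\<^sub>T gen n) \<in> (len_ge 2 :: (_ \<Rightarrow>\<^sub>0 'r::comm_ring_1) set)"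
proof -
  have "pair_of id (comult_gen n) - (gen n \<otimes>\<^sub>T 1 + 1 \<otimes>\<^sub>T gen n) = (\<Sum>m\<in>{1..<n}. gen m \<otimes>\<^sub>T (Q_poly m (n - m) :: 'r free_alg))"
    by (simp add: comult_gen_def pair_of_def lin_add lin_sum)
  also have "\<dots> \<in> len_ge (1 + 1)"
    by (intro len_ge_sum len_ge_tens) (auto simp: gen_def dest: Q_poly_keys)
  finally show ?thesis by (simp add: numeral_2_eq_2)
qed

lemma Delta_word_leading: "Delta_word w - Delta0_word w \<in> (len_ge (Suc (length w)) :: (_ \<Rightarrow>\<^sub>0 'r::comm_ring_1) set)"
proof (induction w)
  case (Cons n w)
  define g :: "nat list \<times> nat list \<Rightarrow>\<^sub>0 'r" where "g = gen n \<otimes>\<^sub>T 1 + 1 \<otimes>\<^sub>T gen n"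
  define h :: "nat list \<times> nat list \<Rightarrow>\<^sub>0 'r" where "h = pair_of id (comult_gen n) - g"
  define y :: "nat list \<times> nat list \<Rightarrow>\<^sub>0 'r" where "y = Delta_word w - Delta0_word w"
  have g: "g \<in> len_ge 1" using primitive_gen_keys[of n, where 'r = 'r] by (fastforce simp: g_def len_ge_def)
  have h: "h \<in> len_ge 2" unfolding h_def g_def by (rule Delta_gen_leading)
  have y: "y \<in> len_ge (Suc (length w))" using Cons by (simp add: y_def)
  have "Delta_word (n # w) - Delta0_word (n # w) = (g + h) * (Delta0_word w + y) - g * Delta0_word w"
    by (simp add: Delta_word_Cons h_def y_def flip: g_def)
  \<comment> \<open>\<open>h\<close> gains a letter over \<open>g\<close>, and \<open>y\<close>
    gains one over \<open>Delta0_word w\<close>; each of the three terms contains at least one of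
    them.\<close>
  also have "\<dots> = g * y + h * y + h * Delta0_word w" by (simp add: algebra_simps)
  also have "\<dots> \<in> len_ge (Suc (length (n # w)))"
    using len_ge_mult[OF g y] len_ge_mult[OF h y] len_ge_mult[OF h Delta0_word_len_ge[of w]]
    by (intro len_ge_add) (auto elim: len_ge_mono)
  finally show ?case .
qed simp

lemma Delta_word_len_ge: "Delta_word w \<in> len_ge (length w)"
  using len_ge_add[OF len_ge_mono[OF Delta_word_leading] Delta0_word_len_ge, of "w" "w"] by simp

definition slice :: "'b \<Rightarrow> ('b \<times> 'c \<Rightarrow>\<^sub>0 'r::comm_ring_1) \<Rightarrow> ('c \<Rightarrow>\<^sub>0 'r)" where
  "slice u = lin (\<lambda>(u', v). if u' = u then single v 1 else 0)"

lemma slice_add: "slice u (x + y) = slice u x + slice u y"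
  and slice_zero [simp]: "slice u 0 = 0"
  by (simp_all add: slice_def lin_add lin_scale lin_diff)

lemma slice_single [simp]:
  "slice u (single (u', v) c) = (if u' = u then single v c else 0)"
  by (simp add: slice_def)

lemma lookup_slice: "lookup (slice u z) v = lookup z (u, v)"
proof (induction z rule: poly_mapping_linear_induct)
  case (single w c)
  then show ?case by (cases w) (auto simp: lookup_single when_def)
qed (simp_all add: slice_add lookup_add)

lemma lookup_iter_cop_Suc:
  "lookup (iter_cop (Suc n) f) (u # ws) = lookup (iter_cop n (slice u (Delta f))) ws"
proof -
  have "lookup (cons_iter n z) (u # ws) = lookup (iter_cop n (slice u z)) ws" for z
  proof (induction z rule: poly_mapping_linear_induct)
    case (single w c)
    obtain a b where w: "w = (a, b)" by force
    have "iter_cop n (single b c) = scale c (iter_cop n (single b 1))"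
      by (simp flip: iter_cop_scale)
    then show ?case by (simp add: cons_iter_def w lookup_single)
  qed (simp_all add: slice_add lookup_add iter_cop_add cons_iter_def lin_add)
  then show ?thesis by (simp only: iter_cop_Suc)
qed

text \<open>\<Delta> never lowers total length, so a coefficient of total length p sees no words of
  \<open>f\<close> longer than p.\<close>

lemma lookup_iter_cop_eq_0:
  assumes "\<And>v. v \<in> keys f \<Longrightarrow> sum_list (map length ws) < length v" "length ws = n"
  shows "lookup (iter_cop n f) ws = 0"
  using assms
proof (induction ws arbitrary: f n)
  case Nil
  then have "[] \<notin> keys f" by force
  with Nil show ?case by (simp add: eps_def in_keys_iff)
next
  case (Cons u ws)
  then obtain m where m: "n = Suc m" "length ws = m" by auto
  have "lookup (iter_cop m (slice u (Delta f))) ws = 0"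
  proof (rule Cons.IH)
    fix v assume "v \<in> keys (slice u (Delta f))"
    then have "(u, v) \<in> keys (Delta f)" by (simp add: in_keys_iff lookup_slice)
    then obtain w where w: "w \<in> keys f" "(u, v) \<in> keys (Delta_word w :: _ \<Rightarrow>\<^sub>0 'a)"
      using keys_lin[of Delta_word f] by blast
    from w(2) Delta_word_len_ge[of w, where 'a = 'a] have "length w \<le> length u + length v"
      by (auto simp: len_ge_def)
    with Cons.prems(1)[OF w(1)] show "sum_list (map length ws) < length v" by simp
  qed (rule m)
  then show ?case by (simp only: m lookup_iter_cop_Suc)
qed

section \<open>The Dynkin operator\<close>

text \<open>Right-normed iterated brackets; the value 0 at the empty word lets the Dynkin identity
  count the letters of a word starting from 0.\<close>

fun lie_word :: "nat list \<Rightarrow> 'r::comm_ring_1 free_alg" where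
  "lie_word [] = 0"
| "lie_word [n] = gen n"
| "lie_word (n # w) = gen n * lie_word w - lie_word w * gen n"

definition dynkin :: "(nat list \<times> nat list \<Rightarrow>\<^sub>0 'r::comm_ring_1) \<Rightarrow> 'r free_alg" where
  "dynkin = lin (\<lambda>(u, v). lie_word u * single v 1)"

text \<open>Prefixing \<open>n\<close> brackets \<open>lie_word u\<close> with \<open>gen n\<close>,
  and the subtracted term of the bracket cancels the summand in which \<open>gen n\<close> is put
  before \<open>v\<close>. The exception is \<open>u = []\<close>, where the bracket rule would give
  0 instead of \<open>gen n\<close>; \<open>eps_L\<close> collects these terms.\<close>

lemma dynkin_primitive_mult:
  "dynkin ((gen n \<otimes>\<^sub>T 1 + 1 \<otimes>\<^sub>T gen n) * z) = gen n * (dynkin z + eps_L z)"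
proof (rule linear_ext[where F = "\<lambda>z. dynkin ((gen n \<otimes>\<^sub>T 1 + 1 \<otimes>\<^sub>T gen n) * z)" and G = "\<lambda>z. gen n * (dynkin z + eps_L z)"])
  fix w :: "nat list \<times> nat list"
  obtain u v where w: "w = (u, v)" by force
  have "(gen n \<otimes>\<^sub>T 1 + 1 \<otimes>\<^sub>T gen n) * single w (1 :: 'a) =
      single (n # u, v) 1 + single (u, n # v) 1"
    by (simp add: w gen_def distrib_right mult_single plus_list_def flip: single_Nil)
  then have d: "dynkin ((gen n \<otimes>\<^sub>T 1 + 1 \<otimes>\<^sub>T gen n) * single w (1 :: 'a)) =
      lie_word (n # u) * single v 1 + lie_word u * (gen n * single v 1)"
    by (simp add: dynkin_def lin_add single_Cons)
  have l: "lie_word (n # u) = gen n * lie_word u - lie_word u * gen n + (if u = [] then gen n else 0)"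
    by (cases u) simp_all
  show "dynkin ((gen n \<otimes>\<^sub>T 1 + 1 \<otimes>\<^sub>T gen n) * single w (1 :: 'a)) =
      gen n * (dynkin (single w 1) + eps_L (single w 1))"
    unfolding d l by (simp add: dynkin_def eps_L_def w algebra_simps)
qed (simp_all add: dynkin_def eps_L_def lin_add lin_scale scale_mult_right distrib_left scale_add_right)

lemma eps_L_Delta0_word: "eps_L (Delta0_word w) = single w 1"
proof (induction w)
  case Nil
  show ?case using eps_L_tens[of 1 "1 :: 'a free_alg"] by simp
next
  case (Cons n w)
  have "eps_L (gen n \<otimes>\<^sub>T 1 + 1 \<otimes>\<^sub>T gen n) = (gen n :: 'a free_alg)"
    using eps_L_tens[of "gen n" "1 :: 'a free_alg"] eps_L_tens[of 1 "gen n :: 'a free_alg"]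
    by (simp add: eps_L_def lin_add)
  then show ?case by (simp add: eps_L_mult Cons single_Cons)
qed

text \<open>By \<open>dynkin_primitive_mult\<close>, each letter adds one copy of the word through
  \<open>eps_L\<close>.\<close>

lemma dynkin_Delta0_word: "dynkin (Delta0_word w) = scale (of_nat (length w)) (single w 1)"
proof (induction w)
  case Nil
  have "dynkin (1 :: _ \<Rightarrow>\<^sub>0 'a) = 0"
    by (simp add: dynkin_def zero_prod_def zero_list_def flip: single_one)
  then show ?case by simp
next
  case (Cons n w)
  have "dynkin (Delta0_word (n # w)) = gen n * scale (1 + of_nat (length w)) (single w (1 :: 'a))"
    by (simp only: Delta0_word.simps dynkin_primitive_mult Cons eps_L_Delta0_word scale_add_left)
      (simp add: add.commute)
  also have "\<dots> = scale (1 + of_nat (length w)) (single (n # w) 1)"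
    by (simp only: scale_mult_right single_Cons)
  finally show ?case by simp
qed

lemma dynkin_Delta0:
  assumes "\<And>w. w \<in> keys f \<Longrightarrow> length w = p"
  shows "dynkin (Delta0 f) = scale (of_nat p) f"
proof -
  have "dynkin (Delta0 f) = lin (\<lambda>w. dynkin (Delta0_word w)) f"
    by (simp add: dynkin_def lin_lin)
  also have "\<dots> = lin (\<lambda>w. scale (of_nat p) (single w 1)) f"
    by (rule lin_cong) (simp add: dynkin_Delta0_word assms)
  finally show ?thesis by (simp only: lin_scale_fun lin_id)
qed

text \<open>Groups the terms by their first word, so that each second factor can be treated by
  induction on its length.\<close>

lemma dynkin_slices:
  "dynkin z = (\<Sum>u\<in>fst ` keys z. lie_word u * slice u z)"
proof -
  have *: "dynkin z = (\<Sum>u\<in>U. lie_word u * slice u z)" if "finite U" "fst ` keys z \<subseteq> U" for U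
  proof -
    have "keys z \<subseteq> {p. fst p \<in> U}" using that by auto
    then show ?thesis
    proof (induction z rule: poly_mapping_keys_induct)
      case (single w c)
      then have "(\<Sum>u\<in>U. lie_word u * slice u (single w c)) =
          (\<Sum>u\<in>U. if u = fst w then lie_word (fst w) * single (snd w) c else 0)"
        by (intro sum.cong) (auto simp: slice_def split: prod.splits)
      also have "\<dots> = lie_word (fst w) * single (snd w) c"
        using single that(1) by simp
      also have "\<dots> = dynkin (single w c)"
        by (subst mult_single_right) (simp add: dynkin_def split: prod.splits)
      finally show ?case by simp
    qed (simp_all add: dynkin_def lin_add slice_add distrib_left sum.distrib)
  qed
  then show ?thesis by simp
qed

lemma slice_Delta0_keys:
  assumes "\<And>w. w \<in> keys f \<Longrightarrow> length w = p" "f \<in> words \<nu>" "v \<in> keys (slice u (Delta0 f))"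
  shows "length u + length v = p" "set u \<subseteq> letters \<nu>" "set v \<subseteq> letters \<nu>"
proof -
  have "(u, v) \<in> keys (Delta0 f)" using assms(3) by (simp add: in_keys_iff lookup_slice)
  then obtain w where w: "w \<in> keys f" "(u, v) \<in> keys (Delta0_word w :: _ \<Rightarrow>\<^sub>0 'a)"
    using keys_lin[of Delta0_word f] by blast
  have "set w \<subseteq> letters \<nu>" using w(1) assms(2) by (auto simp: words_def)
  with Delta0_word_keys[OF w(2)] assms(1)[OF w(1)]
  show "length u + length v = p" "set u \<subseteq> letters \<nu>" "set v \<subseteq> letters \<nu>" by auto
qed

text \<open>\<open>Delta f - Delta0 f\<close> has only terms of total length above \<open>p\<close>,
  and \<open>lookup_iter_cop_eq_0\<close> discards them. Thus conditions on the iterated coproduct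
  of \<open>f\<close> pass to the slices of its primitive coproduct.\<close>

lemma lookup_iter_cop_slice:
  assumes "\<And>w. w \<in> keys f \<Longrightarrow> length w = p"
    and "length ws = n" "length u + sum_list (map length ws) = p"
  shows "lookup (iter_cop n (slice u (Delta0 f))) ws = lookup (iter_cop (Suc n) f) (u # ws)"
proof -
  let ?d = "slice u (Delta f) - slice u (Delta0 f)"
  have "lookup (iter_cop n ?d) ws = 0"
  proof (rule lookup_iter_cop_eq_0)
    fix v assume "v \<in> keys ?d"
    then have "(u, v) \<in> keys (Delta f - Delta0 f)"
      by (simp add: in_keys_iff lookup_slice lookup_minus)
    also have "Delta f - Delta0 f = lin (\<lambda>w. Delta_word w - Delta0_word w) f"
      by (simp add: lin_def scale_diff_right sum_subtractf)
    finally obtain w where w: "w \<in> keys f"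
        "(u, v) \<in> keys (Delta_word w - Delta0_word w :: _ \<Rightarrow>\<^sub>0 'a)"
      using keys_lin[of "\<lambda>w. Delta_word w - Delta0_word w" f] by blast
    from w(2) Delta_word_leading[of w, where 'r = 'a] have "length w < length u + length v"
      by (auto simp: len_ge_def)
    with assms(1)[OF w(1)] assms(3) show "sum_list (map length ws) < length v" by simp
  qed (rule assms)
  moreover have "iter_cop n (slice u (Delta f)) = iter_cop n ?d + iter_cop n (slice u (Delta0 f))"
    by (simp flip: iter_cop_add)
  ultimately show ?thesis by (simp add: lookup_iter_cop_Suc lookup_add)
qed


section \<open>The quantized Hopf algebra\<close>

abbreviation pscale :: "'k::field poly \<Rightarrow> ('b \<Rightarrow>\<^sub>0 'k poly fract) \<Rightarrow> ('b \<Rightarrow>\<^sub>0 'k poly fract)" where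
  "pscale p \<equiv> scale (to_fract p)"

interpretation pm: Modules.module "pscale :: 'k::field poly \<Rightarrow> ('b \<Rightarrow>\<^sub>0 'k poly fract) \<Rightarrow> _"
  by unfold_locales (simp_all add: scale_add_right scale_add_left)

lemma hbar_neq_0 [simp]: "(hbar :: 'k::field poly fract) \<noteq> 0"
  by (simp add: hbar_def)

lemma hbar_power: "hbar ^ n = to_fract ([:0, 1:] ^ n :: 'k::field poly)"
proof -
  have "to_fract (p ^ n) = to_fract p ^ n" for p :: "'k poly"
    by (induction n) simp_all
  then show ?thesis by (simp only: hbar_def)
qed

lemma span_linear_image:
  fixes F :: "('b \<Rightarrow>\<^sub>0 'k::field poly fract) \<Rightarrow> ('c \<Rightarrow>\<^sub>0 'k poly fract)"
  assumes "z \<in> pm.span B" "F 0 = 0" "\<And>x y. F (x + y) = F x + F y" "\<And>c x. F (scale c x) = scale c (F x)"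
    and "\<And>b. b \<in> B \<Longrightarrow> F b \<in> pm.span C"
  shows "F z \<in> pm.span C"
  using assms(1)
  by (induction z rule: pm.span_induct_alt) (simp_all add: assms(2-5) pm.span_add pm.span_scale pm.span_zero)

lemma span_mult:
  fixes x y :: "'b::monoid_add \<Rightarrow>\<^sub>0 'k::field poly fract"
  assumes "\<And>b c. b \<in> B \<Longrightarrow> c \<in> B \<Longrightarrow> b * c \<in> pm.span B" "x \<in> pm.span B" "y \<in> pm.span B"
  shows "x * y \<in> pm.span B"
proof -
  have "b * y \<in> pm.span B" if "b \<in> B" for b
    by (rule span_linear_image[OF assms(3), where F = "\<lambda>y. b * y"])
      (use that assms(1) in \<open>simp_all add: distrib_left scale_mult_right\<close>)
  then show ?thesis
    by (intro span_linear_image[OF assms(2), where F = "\<lambda>x. x * y"]) (simp_all add: distrib_right scale_mult_left)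
qed

definition hcomm :: "('b::monoid_add \<Rightarrow>\<^sub>0 'k::field poly fract) \<Rightarrow> ('b \<Rightarrow>\<^sub>0 'k poly fract) \<Rightarrow> ('b \<Rightarrow>\<^sub>0 'k poly fract)" where
  "hcomm x y = scale (inverse hbar) (x * y - y * x)"

lemma hcomm_zero_left [simp]: "hcomm 0 y = 0" and hcomm_zero_right [simp]: "hcomm x 0 = 0"
  and hcomm_add_left: "hcomm (x + x') y = hcomm x y + hcomm x' y"
  and hcomm_add_right: "hcomm x (y + y') = hcomm x y + hcomm x y'"
  and hcomm_scale_left: "hcomm (scale c x) y = scale c (hcomm x y)"
  and hcomm_scale_right: "hcomm x (scale c y) = scale c (hcomm x y)"
  by (simp_all add: hcomm_def scale_mult_left scale_mult_right scale_add_right scale_diff_right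
      distrib_left distrib_right mult.commute)

lemma span_hcomm:
  fixes x y :: "'b::monoid_add \<Rightarrow>\<^sub>0 'k::field poly fract"
  assumes "\<And>b c. b \<in> B \<Longrightarrow> c \<in> B \<Longrightarrow> hcomm b c \<in> pm.span B" "x \<in> pm.span B" "y \<in> pm.span B"
  shows "hcomm x y \<in> pm.span B"
proof -
  have "hcomm b y \<in> pm.span B" if "b \<in> B" for b
    by (rule span_linear_image[OF assms(3), where F = "hcomm b"])
      (use that assms(1) in \<open>simp_all add: hcomm_add_right hcomm_scale_right\<close>)
  then show ?thesis
    by (intro span_linear_image[OF assms(2), where F = "\<lambda>x. hcomm x y"])
      (simp_all add: hcomm_add_left hcomm_scale_left)
qed

text \<open>
  The explicit form of \<open>(\<H>\<^sub>\<hbar>\<^sup>\<or>)'\<close>: the smallest \<open>k[\<hbar>]\<close>-subalgebra that contains the generators and is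
  commutative modulo \<open>\<hbar>\<close>.
\<close>

inductive_set quant :: "enat \<Rightarrow> 'k::field qfree set" for \<nu> where
  one: "1 \<in> quant \<nu>"
| gen: "n \<in> letters \<nu> \<Longrightarrow> gen n \<in> quant \<nu>"
| add: "x \<in> quant \<nu> \<Longrightarrow> y \<in> quant \<nu> \<Longrightarrow> x + y \<in> quant \<nu>"
| scale: "x \<in> quant \<nu> \<Longrightarrow> pscale p x \<in> quant \<nu>"
| mult: "x \<in> quant \<nu> \<Longrightarrow> y \<in> quant \<nu> \<Longrightarrow> x * y \<in> quant \<nu>"
| comm: "x \<in> quant \<nu> \<Longrightarrow> y \<in> quant \<nu> \<Longrightarrow> hcomm x y \<in> quant \<nu>"

lemma quant_zero [simp]: "0 \<in> quant \<nu>"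
  using quant.scale[OF quant.one, where p = 0] by simp

lemma quant_minus: "x \<in> quant \<nu> \<Longrightarrow> - x \<in> quant \<nu>"
  using quant.scale[where p = "-1"] by (simp add: scale_minus_left)

lemma quant_diff: "x \<in> quant \<nu> \<Longrightarrow> y \<in> quant \<nu> \<Longrightarrow> x - y \<in> quant \<nu>"
  using quant.add[of x \<nu> "- y"] quant_minus[of y] by simp

lemma quant_sum: "(\<And>i. i \<in> I \<Longrightarrow> f i \<in> quant \<nu>) \<Longrightarrow> (\<Sum>i\<in>I. f i) \<in> quant \<nu>"
  by (induction I rule: infinite_finite_induct) (simp_all add: quant.add)

lemma quant_prod_list: "(\<And>x. x \<in> set xs \<Longrightarrow> f x \<in> quant \<nu>) \<Longrightarrow> prod_list (map f xs) \<in> quant \<nu>"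
  by (induction xs) (simp_all add: quant.mult quant.one)

lemma quant_of_nat: "of_nat n \<in> quant \<nu>"
  by (induction n) (simp_all add: quant.add quant.one)

lemma quant_word: "set w \<subseteq> letters \<nu> \<Longrightarrow> single w 1 \<in> quant \<nu>"
  by (induction w) (simp_all add: quant.one single_Cons quant.mult quant.gen)

lemma quant_Q_poly:
  assumes "n \<in> letters \<nu>" "t \<le> n"
  shows "Q_poly l t \<in> quant \<nu>"
  unfolding Q_poly_def P_poly_def
proof (intro quant_sum quant_prod_list quant.gen quant.mult quant_of_nat, clarify)
  fix js :: "nat list" and j
  assume "\<forall>j\<in>set js. 0 < j" "t = sum_list js" "j \<in> set js"
  moreover from this have "j \<le> sum_list js" by (simp add: member_le_sum_list)
  ultimately show "j \<in> letters \<nu>"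
    using assms letters_le[of n \<nu> j] by auto
qed

lemma quant_words: "x \<in> quant \<nu> \<Longrightarrow> x \<in> words \<nu>"
  by (induction rule: quant.induct)
    (simp_all add: words_gen words_add words_scale words_mult hcomm_def words_diff)

lemma antip_quant: "x \<in> quant \<nu> \<Longrightarrow> antip x \<in> quant \<nu>"
proof (induction rule: quant.induct)
  case (gen n)
  then have "antipode_gen n \<in> quant \<nu>"
  proof (induction n rule: antipode_gen.induct)
    case (1 n)
    show ?case
      unfolding antipode_gen.simps[of n]
      by (intro quant_diff quant_minus quant.gen quant_sum quant.mult 1 quant_Q_poly[of n])
        (use 1 letters_le in auto)
  qed
  then show ?case by (simp add: antip_gen)
next
  case (comm x y)
  have "antip (hcomm x y) = hcomm (antip y) (antip x)"
    by (simp add: hcomm_def lin_scale lin_diff antip_mult)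
  then show ?case using comm by (simp add: quant.comm)
qed (auto simp: lin_add lin_scale antip_mult intro: quant.intros)

section \<open>Tensor powers over k[\<hbar>] inside those over k(\<hbar>)\<close>

definition pair_span :: "'k::field qfree set \<Rightarrow> (nat list \<times> nat list \<Rightarrow>\<^sub>0 'k poly fract) set" where
  "pair_span S = pm.span {f \<otimes>\<^sub>T g | f g. f \<in> S \<and> g \<in> S}"

lemma pair_span_tens: "f \<in> S \<Longrightarrow> g \<in> S \<Longrightarrow> f \<otimes>\<^sub>T g \<in> pair_span S"
  unfolding pair_span_def by (rule pm.span_base) auto

lemma pair_span_add: "x \<in> pair_span S \<Longrightarrow> y \<in> pair_span S \<Longrightarrow> x + y \<in> pair_span S"
  and pair_span_scale: "x \<in> pair_span S \<Longrightarrow> pscale p x \<in> pair_span S"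
  and pair_span_sum: "(\<And>i. i \<in> I \<Longrightarrow> f i \<in> pair_span S) \<Longrightarrow> sum f I \<in> pair_span S"
  by (simp_all add: pair_span_def pm.span_add pm.span_scale pm.span_sum)

lemma pair_span_hcomm:
  assumes "x \<in> pair_span (quant \<nu>)" "y \<in> pair_span (quant \<nu>)"
  shows "hcomm x y \<in> pair_span (quant \<nu>)"
  unfolding pair_span_def
proof (rule span_hcomm[OF _ assms[unfolded pair_span_def]])
  fix b c :: "nat list \<times> nat list \<Rightarrow>\<^sub>0 'a poly fract"
  assume "b \<in> {f \<otimes>\<^sub>T g | f g. f \<in> quant \<nu> \<and> g \<in> quant \<nu>}" "c \<in> {f \<otimes>\<^sub>T g | f g. f \<in> quant \<nu> \<and> g \<in> quant \<nu>}"
  then obtain f g f' g' where b: "b = f \<otimes>\<^sub>T g" and c: "c = f' \<otimes>\<^sub>T g'"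
    and q: "f \<in> quant \<nu>" "g \<in> quant \<nu>" "f' \<in> quant \<nu>" "g' \<in> quant \<nu>" by auto
  \<comment> \<open>Leibniz rule for a commutator of pure tensors, obtained by inserting
    \<open>(f' * f) \<otimes> (g * g')\<close>; each summand carries one bracket, which absorbs the
    single factor \<open>inverse hbar\<close>.\<close>
  have "hcomm b c = hcomm f f' \<otimes>\<^sub>T (g * g') + (f' * f) \<otimes>\<^sub>T hcomm g g'"
    by (simp add: b c hcomm_def tens2_mult tens2_scale_left tens2_scale_right tens2_diff_left tens2_diff_right
        flip: scale_add_right)
  also have "\<dots> \<in> pair_span (quant \<nu>)"
    using q by (intro pair_span_add pair_span_tens quant.mult quant.comm)
  finally show "hcomm b c \<in> pm.span {f \<otimes>\<^sub>T g | f g. f \<in> quant \<nu> \<and> g \<in> quant \<nu>}"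
    by (simp add: pair_span_def)
qed

lemma pair_span_mult:
  assumes "x \<in> pair_span (quant \<nu>)" "y \<in> pair_span (quant \<nu>)"
  shows "x * y \<in> pair_span (quant \<nu>)"
  unfolding pair_span_def
  by (rule span_mult[OF _ assms[unfolded pair_span_def]])
    (auto simp: tens2_mult intro!: pair_span_tens[unfolded pair_span_def] quant.mult)

lemma Delta_quant: "x \<in> quant \<nu> \<Longrightarrow> Delta x \<in> pair_span (quant \<nu>)"
proof (induction rule: quant.induct)
  case one
  show ?case using pair_span_tens[OF quant.one quant.one] by simp
next
  case (gen n)
  have "Delta (gen n :: 'a qfree) =
      gen n \<otimes>\<^sub>T 1 + 1 \<otimes>\<^sub>T gen n + (\<Sum>m\<in>{1..<n}. gen m \<otimes>\<^sub>T Q_poly m (n - m))"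
    by (simp add: Delta_gen comult_gen_def pair_of_def lin_add lin_sum)
  also have "\<dots> \<in> pair_span (quant \<nu>)"
    using gen by (intro pair_span_add pair_span_sum pair_span_tens quant.one quant.gen quant_Q_poly[of n])
      (auto intro: letters_le)
  finally show ?case .
next
  case (comm x y)
  have "Delta (hcomm x y) = hcomm (Delta x) (Delta y)"
    by (simp add: hcomm_def lin_scale lin_diff Delta_mult)
  then show ?case using comm by (simp add: pair_span_hcomm)
qed (simp_all add: lin_add lin_scale Delta_mult pair_span_add pair_span_scale pair_span_mult)

definition tens_span :: "'k::field qfree set \<Rightarrow> nat \<Rightarrow> (nat list list \<Rightarrow>\<^sub>0 'k poly fract) set" where
  "tens_span S n = pm.span (wtens ` tuples S n)"

lemma list_of_pair_span: "z \<in> pair_span S \<Longrightarrow> list_of_pair z \<in> tens_span S 2"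
  unfolding pair_span_def tens_span_def
  by (rule span_linear_image[where F = list_of_pair])
    (auto simp: list_of_pair_def lin_add lin_scale tuples_def simp flip: wtens_2[unfolded list_of_pair_def]
      simp del: wtens.simps intro!: pm.span_base imageI)

lemma lookup_map_tensor_id: "lookup (map_tensor to_fract id s) xs = to_fract (lookup s xs)"
  by (auto simp: map_tensor_def lookup_sum lookup_single when_def in_keys_iff)

lemma map_tensor_id_tensors: "map_tensor to_fract id s \<in> tensors L n \<longleftrightarrow> s \<in> tensors L n"
proof -
  have "keys (map_tensor to_fract id s) = keys s"
    by (auto simp: in_keys_iff lookup_map_tensor_id)
  then show ?thesis by (simp add: tensors_def)
qed

text \<open>Translates the witnesses in \<open>drinfeld_prime\<close>, formal tensors over
  k[\<hbar>], into membership in a k[\<hbar>]-span, where span induction is available.\<close>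

lemma tens_span_iff:
  "z \<in> tens_span S n \<longleftrightarrow> (\<exists>s \<in> tensors S n. tvec id (map_tensor to_fract id s) = z)"
proof
  assume "z \<in> tens_span S n"
  then show "\<exists>s \<in> tensors S n. tvec id (map_tensor to_fract id s) = z"
    unfolding tens_span_def
  proof (induction z rule: pm.span_induct_alt)
    case base
    show ?case by (rule bexI[of _ 0]) (simp_all add: map_tensor_def)
  next
    case (step c b z)
    from step(2) obtain s where s: "s \<in> tensors S n" "tvec id (map_tensor to_fract id s) = z" by blast
    from step(1) obtain xs where xs: "xs \<in> tuples S n" "b = wtens xs" by blast
    have "map_tensor to_fract id (single xs c + s) =
        single xs (to_fract c) + map_tensor to_fract id s"
      by (rule poly_mapping_eqI) (simp add: lookup_map_tensor_id lookup_add lookup_single when_def)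
    then have "tvec id (map_tensor to_fract id (single xs c + s)) = pscale c b + z"
      by (simp only: tvec_add tvec_single s(2) xs(2) list.map_id)
    then show ?case
      using s xs by (intro bexI[of _ "single xs c + s"] tensors_add tensors_single)
  qed
next
  assume "\<exists>s \<in> tensors S n. tvec id (map_tensor to_fract id s) = z"
  then obtain s where s: "s \<in> tensors S n" "tvec id (map_tensor to_fract id s) = z" by auto
  have "z = (\<Sum>xs\<in>keys s. pscale (lookup s xs) (wtens xs))"
    using s(2) by (simp add: map_tensor_def tvec_def lin_sum)
  also have "\<dots> \<in> tens_span S n"
    unfolding tens_span_def
    by (intro pm.span_sum pm.span_scale pm.span_base imageI) (use s(1) in \<open>auto simp: tensors_def\<close>)
  finally show "z \<in> tens_span S n" .
qed

text \<open>The free k[\<hbar>]-module on the words in the \<open>x_n\<close>, where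
  \<open>a_n = \<hbar> x_n\<close>; it turns out to be \<open>H_vee \<nu>\<close>
  (\<open>H_vee_eq_lattice\<close>).\<close>

definition lattice :: "enat \<Rightarrow> 'k::field qfree set" where
  "lattice \<nu> = {f \<in> words \<nu>. \<forall>w. \<exists>p. lookup f w * hbar ^ length w = to_fract p}"

lemma lattice_zero [simp]: "0 \<in> lattice \<nu>"
  by (auto simp: lattice_def intro: exI[of _ 0])

lemma lattice_add: "f \<in> lattice \<nu> \<Longrightarrow> g \<in> lattice \<nu> \<Longrightarrow> f + g \<in> lattice \<nu>"
  unfolding lattice_def
  by (clarsimp simp: words_add lookup_add distrib_right) (metis to_fract_add)

lemma lattice_scale: "f \<in> lattice \<nu> \<Longrightarrow> pscale p f \<in> lattice \<nu>"
  unfolding lattice_def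
  by (clarsimp simp: words_scale mult.assoc) (metis to_fract_mult)

lemma lattice_sum: "(\<And>i. i \<in> I \<Longrightarrow> f i \<in> lattice \<nu>) \<Longrightarrow> sum f I \<in> lattice \<nu>"
  by (induction I rule: infinite_finite_induct) (simp_all add: lattice_add)

lemma lattice_single:
  "set w \<subseteq> letters \<nu> \<Longrightarrow> c * hbar ^ length w = to_fract p \<Longrightarrow> single w c \<in> lattice \<nu>"
  unfolding lattice_def
  by (auto simp: words_single lookup_single when_def intro: exI[of _ 0])

lemma lattice_mult:
  assumes "f \<in> lattice \<nu>" "g \<in> lattice \<nu>"
  shows "f * g \<in> lattice \<nu>"
proof -
  have "f * g = (\<Sum>u\<in>keys f. single u (lookup f u)) *
      (\<Sum>v\<in>keys g. single v (lookup g v))"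
    by (simp only: poly_mapping_sum_single)
  also have "\<dots> = (\<Sum>u\<in>keys f. \<Sum>v\<in>keys g.
      single (u @ v) (lookup f u * lookup g v))"
    by (simp add: sum_product mult_single plus_list_def)
  also have "\<dots> \<in> lattice \<nu>"
  proof (intro lattice_sum)
    fix u v assume uv: "u \<in> keys f" "v \<in> keys g"
    from assms obtain p q where "lookup f u * hbar ^ length u = to_fract p"
      "lookup g v * hbar ^ length v = to_fract q"
      unfolding lattice_def by blast
    then have "(lookup f u * lookup g v) * hbar ^ length (u @ v) = to_fract (p * q)"
      by (simp add: power_add mult_ac flip: to_fract_mult)
    then show "single (u @ v) (lookup f u * lookup g v) \<in> lattice \<nu>"
      using uv assms by (intro lattice_single[where p = "p * q"]) (auto simp: lattice_def words_def)
  qed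
  finally show ?thesis .
qed

lemma lattice_minus: "f \<in> lattice \<nu> \<Longrightarrow> - f \<in> lattice \<nu>"
  using lattice_scale[of f \<nu> "-1"] by (simp add: scale_minus_left)

lemma lattice_diff: "f \<in> lattice \<nu> \<Longrightarrow> g \<in> lattice \<nu> \<Longrightarrow> f - g \<in> lattice \<nu>"
  using lattice_add[of f \<nu> "- g"] lattice_minus[of g] by simp

lemma lattice_one: "1 \<in> lattice \<nu>"
  using lattice_single[of "[]" \<nu> 1 1] by simp

lemma lattice_hbar: "f \<in> lattice \<nu> \<Longrightarrow> scale hbar f \<in> lattice \<nu>"
  unfolding hbar_def by (rule lattice_scale)

text \<open>Stronger than membership in the lattice, so that the induction survives brackets:
  constants are central, and \<hbar>^(-1) [\<hbar> l, \<hbar> l'] = \<hbar> [l, l'] regains the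
  factor \<hbar>.\<close>

lemma quant_reduced:
  "x \<in> quant \<nu> \<Longrightarrow> \<exists>r l. l \<in> lattice \<nu> \<and> x = pscale r 1 + scale hbar l"
proof (induction rule: quant.induct)
  case one
  show ?case by (rule exI[of _ 1], rule exI[of _ 0]) simp
next
  case (gen n)
  have "scale (inverse hbar) (gen n) \<in> lattice \<nu>"
    unfolding gen_def scale_single by (rule lattice_single[where p = 1]) (use gen in simp_all)
  then show ?case by (intro exI[of _ 0] exI[of _ "scale (inverse hbar) (gen n)"]) simp
next
  case (add x y)
  then obtain r l r' l' where "l \<in> lattice \<nu>" "x = pscale r 1 + scale hbar l"
    "l' \<in> lattice \<nu>" "y = pscale r' 1 + scale hbar l'" by blast
  then show ?case
    by (intro exI[of _ "r + r'"] exI[of _ "l + l'"])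
      (simp add: lattice_add scale_add_left scale_add_right algebra_simps)
next
  case (scale x p)
  then obtain r l where "l \<in> lattice \<nu>" "x = pscale r 1 + scale hbar l" by blast
  then show ?case
    by (intro exI[of _ "p * r"] exI[of _ "pscale p l"])
      (simp add: lattice_scale scale_add_right mult.commute)
next
  case (mult x y)
  then obtain r l r' l' where l: "l \<in> lattice \<nu>" "x = pscale r 1 + scale hbar l"
    "l' \<in> lattice \<nu>" "y = pscale r' 1 + scale hbar l'" by blast
  then show ?case
    by (intro exI[of _ "r * r'"] exI[of _ "pscale r l' + pscale r' l + scale hbar (l * l')"])
      (simp add: lattice_scale lattice_add lattice_mult lattice_hbar distrib_left distrib_right
        scale_mult_left scale_mult_right scale_add_right mult_ac add_ac)
next
  case (comm x y)
  then obtain r l r' l' where l: "l \<in> lattice \<nu>" "x = pscale r 1 + scale hbar l"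
    "l' \<in> lattice \<nu>" "y = pscale r' 1 + scale hbar l'" by blast
  have "hcomm x y = scale hbar (l * l' - l' * l)"
    by (simp add: l hcomm_def distrib_left distrib_right scale_mult_left scale_mult_right scale_diff_right
        scale_add_right mult_ac)
  with l show ?case
    by (intro exI[of _ 0] exI[of _ "l * l' - l' * l"]) (simp add: lattice_diff lattice_mult)
qed

lemma quant_lattice: "x \<in> quant \<nu> \<Longrightarrow> x \<in> lattice \<nu>"
  using quant_reduced lattice_add lattice_scale lattice_one lattice_hbar by metis

lemma eps_quant: "x \<in> quant \<nu> \<Longrightarrow> \<exists>r. eps x = to_fract r"
  using quant_lattice[of x \<nu>] by (force simp: lattice_def eps_def dest: spec[of _ "[]"])

text \<open>Applying id - u \<epsilon> to an element of M gains a factor \<hbar>; over n tensor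
  factors this is the \<hbar>^n asked of \<delta>_n.\<close>

lemma quant_reduced_lattice:
  assumes "x \<in> quant \<nu>"
  shows "\<exists>l\<in>lattice \<nu>. x - scale (eps x) 1 = scale hbar l"
proof -
  obtain r l where l: "l \<in> lattice \<nu>" "x = pscale r 1 + scale hbar l" using quant_reduced[OF assms] by blast
  obtain p where p: "eps l = to_fract p" using l(1) by (force simp: lattice_def eps_def dest: spec[of _ "[]"])
  have "x - scale (eps x) 1 = scale hbar (l - scale (eps l) 1)"
    by (simp add: l(2) scale_add_left scale_diff_right)
  moreover have "l - scale (eps l) 1 \<in> lattice \<nu>"
    unfolding p by (intro lattice_diff lattice_scale lattice_one l)
  ultimately show ?thesis by blast
qed


section \<open>Identification of \<open>H_vee\<close> with the lattice\<close>

lemma lookup_base_change: "lookup (base_change f) w = to_fract [:lookup f w:]"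
  by (simp add: base_change_def Poly_Mapping.map.rep_eq when_def)

lemma ideal_power_keys:
  assumes "x \<in> ideal_power (nc_diff \<nu>) (aug_ideal (nc_diff \<nu>)) n"
  shows "x \<in> words \<nu> \<and> (\<forall>w\<in>keys x. n \<le> length w)"
  using assms
proof (induction n arbitrary: x)
  case (Suc n)
  from Suc.prems have "x \<in> ideal_prod (nc_diff \<nu>) (aug_ideal (nc_diff \<nu>)) (ideal_power (nc_diff \<nu>) (aug_ideal (nc_diff \<nu>)) n)"
    by simp
  then show ?case
  proof (induction rule: ideal_prod.induct)
    case (prod i j)
    have i: "i \<in> words \<nu>" "[] \<notin> keys i"
      using prod(1) by (auto simp: aug_ideal_def eps_def in_keys_iff)
    have "Suc n \<le> length w" if "w \<in> keys (i * j)" for w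
    proof -
      from that obtain u v where "u \<in> keys i" "v \<in> keys j" "w = u @ v"
        using Poly_Mapping.keys_mult[of i j] by (auto simp: plus_list_def)
      moreover from this have "u \<noteq> []" using i(2) by auto
      ultimately show ?thesis using Suc.IH[OF prod(2)] by (cases u) auto
    qed
    then show ?case using Suc.IH[OF prod(2)] i(1) by (simp add: words_mult)
  next
    case (sum x y)
    then show ?case using Poly_Mapping.keys_add[of x y] by (auto simp: words_add)
  qed
qed simp

lemma single_ideal_power:
  "set w \<subseteq> letters \<nu> \<Longrightarrow>
    single w (1 :: 'r::comm_ring_1) \<in> ideal_power (nc_diff \<nu>) (aug_ideal (nc_diff \<nu>)) (length w)"
proof (induction w)
  case (Cons n w)
  have "gen n \<otimes>\<^bsub>nc_diff \<nu>\<^esub> single w (1 :: 'r) \<in>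
      ideal_power (nc_diff \<nu>) (aug_ideal (nc_diff \<nu>)) (length (n # w))"
    unfolding length_Cons ideal_power.simps
    by (rule ideal_prod.prod) (use Cons in \<open>simp_all add: aug_ideal_def words_gen\<close>)
  then show ?case by (simp only: nc_diff_sel single_Cons)
qed simp

text \<open>Words in elements of J^n have length at least n, so \<hbar>^|w| clears the denominator
  \<hbar>^n, which gives one inclusion; for the other, a word of length l lies in J^l.\<close>

lemma H_vee_eq_lattice: "H_vee \<nu> = (lattice \<nu> :: 'k::field qfree set)"
proof
  have "scale (inverse hbar ^ n) (base_change x) \<in> (lattice \<nu> :: 'k qfree set)"
    if "x \<in> ideal_power (nc_diff \<nu>) (aug_ideal (nc_diff \<nu>)) n" for x n
  proof -
    have x: "x \<in> words \<nu>" "\<And>w. w \<in> keys x \<Longrightarrow> n \<le> length w"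
      using ideal_power_keys[OF that] by auto
    have "keys (base_change x) = keys x"
      by (auto simp: in_keys_iff lookup_base_change)
    then have "base_change x \<in> words \<nu>" using x(1) by (simp add: words_def)
    moreover have "\<exists>p. lookup (scale (inverse hbar ^ n) (base_change x)) w * hbar ^ length w = to_fract p" for w
    proof (cases "w \<in> keys x")
      case True
      then have "length w = n + (length w - n)" using x(2) by simp
      then have "hbar ^ length w = (hbar ^ n * hbar ^ (length w - n) :: 'k poly fract)"
        by (metis power_add)
      then have "lookup (scale (inverse hbar ^ n) (base_change x)) w * hbar ^ length w =
          to_fract [:lookup x w:] * hbar ^ (length w - n)"
        by (simp add: lookup_base_change power_inverse)
      also have "\<dots> = to_fract ([:lookup x w:] * [:0, 1:] ^ (length w - n))"
        by (simp only: hbar_power to_fract_mult)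
      finally show ?thesis by blast
    next
      case False
      then show ?thesis by (auto simp: lookup_base_change in_keys_iff intro: exI[of _ 0])
    qed
    ultimately show ?thesis by (simp add: lattice_def words_scale)
  qed
  then show "H_vee \<nu> \<subseteq> (lattice \<nu> :: 'k qfree set)"
    unfolding H_vee_def
    by (intro pm.span_minimal) (auto simp: pm.subspace_def lattice_add lattice_scale)
next
  show "lattice \<nu> \<subseteq> (H_vee \<nu> :: 'k qfree set)"
  proof
    fix f :: "'k qfree" assume f: "f \<in> lattice \<nu>"
    have "single w (lookup f w) \<in> H_vee \<nu>" if w: "w \<in> keys f" for w
    proof -
      obtain p where p: "lookup f w * hbar ^ length w = to_fract p"
        using f by (auto simp: lattice_def)
      have "set w \<subseteq> letters \<nu>" using w f by (auto simp: lattice_def words_def)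
      then have "single w (1 :: 'k) \<in> ideal_power (nc_diff \<nu>) (aug_ideal (nc_diff \<nu>)) (length w)"
        by (rule single_ideal_power)
      then have "scale (inverse hbar ^ length w) (base_change (single w (1 :: 'k))) \<in> H_vee \<nu>"
        unfolding H_vee_def by (intro pm.span_base) blast
      then have "pscale p (scale (inverse hbar ^ length w) (base_change (single w (1 :: 'k)))) \<in> H_vee \<nu>"
        unfolding H_vee_def by (rule pm.span_scale)
      moreover have "base_change (single w (1 :: 'k)) = single w 1"
        by (rule poly_mapping_eqI) (simp add: lookup_base_change lookup_single when_def flip: one_pCons)
      moreover have "to_fract p * inverse hbar ^ length w = lookup f w"
        by (simp add: p[symmetric] power_inverse)
      ultimately show ?thesis by simp
    qed
    then have "(\<Sum>w\<in>keys f. single w (lookup f w)) \<in> H_vee \<nu>"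
      unfolding H_vee_def by (intro pm.span_sum) simp
    then show "f \<in> H_vee \<nu>" by (simp only: poly_mapping_sum_single)
  qed
qed

section \<open>The integral form satisfies the conditions on \<delta>_n\<close>

lemma iter_cop_quant: "(f :: 'k::field qfree) \<in> quant \<nu> \<Longrightarrow> iter_cop n f \<in> tens_span (quant \<nu>) n"
proof (induction n arbitrary: f)
  case 0
  obtain r where "eps f = to_fract r" using eps_quant[OF 0] by blast
  moreover have "wtens [] \<in> tens_span (quant \<nu> :: 'k qfree set) 0"
    unfolding tens_span_def by (intro pm.span_base imageI) (simp add: tuples_def)
  ultimately show ?case
    unfolding tens_span_def by (simp add: pm.span_scale del: wtens.simps)
next
  case (Suc n)
  have "cons_iter n z \<in> tens_span (quant \<nu>) (Suc n)" if "z \<in> pair_span (quant \<nu>)" for z :: "_ \<Rightarrow>\<^sub>0 'k poly fract"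
    unfolding tens_span_def
  proof (rule span_linear_image[OF that[unfolded pair_span_def], where F = "cons_iter n"])
    fix b :: "_ \<Rightarrow>\<^sub>0 'k poly fract"
    assume "b \<in> {f \<otimes>\<^sub>T g |f g. f \<in> quant \<nu> \<and> g \<in> quant \<nu>}"
    then obtain f g where b: "b = f \<otimes>\<^sub>T g" and fg: "f \<in> quant \<nu>" "g \<in> quant \<nu>" by auto
    have "cons_tens (f \<otimes>\<^sub>T iter_cop n g) \<in> pm.span (wtens ` tuples (quant \<nu>) (Suc n))"
    proof (rule span_linear_image[OF Suc.IH[OF fg(2), unfolded tens_span_def], where F = "\<lambda>t. cons_tens (f \<otimes>\<^sub>T t)"])
      fix t :: "_ \<Rightarrow>\<^sub>0 'k poly fract"
      assume "t \<in> wtens ` tuples (quant \<nu>) n"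
      then obtain fs where "t = wtens fs" "fs \<in> tuples (quant \<nu>) n" by blast
      then have "cons_tens (f \<otimes>\<^sub>T t) = wtens (f # fs)" "f # fs \<in> tuples (quant \<nu>) (Suc n)"
        using fg(1) by (auto simp: tuples_def)
      then show "cons_tens (f \<otimes>\<^sub>T t) \<in> pm.span (wtens ` tuples (quant \<nu>) (Suc n))"
        by (metis imageI pm.span_base)
    qed (simp_all add: tens2_add_right tens2_scale_right cons_tens_add cons_tens_scale)
    then show "cons_iter n b \<in> pm.span (wtens ` tuples (quant \<nu>) (Suc n))"
      by (simp add: b cons_iter_tens)
  qed (simp_all add: cons_iter_def lin_add lin_scale)
  then show ?case by (simp only: iter_cop_Suc Delta_quant[OF Suc.prems])
qed

lemma wtens_map_scale: "wtens (map (scale c) fs) = scale (c ^ length fs) (wtens fs)"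
  by (induction fs) (simp_all add: tens2_scale_left tens2_scale_right cons_tens_scale mult.commute)

lemma tens_span_scale_hbar:
  fixes z :: "nat list list \<Rightarrow>\<^sub>0 'k::field poly fract"
  assumes "z \<in> tens_span (quant \<nu>) n"
  shows "\<exists>y\<in>tens_span (lattice \<nu>) n. reduce_tens z = scale (hbar ^ n) y"
  using assms unfolding tens_span_def
proof (induction z rule: pm.span_induct_alt)
  case base
  show ?case by (rule bexI[of _ 0]) (simp_all add: pm.span_zero)
next
  case (step c b z)
  from step(2) obtain y where y: "y \<in> pm.span (wtens ` tuples (lattice \<nu>) n)" "reduce_tens z = scale (hbar ^ n) y"
    by blast
  from step(1) obtain fs where fs: "b = wtens fs" "fs \<in> tuples (quant \<nu>) n" by blast
  obtain g :: "'k qfree \<Rightarrow> 'k qfree" where g: "\<And>x. x \<in> quant \<nu> \<Longrightarrow> g x \<in> lattice \<nu> \<and> x - scale (eps x) 1 = scale hbar (g x)"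
    using quant_reduced_lattice[of _ \<nu>] by metis
  have "map (\<lambda>y. y - scale (eps y) 1) fs = map (scale hbar) (map g fs)"
    using fs(2) g by (auto simp: tuples_def)
  then have "reduce_tens b = scale (hbar ^ n) (wtens (map g fs))"
    using fs by (simp only: fs(1) reduce_tens_wtens wtens_map_scale) (simp add: tuples_def)
  then have "reduce_tens (pscale c b + z) = scale (hbar ^ n) (pscale c (wtens (map g fs)) + y)"
    by (simp add: reduce_tens_add reduce_tens_scale y(2) scale_add_right mult.commute)
  moreover have "wtens (map g fs) \<in> pm.span (wtens ` tuples (lattice \<nu>) n)"
    by (intro pm.span_base imageI) (use fs(2) g in \<open>auto simp: tuples_def\<close>)
  ultimately show ?case using y(1) by (blast intro: pm.span_add pm.span_scale)
qed

lemma drinfeld_prime_iff: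
  "f \<in> drinfeld_prime (nc_diff \<nu>) (H_vee \<nu>) \<longleftrightarrow>
    f \<in> lattice \<nu> \<and> (\<forall>n. \<exists>y\<in>tens_span (lattice \<nu>) n. reduce_tens (iter_cop n f) = scale (hbar ^ n) y)"
  (is "?D \<longleftrightarrow> ?R")
proof -
  have "(\<exists>s. s \<in> tensors (lattice \<nu>) n \<and> tensor_eq (nc_diff \<nu>) n (delta (nc_diff \<nu>) n f)
        (scale (hbar ^ n) (map_tensor to_fract id s))) \<longleftrightarrow>
      (\<exists>y\<in>tens_span (lattice \<nu>) n. reduce_tens (iter_cop n f) = scale (hbar ^ n) y)"
    if f: "f \<in> words \<nu>" for n
  proof -
    have "tensor_eq (nc_diff \<nu>) n (delta (nc_diff \<nu>) n f) (scale (hbar ^ n) (map_tensor to_fract id s)) \<longleftrightarrow>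
        reduce_tens (iter_cop n f) = scale (hbar ^ n) (tvec id (map_tensor to_fract id s))"
      if "s \<in> tensors (lattice \<nu>) n" for s
    proof (subst nc.tensor_eq_iff)
      have "s \<in> tensors (words \<nu>) n" using that by (auto simp: tensors_def tuples_def lattice_def)
      then show "scale (hbar ^ n) (map_tensor to_fract id s) \<in> tensors (carrier (nc_diff \<nu>)) n"
        by (simp add: tensors_scale map_tensor_id_tensors)
    qed (simp_all add: f delta_closed tvec_delta tvec_scale)
    then show ?thesis using tens_span_iff by metis
  qed
  then show ?thesis
    unfolding drinfeld_prime_def H_vee_eq_lattice by (auto simp: lattice_def)
qed

lemma quant_subset_prime: "quant \<nu> \<subseteq> drinfeld_prime (nc_diff \<nu>) (H_vee \<nu>)"
  using quant_lattice iter_cop_quant tens_span_scale_hbar by (fastforce simp: drinfeld_prime_iff)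

text \<open>What membership in (H^v)' says about single coefficients: only tensors without empty
  factors survive in \<delta>_n, and each of the \<open>length ws\<close> factors costs one \<hbar>.
  The condition can be tested separately for each total length, as the peeling of shortest parts
  requires.\<close>

definition order_cond :: "enat \<Rightarrow> 'k::field qfree set" where
  "order_cond \<nu> = {f \<in> words \<nu>. \<forall>ws. [] \<notin> set ws \<longrightarrow>
     (\<exists>r. lookup (iter_cop (length ws) f) ws * hbar ^ sum_list (map length ws)
        = hbar ^ length ws * to_fract r)}"

text \<open>A coefficient of a pure tensor is a product of coefficients of its factors, each
  integral after multiplication by the power of \<hbar> belonging to its own word.\<close>

lemma tens_span_lookup:
  assumes "z \<in> tens_span (lattice \<nu>) n"
  shows "\<exists>r. lookup z ws * hbar ^ sum_list (map length ws) = to_fract r"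
  using assms unfolding tens_span_def
proof (induction z rule: pm.span_induct_alt)
  case base
  show ?case by (auto intro: exI[of _ 0])
next
  case (step c b z)
  from step(1) obtain fs where fs: "b = wtens fs" "set fs \<subseteq> lattice \<nu>" by (auto simp: tuples_def)
  have "\<exists>r. prod_list (map2 lookup fs ws) * hbar ^ sum_list (map length ws) = to_fract r"
    if "length ws = length fs" using that fs(2)
  proof (induction fs ws rule: list_induct2')
    case (4 f fs w ws)
    from 4(1) 4(2,3) obtain s where
      s: "prod_list (map2 lookup fs ws) * hbar ^ sum_list (map length ws) = to_fract s"
      by auto
    from 4(3) have "f \<in> lattice \<nu>" by simp
    then obtain r where r: "lookup f w * hbar ^ length w = to_fract r"
      unfolding lattice_def by blast
    have "prod_list (map2 lookup (f # fs) (w # ws)) * hbar ^ sum_list (map length (w # ws)) =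
        (lookup f w * hbar ^ length w) *
        (prod_list (map2 lookup fs ws) * hbar ^ sum_list (map length ws))"
      by (simp add: power_add mult_ac)
    also have "\<dots> = to_fract (r * s)" by (simp only: r s to_fract_mult)
    finally show ?case by blast
  qed (auto intro: exI[of _ 1])
  then have "\<exists>r. lookup b ws * hbar ^ sum_list (map length ws) = to_fract r"
    by (auto simp: fs(1) lookup_wtens intro: exI[of _ 0])
  then obtain r where r: "lookup b ws * hbar ^ sum_list (map length ws) = to_fract r" ..
  from step(2) obtain s where s: "lookup z ws * hbar ^ sum_list (map length ws) = to_fract s" ..
  have "lookup (pscale c b + z) ws * hbar ^ sum_list (map length ws) = to_fract (c * r + s)"
    by (simp add: lookup_add distrib_right r s mult.assoc)
  then show ?case by blast
qed

lemma prime_subset_order_cond: "drinfeld_prime (nc_diff \<nu>) (H_vee \<nu>) \<subseteq> order_cond \<nu>"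
proof
  fix f assume f: "f \<in> drinfeld_prime (nc_diff \<nu>) (H_vee \<nu>)"
  have "\<exists>r. lookup (iter_cop (length ws) f) ws * hbar ^ sum_list (map length ws) = hbar ^ length ws * to_fract r"
    if ws: "[] \<notin> set ws" for ws
  proof -
    from f obtain y where y: "y \<in> tens_span (lattice \<nu>) (length ws)"
        "reduce_tens (iter_cop (length ws) f) = scale (hbar ^ length ws) y"
      by (auto simp: drinfeld_prime_iff)
    from tens_span_lookup[OF y(1), of ws] obtain r
      where r: "lookup y ws * hbar ^ sum_list (map length ws) = to_fract r" ..
    have "lookup (iter_cop (length ws) f) ws = hbar ^ length ws * lookup y ws"
      using arg_cong[OF y(2), of "\<lambda>z. lookup z ws"] ws by (simp add: lookup_reduce_tens)
    then show ?thesis using r by (auto simp: mult.assoc)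
  qed
  then show "f \<in> order_cond \<nu>"
    using f by (auto simp: order_cond_def drinfeld_prime_iff lattice_def)
qed

lemma order_cond_diff:
  assumes "f \<in> order_cond \<nu>" "g \<in> order_cond \<nu>"
  shows "f - g \<in> order_cond \<nu>"
proof -
  have "\<exists>r. lookup (iter_cop (length ws) (f - g)) ws * hbar ^ sum_list (map length ws) = hbar ^ length ws * to_fract r"
    if ws: "[] \<notin> set ws" for ws
  proof -
    from assms ws obtain r s where
      "lookup (iter_cop (length ws) f) ws * hbar ^ sum_list (map length ws) = hbar ^ length ws * to_fract r"
      "lookup (iter_cop (length ws) g) ws * hbar ^ sum_list (map length ws) = hbar ^ length ws * to_fract s"
      unfolding order_cond_def by blast
    moreover have "iter_cop (length ws) (f - g) = iter_cop (length ws) f - iter_cop (length ws) g"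
      using iter_cop_add[of "length ws" "f - g" g] by simp
    ultimately have "lookup (iter_cop (length ws) (f - g)) ws * hbar ^ sum_list (map length ws) =
        hbar ^ length ws * to_fract (r - s)"
      by (simp only: lookup_minus left_diff_distrib right_diff_distrib to_fract_diff)
    then show ?thesis by blast
  qed
  then show ?thesis using assms by (simp add: order_cond_def words_diff)
qed

text \<open>The right-normed bracket of \<open>u\<close> consists of \<open>length u - 1\<close>
  brackets, each of which supplies one \<open>inverse hbar\<close>.\<close>

lemma lie_word_quant: "set u \<subseteq> letters \<nu> \<Longrightarrow> u \<noteq> [] \<Longrightarrow> 
    scale (inverse hbar ^ (length u - 1)) (lie_word u) \<in> (quant \<nu> :: 'k::field qfree set)"
proof (induction u rule: lie_word.induct)
  case (3 n m w)
  let ?x = "scale (inverse hbar ^ length w) (lie_word (m # w)) :: 'k qfree"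
  have "hcomm (gen n) ?x \<in> quant \<nu>"
    using 3 by (intro quant.comm quant.gen) auto
  also have "hcomm (gen n) ?x = scale (inverse hbar ^ (length (n # m # w) - 1)) (lie_word (n # m # w))"
    by (simp add: hcomm_def scale_mult_left scale_mult_right flip: scale_diff_right)
  finally show ?case .
qed (auto intro: quant.gen)

text \<open>
  Dynkin: for homogeneous \<open>f\<close> of length \<open>p\<close>, \<open>p f\<close> is the sum of the products \<open>lie_word u \<cdot> f\<^sub>u\<close>, where
  \<open>\<Sum> u \<otimes> f\<^sub>u\<close> is the primitive coproduct of \<open>f\<close>; the factors \<open>f\<^sub>u\<close> are shorter.
\<close>

lemma homogeneous_quant:
  fixes f :: "'k::field_char_0 qfree"
  assumes "f \<in> words \<nu>" "\<And>w. w \<in> keys f \<Longrightarrow> length w = p"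
    and "\<And>ws. [] \<notin> set ws \<Longrightarrow> sum_list (map length ws) = p \<Longrightarrow>
      \<exists>r. lookup (iter_cop (length ws) f) ws * hbar ^ p = hbar ^ length ws * to_fract r"
  shows "f \<in> quant \<nu>"
  using assms
proof (induction p arbitrary: f rule: less_induct)
  case (less p)
  show ?case
  proof (cases "p = 0")
    case True
    then have "keys f \<subseteq> {[]}" using less.prems(2) by auto
    then have "lookup f w = lookup (scale (eps f) 1) w" for w
      by (cases "w = []") (auto simp: eps_def lookup_one zero_list_def in_keys_iff)
    then have f: "f = scale (eps f) 1" by (rule poly_mapping_eqI)
    \<comment> \<open>The condition for the empty list of words concerns the counit.\<close>
    obtain r where "eps f = to_fract r"
      using less.prems(3)[of "[]"] True by auto
    with f show ?thesis by (metis quant.one quant.scale)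
  next
    case False
    let ?f = "\<lambda>u. slice u (Delta0 f)"
    have "lie_word u * ?f u \<in> quant \<nu>" for u
    proof (cases "u = [] \<or> ?f u = 0")
      case False
      then have u: "u \<noteq> []" and "keys (?f u) \<noteq> {}" by auto
      then obtain v where "v \<in> keys (?f u)" by blast
      note uv = slice_Delta0_keys[OF less.prems(2,1) this]
      note keys = slice_Delta0_keys[OF less.prems(2,1), of _ u]
      \<comment> \<open>The power of \<hbar> that compensates the factors
        \<open>inverse hbar\<close> which put \<open>lie_word u\<close> into
        \<open>quant \<nu>\<close>. The remaining \<hbar> in the equation below pays for the tensor
        factor \<open>u\<close> removed from \<open>u # ws\<close>.\<close>
      define c where "c = (hbar ^ (length u - 1) :: 'k poly fract)"
      have c: "c * hbar ^ (p - length u) * hbar = hbar ^ p"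
      proof -
        have "0 < length u" using u by simp
        then have e: "(length u - 1) + (p - length u) + 1 = p"
          using uv(1) by linarith
        have "c * hbar ^ (p - length u) * hbar = hbar ^ ((length u - 1) + (p - length u) + 1)"
          by (simp only: c_def power_add power_one_right)
        then show ?thesis by (simp only: e)
      qed
      have "scale c (?f u) \<in> quant \<nu>"
      proof (rule less.IH)
        show "p - length u < p" using u False uv(1) by (cases u) auto
        show "scale c (?f u) \<in> words \<nu>"
          using keys(3) by (intro words_scale) (auto simp: words_def)
        fix w assume "w \<in> keys (scale c (?f u))"
        then have "w \<in> keys (?f u)" by (rule subsetD[OF keys_scale_subset])
        then show "length w = p - length u" using keys(1)[of w] by simp
      next
        fix ws :: "nat list list" assume ws: "[] \<notin> set ws" "sum_list (map length ws) = p - length u"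
        have "lookup (iter_cop (length ws) (?f u)) ws = lookup (iter_cop (Suc (length ws)) f) (u # ws)"
          by (rule lookup_iter_cop_slice[OF less.prems(2)]) (use ws uv(1) in auto)
        moreover obtain r where "lookup (iter_cop (Suc (length ws)) f) (u # ws) * hbar ^ p = hbar ^ Suc (length ws) * to_fract r"
          using less.prems(3)[of "u # ws"] ws u uv(1) by auto
        ultimately have "lookup (iter_cop (length ws) (?f u)) ws * (c * hbar ^ (p - length u) * hbar) = hbar ^ Suc (length ws) * to_fract r"
          unfolding c by simp
        then have "hbar * (lookup (iter_cop (length ws) (scale c (?f u))) ws * hbar ^ (p - length u)) =
            hbar * (hbar ^ length ws * to_fract r)"
          by (simp add: iter_cop_scale mult_ac)
        then show "\<exists>r. lookup (iter_cop (length ws) (scale c (?f u))) ws * hbar ^ (p - length u) = hbar ^ length ws * to_fract r"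
          by auto
      qed
      moreover have "scale (inverse hbar ^ (length u - 1)) (lie_word u) \<in> quant \<nu>"
        using uv(2) u by (rule lie_word_quant)
      ultimately have "scale (inverse hbar ^ (length u - 1)) (lie_word u) * scale c (?f u) \<in> quant \<nu>"
        by (intro quant.mult)
      then show ?thesis
        by (simp add: scale_mult_left scale_mult_right c_def power_inverse)
    qed auto
    then have "dynkin (Delta0 f) \<in> quant \<nu>"
      unfolding dynkin_slices by (intro quant_sum)
    then have "scale (of_nat p) f \<in> quant \<nu>"
      using dynkin_Delta0[of f p] less.prems(2) by simp
    \<comment> \<open>Here characteristic zero enters: the nonzero \<open>p\<close> is invertible in
      k.\<close>
    then have "pscale [:inverse (of_nat p):] (scale (of_nat p) f) \<in> quant \<nu>"
      by (rule quant.scale)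
    moreover have "to_fract [:inverse (of_nat p :: 'k):] * of_nat p = 1"
    proof -
      have "to_fract [:of_nat p :: 'k:] = of_nat p"
        unfolding of_nat_poly[symmetric] by (induction p) simp_all
      then have "to_fract [:inverse (of_nat p :: 'k):] * of_nat p = to_fract ([:inverse (of_nat p):] * [:of_nat p:])"
        by (simp only: to_fract_mult)
      also have "\<dots> = 1" using False by (simp flip: one_pCons)
      finally show ?thesis .
    qed
    ultimately show ?thesis by simp
  qed
qed

text \<open>Induction on the number of words in \<open>f\<close>, stripping off its part
  \<open>g\<close> of shortest length \<open>p\<close>. Words longer than \<open>p\<close> do not
  reach coefficients of total length \<open>p\<close>, so there \<open>g\<close> inherits the
  condition from \<open>f\<close>.\<close>

lemma order_cond_subset_quant: "order_cond \<nu> \<subseteq> (quant \<nu> :: 'k::field_char_0 qfree set)"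
proof
  fix f :: "'k qfree"
  assume "f \<in> order_cond \<nu>"
  then show "f \<in> quant \<nu>"
  proof (induction "card (keys f)" arbitrary: f rule: less_induct)
    case less
    show ?case
    proof (cases "f = 0")
      case False
      define p where "p = Min (length ` keys f)"
      have "keys f \<noteq> {}" using False by simp
      then have "p \<in> length ` keys f" unfolding p_def by (intro Min_in) auto
      then obtain w0 where w0: "w0 \<in> keys f" "length w0 = p" by auto
      have p_le: "p \<le> length w" if "w \<in> keys f" for w
        using that by (auto simp: p_def intro!: Min_le)
      define g where "g = lin (\<lambda>w. if length w = p then single w 1 else 0) f"
      have lookup_g: "lookup g w = (if length w = p then lookup f w else 0)" for w
        unfolding g_def
        by (induction f rule: poly_mapping_linear_induct) (auto simp: lin_add lookup_add lookup_single when_def)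
      have g_keys: "w \<in> keys g \<longleftrightarrow> w \<in> keys f \<and> length w = p" for w
        by (auto simp: in_keys_iff lookup_g)
      have fg_keys: "w \<in> keys (f - g) \<longleftrightarrow> w \<in> keys f \<and> length w \<noteq> p" for w
        by (auto simp: in_keys_iff lookup_g lookup_minus)
      have "g \<in> quant \<nu>"
      proof (rule homogeneous_quant)
        show "g \<in> words \<nu>" using less.prems g_keys by (auto simp: order_cond_def words_def)
        show "length w = p" if "w \<in> keys g" for w using that g_keys by simp
        fix ws :: "nat list list" assume ws: "[] \<notin> set ws" "sum_list (map length ws) = p"
        have "lookup (iter_cop (length ws) (f - g)) ws = 0"
        proof (rule lookup_iter_cop_eq_0)
          fix v assume "v \<in> keys (f - g)"
          then have "v \<in> keys f" "length v \<noteq> p" using fg_keys by auto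
          with p_le[of v] ws(2) show "sum_list (map length ws) < length v" by simp
        qed simp
        then have "lookup (iter_cop (length ws) g) ws = lookup (iter_cop (length ws) f) ws"
          using iter_cop_add[of "length ws" "f - g" g] by (simp add: lookup_add)
        then show "\<exists>r. lookup (iter_cop (length ws) g) ws * hbar ^ p = hbar ^ length ws * to_fract r"
          using less.prems ws by (auto simp: order_cond_def)
      qed
      moreover have "f - g \<in> quant \<nu>"
      proof (rule less.hyps)
        show "card (keys (f - g)) < card (keys f)"
          by (rule psubset_card_mono) (use fg_keys w0 in auto)
        \<comment> \<open>\<open>g\<close> is already known to lie in \<open>quant \<nu>\<close>,
          hence satisfies the order condition at every total length; so does the remainder.\<close>
        show "f - g \<in> order_cond \<nu>"
          using \<open>g \<in> quant \<nu>\<close> quant_subset_prime prime_subset_order_cond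
          by (intro order_cond_diff less.prems) blast
      qed
      ultimately have "(f - g) + g \<in> quant \<nu>" by (intro quant.add)
      then show ?thesis by simp
    qed simp
  qed
qed

theorem drinfeld_prime_eq_quant:
  "drinfeld_prime (nc_diff \<nu>) (H_vee \<nu>) = (quant \<nu> :: 'k::field_char_0 qfree set)"
  using quant_subset_prime prime_subset_order_cond order_cond_subset_quant by blast


section \<open>Evaluation at 1\<close>

text \<open>
  \<open>ev_rel\<close> is the graph of the evaluation \<open>k[\<hbar>, \<hbar>\<^sup>-\<^sup>1] \<rightarrow> k\<close> at \<open>\<hbar> = 1\<close>.
\<close>

definition ev_rel :: "'k::field poly fract \<Rightarrow> 'k \<Rightarrow> bool" where
  "ev_rel c d \<longleftrightarrow> (\<exists>N p. hbar ^ N * c = to_fract p \<and> poly p 1 = d)"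

lemma poly_hbar_power [simp]: "poly ([:0, 1:] ^ N :: 'k::field poly) 1 = 1"
  by (simp add: poly_power)

lemma ev_rel_to_fract: "ev_rel (to_fract p) (poly p 1)"
  unfolding ev_rel_def by (rule exI[of _ 0]) simp

lemma ev_rel_0 [simp]: "ev_rel 0 0" and ev_rel_1 [simp]: "ev_rel 1 1"
  using ev_rel_to_fract[of 0] ev_rel_to_fract[of 1] by simp_all

lemma ev_rel_inverse_hbar: "ev_rel (inverse hbar) 1"
  unfolding ev_rel_def by (intro exI[of _ 1]) simp

text \<open>Clear both denominators: \<hbar> takes the value 1 at 1, so multiplying by its powers
  does not change the value.\<close>

lemma ev_rel_unique:
  assumes "ev_rel c d" "ev_rel c d'"
  shows "d = d'"
proof -
  obtain N p M q where p: "hbar ^ N * c = to_fract p" "poly p 1 = d"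
    and q: "hbar ^ M * c = to_fract q" "poly q 1 = d'"
    using assms unfolding ev_rel_def by blast
  have "hbar ^ M * (hbar ^ N * c) = hbar ^ N * (hbar ^ M * c)" by (simp add: mult_ac)
  then have "to_fract ([:0, 1:] ^ M * p) = to_fract ([:0, 1:] ^ N * q)"
    by (simp only: to_fract_mult hbar_power[symmetric] p(1)[symmetric] q(1)[symmetric])
  then have "poly ([:0, 1:] ^ M * p) 1 = poly ([:0, 1:] ^ N * q) 1" by (simp only: to_fract_eq_iff)
  then show ?thesis using p(2) q(2) by simp
qed

lemma ev_rel_add:
  assumes "ev_rel c d" "ev_rel c' d'"
  shows "ev_rel (c + c') (d + d')"
proof -
  obtain N p M q where p: "hbar ^ N * c = to_fract p" "poly p 1 = d"
    and q: "hbar ^ M * c' = to_fract q" "poly q 1 = d'"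
    using assms unfolding ev_rel_def by blast
  have "hbar ^ (N + M) * (c + c') = hbar ^ M * (hbar ^ N * c) + hbar ^ N * (hbar ^ M * c')"
    by (simp add: power_add algebra_simps)
  also have "\<dots> = to_fract ([:0, 1:] ^ M * p + [:0, 1:] ^ N * q)"
    by (simp only: to_fract_add to_fract_mult hbar_power[symmetric] p(1) q(1))
  finally show ?thesis
    unfolding ev_rel_def using p(2) q(2)
    by (intro exI[of _ "N + M"] exI[of _ "[:0, 1:] ^ M * p + [:0, 1:] ^ N * q"]) simp
qed

lemma ev_rel_mult:
  assumes "ev_rel c d" "ev_rel c' d'"
  shows "ev_rel (c * c') (d * d')"
proof -
  obtain N p M q where p: "hbar ^ N * c = to_fract p" "poly p 1 = d"
    and q: "hbar ^ M * c' = to_fract q" "poly q 1 = d'"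
    using assms unfolding ev_rel_def by blast
  have "hbar ^ (N + M) * (c * c') = (hbar ^ N * c) * (hbar ^ M * c')"
    by (simp add: power_add mult_ac)
  also have "\<dots> = to_fract (p * q)" by (simp only: p q to_fract_mult)
  finally show ?thesis
    unfolding ev_rel_def using p(2) q(2) by (intro exI[of _ "N + M"] exI[of _ "p * q"]) simp
qed

definition ev_pm :: "('b \<Rightarrow>\<^sub>0 'k::field poly fract) \<Rightarrow> ('b \<Rightarrow>\<^sub>0 'k) \<Rightarrow> bool" where
  "ev_pm f g \<longleftrightarrow> (\<forall>w. ev_rel (lookup f w) (lookup g w))"

lemma ev_pm_unique: "ev_pm f g \<Longrightarrow> ev_pm f g' \<Longrightarrow> g = g'"
  unfolding ev_pm_def by (rule poly_mapping_eqI) (blast intro: ev_rel_unique)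

lemma ev_pm_0 [simp]: "ev_pm 0 0"
  by (simp add: ev_pm_def)

lemma ev_pm_add: "ev_pm f g \<Longrightarrow> ev_pm f' g' \<Longrightarrow> ev_pm (f + f') (g + g')"
  by (simp add: ev_pm_def lookup_add ev_rel_add)

lemma ev_pm_scale: "ev_rel c d \<Longrightarrow> ev_pm f g \<Longrightarrow> ev_pm (scale c f) (scale d g)"
  by (simp add: ev_pm_def ev_rel_mult)

lemma ev_pm_minus: "ev_pm f g \<Longrightarrow> ev_pm (- f) (- g)"
  using ev_pm_scale[OF ev_rel_to_fract[of "-1"], of f g] by (simp add: scale_minus_left)

lemma ev_pm_diff: "ev_pm f g \<Longrightarrow> ev_pm f' g' \<Longrightarrow> ev_pm (f - f') (g - g')"
  using ev_pm_add[of f g "- f'" "- g'"] ev_pm_minus[of f' g'] by simp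

lemma ev_pm_sum: "(\<And>i. i \<in> I \<Longrightarrow> ev_pm (f i) (g i)) \<Longrightarrow> ev_pm (sum f I) (sum g I)"
  by (induction I rule: infinite_finite_induct) (simp_all add: ev_pm_add)

lemma ev_pm_single: "ev_rel c d \<Longrightarrow> ev_pm (single w c) (single w d)"
  by (simp add: ev_pm_def lookup_single when_def)

lemma ev_pm_lin:
  assumes "ev_pm f g" "\<And>w. ev_pm (h w) (h' w)"
  shows "ev_pm (lin h f) (lin h' g)"
proof -
  let ?S = "keys f \<union> keys g"
  have "lin h f = (\<Sum>w\<in>?S. scale (lookup f w) (h w))"
    "lin h' g = (\<Sum>w\<in>?S. scale (lookup g w) (h' w))"
    by (simp_all add: lin_superset)
  then show ?thesis
    using assms by (simp add: ev_pm_sum ev_pm_scale ev_pm_def[of f g])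
qed

lemma ev_pm_tens2: "ev_pm f g \<Longrightarrow> ev_pm f' g' \<Longrightarrow> ev_pm (f \<otimes>\<^sub>T f') (g \<otimes>\<^sub>T g')"
  unfolding tens2_def by (intro ev_pm_lin ev_pm_single ev_rel_1)

text \<open>Writes the product as a linear extension, so that \<open>ev_pm_lin\<close> applies to
  it.\<close>

lemma mult_conv_lin:
  fixes f g :: "'b::monoid_add \<Rightarrow>\<^sub>0 'r::comm_ring_1"
  shows "f * g = lin (\<lambda>u. lin (\<lambda>v. single (u + v) 1) g) f"
proof (induction f rule: poly_mapping_linear_induct)
  case (single w c)
  show ?case
    by (induction g rule: poly_mapping_linear_induct)
      (simp_all add: distrib_left mult_single lin_add scale_add_right)
qed (simp_all add: distrib_right lin_add)

lemma ev_pm_mult: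
  fixes f f' :: "'b::monoid_add \<Rightarrow>\<^sub>0 'k::field poly fract"
  shows "ev_pm f g \<Longrightarrow> ev_pm f' g' \<Longrightarrow> ev_pm (f * f') (g * g')"
  unfolding mult_conv_lin by (intro ev_pm_lin ev_pm_single ev_rel_1)

lemma ev_pm_1 [simp]: "ev_pm 1 1"
  unfolding single_one[symmetric] by (rule ev_pm_single) simp

lemma ev_pm_gen [simp]: "ev_pm (gen n) (gen n)"
  by (simp add: gen_def ev_pm_single)

lemma ev_pm_of_nat: "ev_pm (of_nat n) (of_nat n)"
  by (induction n) (simp_all add: ev_pm_add)

lemma ev_pm_Q_poly [simp]: "ev_pm (Q_poly l t) (Q_poly l t)"
proof -
  have "ev_pm (prod_list (map gen js)) (prod_list (map gen js))" for js
    by (induction js) (simp_all add: ev_pm_mult)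
  then show ?thesis
    unfolding Q_poly_def P_poly_def by (intro ev_pm_sum ev_pm_mult ev_pm_of_nat)
qed

lemma ev_pm_Delta_word: "ev_pm (Delta_word w) (Delta_word w)"
proof (induction w)
  case (Cons n w)
  have eq: "pair_of id (comult_gen n) = gen n \<otimes>\<^sub>T 1 + 1 \<otimes>\<^sub>T gen n + (\<Sum>m\<in>{1..<n}. gen m \<otimes>\<^sub>T (Q_poly m (n - m) :: 'r::comm_ring_1 free_alg))"
    by (simp add: comult_gen_def pair_of_def lin_add lin_sum)
  show ?case
    unfolding Delta_word_Cons eq
    by (intro ev_pm_mult Cons ev_pm_add ev_pm_tens2 ev_pm_sum ev_pm_gen ev_pm_1 ev_pm_Q_poly)
qed simp

lemma ev_pm_Delta: "ev_pm f g \<Longrightarrow> ev_pm (Delta f) (Delta g)"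
  by (intro ev_pm_lin ev_pm_Delta_word)

lemma ev_pm_antipode_gen: "ev_pm (antipode_gen n) (antipode_gen n)"
proof (induction n rule: less_induct)
  case (less n)
  show ?case
    unfolding antipode_gen.simps[of n]
    by (intro ev_pm_diff ev_pm_minus ev_pm_gen ev_pm_sum ev_pm_mult less ev_pm_Q_poly) auto
qed

lemma ev_pm_antip: "ev_pm f g \<Longrightarrow> ev_pm (antip f) (antip g)"
proof (rule ev_pm_lin)
  show "ev_pm (antipode_word w) (antipode_word w)" for w
    by (induction w) (simp_all add: ev_pm_mult ev_pm_antipode_gen)
qed

lemma ev_rel_eps: "ev_pm f g \<Longrightarrow> ev_rel (eps f) (eps g)"
  by (simp add: ev_pm_def eps_def)

text \<open>Brackets divide by \<hbar>, whose value at 1 is 1, so \<open>hcomm\<close> evaluates to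
  the plain commutator.\<close>

lemma ev_pm_quant_ex: "f \<in> quant \<nu> \<Longrightarrow> \<exists>g\<in>words \<nu>. ev_pm f g"
proof (induction rule: quant.induct)
  case one
  show ?case by (rule bexI[of _ 1]) simp_all
next
  case (gen n)
  then show ?case by (intro bexI[of _ "gen n"]) (simp_all add: words_gen)
next
  case (add x y)
  then show ?case by (meson ev_pm_add words_add)
next
  case (scale x p)
  then show ?case by (meson ev_pm_scale ev_rel_to_fract words_scale)
next
  case (mult x y)
  then show ?case by (meson ev_pm_mult words_mult)
next
  case (comm x y)
  then obtain f g where "f \<in> words \<nu>" "g \<in> words \<nu>" "ev_pm x f" "ev_pm y g" by blast
  then show ?case
    unfolding hcomm_def
    by (intro bexI[of _ "scale 1 (f * g - g * f)"] ev_pm_scale ev_rel_inverse_hbar ev_pm_diff ev_pm_mult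
        words_scale words_diff words_mult)
qed

text \<open>Meaningful only for coefficients in k[\<hbar>, \<hbar>^(-1)]; that elements of
  \<open>quant \<nu>\<close> have such coefficients is part of
  \<open>ev_pm_quant_ex\<close>.\<close>

definition ev :: "'k::field qfree \<Rightarrow> 'k free_alg" where
  "ev f = (THE g. ev_pm f g)"

lemma ev_eqI: "ev_pm f g \<Longrightarrow> ev f = g"
  unfolding ev_def by (rule the_equality) (auto intro: ev_pm_unique)

lemma ev_quant: "f \<in> quant \<nu> \<Longrightarrow> ev_pm f (ev f)" and ev_words: "f \<in> quant \<nu> \<Longrightarrow> ev f \<in> words \<nu>"
  using ev_pm_quant_ex ev_eqI by metis+

lemma ev_surj:
  assumes "g \<in> words \<nu>"
  shows "\<exists>f\<in>quant \<nu>. ev f = g"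
proof -
  have "keys g \<subseteq> {w. set w \<subseteq> letters \<nu>}" using assms by (auto simp: words_def)
  then have "\<exists>f\<in>quant \<nu>. ev_pm f g"
  proof (induction g rule: poly_mapping_keys_induct)
    case zero
    show ?case by (rule bexI[of _ 0]) simp_all
  next
    case (add f g)
    then show ?case by (meson ev_pm_add quant.add)
  next
    case (single w c)
    have "pscale [:c:] (single w 1) \<in> quant \<nu>"
      using single by (intro quant.scale quant_word) simp
    moreover have "ev_pm (pscale [:c:] (single w 1)) (single w c)"
      using ev_pm_scale[OF ev_rel_to_fract[of "[:c:]"] ev_pm_single[OF ev_rel_1], of w] by simp
    ultimately show ?case by blast
  qed
  then show ?thesis using ev_eqI by blast
qed

text \<open>
  \<open>y = (\<hbar> - 1)\<^sup>-\<^sup>1 x\<close> has coefficients in \<open>k[\<hbar>, \<hbar>\<^sup>-\<^sup>1]\<close>, so \<open>\<hbar>\<^sup>N y\<close> is a \<open>k[\<hbar>]\<close>-combination of words for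
  large \<open>N\<close>; and \<open>(\<hbar>\<^sup>N - 1) y\<close> is a \<open>k[\<hbar>]\<close>-multiple of \<open>x\<close>.
\<close>

lemma ev_kernel:
  fixes x :: "'k::field qfree"
  assumes x: "x \<in> quant \<nu>" and "ev x = 0"
  shows "\<exists>y\<in>quant \<nu>. x = pscale [:- 1, 1:] y"
proof -
  define h where "h = (to_fract [:- 1, 1:] :: 'k poly fract)"
  have h: "h \<noteq> 0" by (simp add: h_def)
  define y where "y = scale (inverse h) x"
  \<comment> \<open>\<hbar>^N clears all denominators of \<open>x\<close>, as \<open>x\<close> lies
    in the lattice; the inserted 0 covers \<open>x = 0\<close>, which has no words.\<close>
  define N where "N = Max (insert 0 (length ` keys x))"
  have len: "length w \<le> N" if "w \<in> keys x" for w
    using that unfolding N_def by (intro Max_ge) auto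
  have coeff: "\<exists>q. hbar ^ N * lookup y w = to_fract q" if w: "w \<in> keys x" for w
  proof -
    obtain p where p: "lookup x w * hbar ^ length w = to_fract p"
      using quant_lattice[OF x] unfolding lattice_def by blast
    have N: "hbar ^ N = (hbar ^ (N - length w) * hbar ^ length w :: 'k poly fract)"
      using len[OF w] by (simp flip: power_add)
    define p' where "p' = [:0, 1:] ^ (N - length w) * p"
    have p': "hbar ^ N * lookup x w = to_fract p'"
      unfolding p'_def to_fract_mult hbar_power[symmetric] p[symmetric] N by (simp add: mult_ac)
    then have "ev_rel (lookup x w) (poly p' 1)"
      unfolding ev_rel_def by blast
    moreover have "ev_rel (lookup x w) 0"
      using ev_quant[OF x] assms(2) by (simp add: ev_pm_def)
    ultimately have "poly p' 1 = 0" by (rule ev_rel_unique)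
    then obtain q where "p' = [:- 1, 1:] * q" unfolding poly_eq_0_iff_dvd by blast
    then have "hbar ^ N * lookup x w = h * to_fract q"
      by (simp only: p' to_fract_mult h_def)
    then have "hbar ^ N * lookup y w = to_fract q"
      using h by (simp add: y_def field_simps)
    then show ?thesis by blast
  qed
  have "scale (hbar ^ N) y \<in> quant \<nu>"
  proof -
    have "single w (lookup (scale (hbar ^ N) y) w) \<in> quant \<nu>"
      if "w \<in> keys (scale (hbar ^ N) y)" for w
    proof -
      have w: "w \<in> keys x" using that by (auto simp: in_keys_iff y_def)
      then obtain q where "hbar ^ N * lookup y w = to_fract q" using coeff by blast
      moreover have "set w \<subseteq> letters \<nu>" using w quant_words[OF x] by (auto simp: words_def)
      then have "pscale q (single w 1) \<in> quant \<nu>" by (intro quant.scale quant_word)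
      ultimately show ?thesis by simp
    qed
    then have "(\<Sum>w\<in>keys (scale (hbar ^ N) y).
        single w (lookup (scale (hbar ^ N) y) w)) \<in> quant \<nu>"
      by (intro quant_sum)
    then show ?thesis by (simp only: poly_mapping_sum_single)
  qed
  moreover have "scale (hbar ^ N - 1) y \<in> quant \<nu>"
  proof -
    have "poly ([:0, 1:] ^ N - 1 :: 'k poly) 1 = 0" by simp
    then obtain r where r: "[:0, 1:] ^ N - 1 = [:- 1, 1:] * (r :: 'k poly)" unfolding poly_eq_0_iff_dvd by blast
    have "hbar ^ N - 1 = h * to_fract r"
      by (simp only: hbar_power h_def flip: to_fract_mult r) simp
    moreover have "h * to_fract r * inverse h = to_fract r" using h by simp
    ultimately have "scale (hbar ^ N - 1) y = pscale r x"
      by (simp only: y_def scale_scale)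
    then show ?thesis using x by (simp add: quant.scale)
  qed
  ultimately have "scale (hbar ^ N) y - scale (hbar ^ N - 1) y \<in> quant \<nu>" by (rule quant_diff)
  then have "y \<in> quant \<nu>" by (simp flip: scale_diff_left)
  moreover have "x = pscale [:- 1, 1:] y" using h by (simp add: y_def flip: h_def)
  ultimately show ?thesis by blast
qed


section \<open>The specialization\<close>

lemma hopf_restrict_sel [simp]:
  "carrier (hopf_restrict A L) = L" "monoid.mult (hopf_restrict A L) = monoid.mult A"
  "monoid.one (hopf_restrict A L) = monoid.one A" "ring.zero (hopf_restrict A L) = ring.zero A"
  "ring.add (hopf_restrict A L) = ring.add A"
  "module.smult (hopf_restrict A L) = (\<lambda>p. module.smult A (to_fract p))"
  "antipode (hopf_restrict A L) = antipode A"
  by (simp_all add: hopf_restrict_def)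

lemma H_vee_prime_eq:
  "H_vee_prime \<nu> = hopf_restrict (nc_diff \<nu>) (quant \<nu> :: 'k::field_char_0 qfree set)"
  by (simp add: H_vee_prime_def drinfeld_prime_eq_quant)

lemma H_vee_prime_sel [simp]:
  "carrier (H_vee_prime \<nu>) = (quant \<nu> :: 'k::field_char_0 qfree set)"
  "monoid.mult (H_vee_prime \<nu> :: ('k poly, _) hopf) = (*)" "monoid.one (H_vee_prime \<nu> :: ('k poly, _) hopf) = 1"
  "ring.zero (H_vee_prime \<nu> :: ('k poly, _) hopf) = 0" "ring.add (H_vee_prime \<nu> :: ('k poly, _) hopf) = (+)"
  "module.smult (H_vee_prime \<nu> :: ('k poly, _) hopf) = pscale" "antipode (H_vee_prime \<nu> :: ('k poly, _) hopf) = antip"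
  by (simp_all add: H_vee_prime_eq)

lemma counit_H_vee_prime:
  assumes "x \<in> (quant \<nu> :: 'k::field_char_0 qfree set)"
  shows "to_fract (counit (H_vee_prime \<nu>) x) = eps x"
proof -
  obtain r where r: "eps x = to_fract r" using eps_quant[OF assms] by blast
  have "counit (H_vee_prime \<nu>) x = (THE p. to_fract p = eps x)"
    by (simp add: H_vee_prime_eq hopf_restrict_def)
  also have "\<dots> = r" by (simp add: r)
  finally show ?thesis by (simp add: r)
qed

text \<open>\<open>hopf_restrict\<close> picks some tensor over k[\<hbar>];
  \<open>Delta_quant\<close> provides a candidate, and the coordinates of any admissible choice are
  then determined.\<close>

lemma comult_H_vee_prime:
  assumes "x \<in> (quant \<nu> :: 'k::field_char_0 qfree set)"
  shows "comult (H_vee_prime \<nu>) x \<in> tensors (quant \<nu>) 2"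
    and "pair_of id (map_tensor to_fract id (comult (H_vee_prime \<nu>) x)) = Delta x"
proof -
  have x: "x \<in> words \<nu>" using assms by (rule quant_words)
  have words: "s \<in> tensors (words \<nu>) 2" if "s \<in> tensors (quant \<nu>) 2"
    for s :: "'k qfree list \<Rightarrow>\<^sub>0 'k poly"
    using that quant_words by (fastforce simp: tensors_def tuples_def)
  have iff: "tensor_eq (nc_diff \<nu>) 2 (comult (nc_diff \<nu>) x) (map_tensor to_fract id s) \<longleftrightarrow>
      pair_of id (map_tensor to_fract id s) = Delta x" if "s \<in> tensors (quant \<nu>) 2" for s
    using words[OF that] nc.comult_closed[of x \<nu>] nc.map_comult[of x \<nu>] x
    by (subst nc.tensor_eq_2_iff) (auto simp: map_tensor_id_tensors)
  obtain s where s: "s \<in> tensors (quant \<nu>) 2" "tvec id (map_tensor to_fract id s) = list_of_pair (Delta x)"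
    using list_of_pair_span[OF Delta_quant[OF assms]] tens_span_iff by blast
  moreover have "tvec id (map_tensor to_fract id s) = list_of_pair (pair_of id (map_tensor to_fract id s))"
    by (rule tvec_pair[of _ "quant \<nu>"]) (simp add: map_tensor_id_tensors s)
  ultimately have "pair_of id (map_tensor to_fract id s) = Delta x"
    by (simp add: list_of_pair_inject)
  then have "\<exists>s. s \<in> tensors (quant \<nu>) 2 \<and> tensor_eq (nc_diff \<nu>) 2 (comult (nc_diff \<nu>) x) (map_tensor to_fract id s)"
    using s(1) iff by blast
  from someI_ex[OF this] have *: "comult (H_vee_prime \<nu>) x \<in> tensors (quant \<nu>) 2"
    "tensor_eq (nc_diff \<nu>) 2 (comult (nc_diff \<nu>) x) (map_tensor to_fract id (comult (H_vee_prime \<nu>) x))"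
    unfolding H_vee_prime_eq hopf_restrict_def by simp_all
  then show "comult (H_vee_prime \<nu>) x \<in> tensors (quant \<nu>) 2"
    "pair_of id (map_tensor to_fract id (comult (H_vee_prime \<nu>) x)) = Delta x"
    using iff by blast+
qed

lemma ring_H_vee_prime: "ring (H_vee_prime \<nu> :: ('k::field_char_0 poly, _) hopf)"
proof (rule ringI)
  show "abelian_group (H_vee_prime \<nu> :: ('k poly, _) hopf)"
  proof (rule abelian_groupI)
    fix x :: "'k qfree" assume "x \<in> carrier (H_vee_prime \<nu>)"
    then show "\<exists>y\<in>carrier (H_vee_prime \<nu>). y \<oplus>\<^bsub>H_vee_prime \<nu>\<^esub> x = \<zero>\<^bsub>H_vee_prime \<nu>\<^esub>"
      by (intro bexI[of _ "- x"]) (simp_all add: quant_minus)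
  qed (simp_all add: quant.add algebra_simps)
  show "Group.monoid (H_vee_prime \<nu> :: ('k poly, _) hopf)"
    by (rule monoidI) (simp_all add: quant.mult quant.one mult.assoc)
qed (simp_all add: algebra_simps)

lemma ev_add: "x \<in> quant \<nu> \<Longrightarrow> y \<in> quant \<nu> \<Longrightarrow> ev (x + y) = ev x + ev y"
  and ev_mult: "x \<in> quant \<nu> \<Longrightarrow> y \<in> quant \<nu> \<Longrightarrow> ev (x * y) = ev x * ev y"
  and ev_pscale: "x \<in> quant \<nu> \<Longrightarrow> ev (pscale p x) = scale (poly p 1) (ev x)"
  and ev_antip: "x \<in> quant \<nu> \<Longrightarrow> ev (antip x) = antip (ev x)"
  by (rule ev_eqI; intro ev_pm_add ev_pm_mult ev_pm_scale ev_rel_to_fract ev_pm_antip ev_quant; assumption)+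

lemma ev_one: "ev 1 = 1" and ev_gen: "ev (gen n) = gen n"
  by (rule ev_eqI; simp)+

lemma ring_hom_ev: "ring_hom_ring (H_vee_prime \<nu>) (nc_diff \<nu>) (ev :: 'k::field_char_0 qfree \<Rightarrow> _)"
  by (rule ring_hom_ringI[OF ring_H_vee_prime ring_nc_diff])
    (simp_all add: ev_words ev_mult ev_add ev_one)

lemma kernel_ev:
  "a_kernel (H_vee_prime \<nu>) (nc_diff \<nu>) ev = spec_ideal 1 (H_vee_prime \<nu> :: ('k::field_char_0 poly, _) hopf)"
proof -
  have "x \<in> pscale [:- 1, 1:] ` quant \<nu> \<longleftrightarrow> x \<in> quant \<nu> \<and> ev x = 0" for x :: "'k qfree"
    using ev_kernel[of x \<nu>] by (auto simp: quant.scale ev_pscale[of _ \<nu>])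
  then show ?thesis by (auto simp: a_kernel_def' spec_ideal_def)
qed

text \<open>\<open>ev\<close> is constant on each class, so \<open>the_elem\<close> is applied to a
  singleton; this is the form in which the first isomorphism theorem supplies the map.\<close>

definition spec_map :: "'k::field qfree set \<Rightarrow> 'k free_alg" where
  "spec_map K = the_elem (ev ` K)"

abbreviation (input) specH :: "enat \<Rightarrow> ('k::field_char_0, 'k qfree set) hopf" where
  "specH \<nu> \<equiv> specialization 1 (H_vee_prime \<nu>)"

lemma specialization_sel:
  "carrier (specialization a A) = carrier (A Quot spec_ideal a A)"
  "monoid.mult (specialization a A) = monoid.mult (A Quot spec_ideal a A)"
  "monoid.one (specialization a A) = monoid.one (A Quot spec_ideal a A)"
  "ring.zero (specialization a A) = ring.zero (A Quot spec_ideal a A)"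
  "ring.add (specialization a A) = ring.add (A Quot spec_ideal a A)"
  by (simp_all add: specialization_def Let_def)

lemma spec_map_ring_iso: "spec_map \<in> ring_iso (specH \<nu>) (nc_diff \<nu> :: ('k::field_char_0, _) hopf)"
proof -
  interpret h: ring_hom_ring "H_vee_prime \<nu>" "nc_diff \<nu>" "ev :: 'k qfree \<Rightarrow> _"
    by (rule ring_hom_ev)
  have "ev ` carrier (H_vee_prime \<nu>) = carrier (nc_diff \<nu> :: ('k, _) hopf)"
  proof
    show "ev ` carrier (H_vee_prime \<nu>) \<subseteq> carrier (nc_diff \<nu> :: ('k, _) hopf)"
      using ev_words by auto
    show "carrier (nc_diff \<nu>) \<subseteq> ev ` carrier (H_vee_prime \<nu> :: ('k poly, _) hopf)"
      using ev_surj[of _ \<nu>] by fastforce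
  qed
  from h.FactRing_iso_set[OF this] show ?thesis
    by (simp add: kernel_ev spec_map_def[abs_def] ring_iso_def ring_hom_def specialization_sel)
qed

text \<open>\<open>specialization\<close> copies the ring operations of the quotient into a larger
  record, so the ring axioms have to be carried over field by field.\<close>

lemma ring_specialization: "ring (specH \<nu> :: ('k::field_char_0, _) hopf)"
proof -
  interpret h: ring_hom_ring "H_vee_prime \<nu>" "nc_diff \<nu>" "ev :: 'k qfree \<Rightarrow> _"
    by (rule ring_hom_ev)
  let ?Q = "H_vee_prime \<nu> Quot spec_ideal 1 (H_vee_prime \<nu> :: ('k poly, _) hopf)"
  have "ring ?Q"
    using ideal.quotient_is_ring[OF h.kernel_is_ideal] by (simp only: kernel_ev)
  then interpret Q: ring ?Q .
  have inv: "\<exists>y\<in>carrier ?Q. y \<oplus>\<^bsub>?Q\<^esub> x = \<zero>\<^bsub>?Q\<^esub>" if "x \<in> carrier ?Q" for x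
    using that by (intro bexI[of _ "\<ominus>\<^bsub>?Q\<^esub> x"]) (rule Q.l_neg Q.a_inv_closed; assumption)+
  show ?thesis
  proof (rule ringI)
    show "abelian_group (specH \<nu> :: ('k, _) hopf)"
      by (rule abelian_groupI; unfold specialization_sel)
        (assumption | rule Q.add.m_closed Q.zero_closed Q.a_assoc Q.a_comm Q.l_zero
          inv)+
    show "Group.monoid (specH \<nu> :: ('k, _) hopf)"
      by (rule monoidI; unfold specialization_sel)
        (assumption | rule Q.m_closed Q.one_closed Q.m_assoc Q.l_one Q.r_one)+
  qed (unfold specialization_sel, (assumption | rule Q.l_distr Q.r_distr)+)
qed

lemma spec_class_mem:
  assumes "y \<in> spec_class 1 (H_vee_prime \<nu>) x" "x \<in> (quant \<nu> :: 'k::field_char_0 qfree set)"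
  shows "y \<in> quant \<nu> \<and> ev y = ev x"
proof -
  obtain z where "z \<in> quant \<nu>" "y = pscale [:- 1, 1:] z + x"
    using assms by (auto simp: spec_class_def spec_ideal_def a_r_coset_def')
  with assms(2) show ?thesis
    using ev_add[of "pscale [:- 1, 1:] z" \<nu> x] ev_pscale[of z \<nu>] by (simp add: quant.add quant.scale)
qed

lemma spec_class_self: "x \<in> spec_class 1 (H_vee_prime \<nu>) (x :: 'k::field_char_0 qfree)"
  by (auto simp: spec_class_def spec_ideal_def a_r_coset_def' intro!: bexI[of _ 0])

lemma spec_map_class:
  assumes "x \<in> (quant \<nu> :: 'k::field_char_0 qfree set)"
  shows "spec_map (spec_class 1 (H_vee_prime \<nu>) x) = ev x"
proof -
  have "ev ` spec_class 1 (H_vee_prime \<nu>) x = {ev x}"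
  proof
    show "ev ` spec_class 1 (H_vee_prime \<nu>) x \<subseteq> {ev x}"
      using spec_class_mem[OF _ assms] by blast
    show "{ev x} \<subseteq> ev ` spec_class 1 (H_vee_prime \<nu>) x"
      using imageI[OF spec_class_self] by blast
  qed
  then show ?thesis by (simp only: spec_map_def the_elem_eq)
qed

lemma carrier_specialization:
  "carrier (specH \<nu>) = spec_class 1 (H_vee_prime \<nu>) ` (quant \<nu> :: 'k::field_char_0 qfree set)"
  by (auto simp: specialization_sel FactRing_def A_RCOSETS_def' spec_class_def)

text \<open>Scalar multiplication and the Hopf maps of the specialization are computed on an
  arbitrary representative; its evaluation does not depend on the choice.\<close>

lemma spec_rep:
  assumes "K \<in> carrier (specH \<nu> :: ('k::field_char_0, _) hopf)"
  shows "(SOME x. x \<in> K) \<in> quant \<nu>" "ev (SOME x. x \<in> K) = spec_map K"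
proof -
  obtain x where x: "x \<in> quant \<nu>" "K = spec_class 1 (H_vee_prime \<nu>) x"
    using assms by (auto simp: carrier_specialization)
  then have "(SOME x. x \<in> K) \<in> K" using spec_class_self someI by metis
  then show "(SOME x. x \<in> K) \<in> quant \<nu>" "ev (SOME x. x \<in> K) = spec_map K"
    using spec_class_mem[OF _ x(1)] spec_map_class[OF x(1)] x(2) by auto
qed

lemma map_tensor_closed:
  assumes "s \<in> tensors L n" "\<And>x. x \<in> L \<Longrightarrow> f x \<in> M"
  shows "map_tensor g f s \<in> tensors M n"
  unfolding map_tensor_def
  by (intro tensors_sum tensors_single) (use assms in \<open>fastforce simp: tensors_def tuples_def\<close>)

lemma pair_of_map_tensor:
  assumes "s \<in> tensors L 2"
  shows "pair_of \<phi> (map_tensor g f s) =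
    (\<Sum>xs\<in>keys s. scale (g (lookup s xs)) (\<phi> (f (xs ! 0)) \<otimes>\<^sub>T \<phi> (f (xs ! 1))))"
  unfolding map_tensor_def pair_of_def lin_sum
  by (rule sum.cong) (auto elim!: tensors_2E[OF assms])

theorem nc_diff_model_specialization: "nc_diff_model (specH \<nu> :: ('k::field_char_0, _) hopf) spec_map \<nu>"
proof (intro nc_diff_model.intro free_module_model.intro nc_diff_model_axioms.intro ring_specialization)
  let ?S = "specH \<nu> :: ('k, _) hopf"
  interpret ring ?S by (rule ring_specialization)
  show "bij_betw spec_map (carrier ?S) (words \<nu>)"
    using spec_map_ring_iso[of \<nu>, where 'k = 'k] by (simp add: ring_iso_def)
  show "spec_map \<one>\<^bsub>?S\<^esub> = 1"
    using spec_map_ring_iso[of \<nu>, where 'k = 'k] by (simp add: ring_iso_def ring_hom_def)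
  fix K L assume K: "K \<in> carrier ?S" and L: "L \<in> carrier ?S"
  then show "K \<oplus>\<^bsub>?S\<^esub> L \<in> carrier ?S" by (rule add.m_closed)
  show "spec_map (K \<oplus>\<^bsub>?S\<^esub> L) = spec_map K + spec_map L"
    "spec_map (K \<otimes>\<^bsub>?S\<^esub> L) = spec_map K * spec_map L"
    using K L spec_map_ring_iso[of \<nu>, where 'k = 'k] by (auto simp: ring_iso_def ring_hom_def)
next
  let ?S = "specH \<nu> :: ('k, _) hopf"
  fix K assume K: "K \<in> carrier ?S"
  define x where "x = (SOME x. x \<in> K)"
  have x: "x \<in> quant \<nu>" "ev x = spec_map K" using spec_rep[OF K] by (simp_all add: x_def)
  show "c \<odot>\<^bsub>?S\<^esub> K \<in> carrier ?S" "spec_map (c \<odot>\<^bsub>?S\<^esub> K) = scale c (spec_map K)" for c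
  proof -
    have "c \<odot>\<^bsub>?S\<^esub> K = spec_class 1 (H_vee_prime \<nu>) (pscale [:c:] x)"
      by (simp add: specialization_def Let_def x_def)
    then show "c \<odot>\<^bsub>?S\<^esub> K \<in> carrier ?S" "spec_map (c \<odot>\<^bsub>?S\<^esub> K) = scale c (spec_map K)"
      using x ev_pscale[OF x(1), of "[:c:]"] by (simp_all add: carrier_specialization quant.scale spec_map_class)
  qed
  define s where "s = comult (H_vee_prime \<nu>) x"
  have s: "s \<in> tensors (quant \<nu>) 2" "pair_of id (map_tensor to_fract id s) = Delta x"
    unfolding s_def by (rule comult_H_vee_prime[OF x(1)])+
  have comult_K: "comult ?S K = map_tensor (\<lambda>p. poly p 1) (spec_class 1 (H_vee_prime \<nu>)) s"
    by (simp add: specialization_def Let_def x_def s_def)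
  show "comult ?S K \<in> tensors (carrier ?S) 2"
    unfolding comult_K by (rule map_tensor_closed[OF s(1)]) (simp add: carrier_specialization)
  show "pair_of spec_map (comult ?S K) = Delta (spec_map K)"
  \<comment> \<open>Both sides are values at 1 of \<open>Delta x\<close>.\<close>
  proof (rule ev_pm_unique)
    show "ev_pm (Delta x) (Delta (spec_map K))"
      using ev_pm_Delta[OF ev_quant[OF x(1)]] by (simp add: x(2))
    show "ev_pm (Delta x) (pair_of spec_map (comult ?S K))"
      unfolding s(2)[symmetric] comult_K pair_of_map_tensor[OF s(1)]
    proof (rule ev_pm_sum)
      fix xs assume "xs \<in> keys s"
      then obtain y z where "xs = [y, z]" "y \<in> quant \<nu>" "z \<in> quant \<nu>" by (rule tensors_2E[OF s(1)])
      then show "ev_pm (scale (to_fract (lookup s xs)) (id (id (xs ! 0)) \<otimes>\<^sub>T id (id (xs ! 1))))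
        (scale (poly (lookup s xs) 1)
          (spec_map (spec_class 1 (H_vee_prime \<nu>) (xs ! 0)) \<otimes>\<^sub>T spec_map (spec_class 1 (H_vee_prime \<nu>) (xs ! 1))))"
        by (auto simp: spec_map_class intro!: ev_pm_scale ev_rel_to_fract ev_pm_tens2 ev_quant)
    qed
  qed
  show "counit ?S K = eps (spec_map K)"
  proof (rule ev_rel_unique)
    show "ev_rel (eps x) (eps (spec_map K))"
      using ev_rel_eps[OF ev_quant[OF x(1)]] by (simp add: x(2))
    have "counit ?S K = poly (counit (H_vee_prime \<nu>) x) 1"
      by (simp add: specialization_def Let_def x_def)
    then show "ev_rel (eps x) (counit ?S K)"
      using ev_rel_to_fract[of "counit (H_vee_prime \<nu>) x"] by (simp add: counit_H_vee_prime[OF x(1)])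
  qed
  have "antipode ?S K = spec_class 1 (H_vee_prime \<nu>) (antip x)"
    by (simp add: specialization_def Let_def x_def)
  then show "antipode ?S K \<in> carrier ?S" "spec_map (antipode ?S K) = antip (spec_map K)"
    using x antip_quant[OF x(1)] by (simp_all add: carrier_specialization spec_map_class ev_antip)
qed

theorem mainTheorem6:
  fixes \<nu> :: enat
  assumes "1 \<le> \<nu>"
  shows "hopf_algebra (specialization 1 (H_vee_prime \<nu>) :: ('k::field_char_0, _) hopf)
    \<and> hopf_algebra (nc_diff \<nu> :: ('k, _) hopf)
    \<and> (\<exists>\<phi> \<in> hopf_iso (specialization 1 (H_vee_prime \<nu>)) (nc_diff \<nu> :: ('k, _) hopf).
         \<forall>n\<in>letters \<nu>. gen n \<in> carrier (H_vee_prime \<nu> :: ('k poly, _) hopf)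
            \<and> \<phi> (spec_class 1 (H_vee_prime \<nu>) (gen n)) = gen n)"
proof (intro conjI bexI[of _ spec_map] ballI)
  let ?S = "specialization 1 (H_vee_prime \<nu>) :: ('k, _) hopf"
  \<comment> \<open>This one model yields both the Hopf axioms and the compatibility of
    \<open>spec_map\<close> with all structure maps.\<close>
  interpret S: nc_diff_model ?S spec_map \<nu> by (rule nc_diff_model_specialization)
  show "hopf_algebra ?S" by (rule S.hopf_algebra)
  show "hopf_algebra (nc_diff \<nu> :: ('k, _) hopf)" by (rule nc.hopf_algebra)
  show "spec_map \<in> hopf_iso ?S (nc_diff \<nu>)"
    unfolding hopf_iso_def
  proof (intro CollectI conjI ballI allI spec_map_ring_iso)
    fix K assume K: "K \<in> carrier ?S"
    have "spec_map K \<in> carrier (nc_diff \<nu>)" using S.map_closed[OF K] by simp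
    note nc = nc.comult_closed[OF this] nc.map_comult[OF this]
    have "map_tensor id spec_map (comult ?S K) \<in> tensors (words \<nu>) 2"
      by (rule map_tensor_closed[OF S.comult_closed[OF K]]) (rule S.map_closed)
    moreover have "pair_of id (map_tensor id spec_map (comult ?S K)) = pair_of spec_map (comult ?S K)"
      by (simp add: pair_of_map_tensor[OF S.comult_closed[OF K]]) (simp add: pair_of_def lin_def)
    ultimately show "tensor_eq (nc_diff \<nu>) 2 (comult (nc_diff \<nu>) (spec_map K)) (map_tensor id spec_map (comult ?S K))"
      using nc by (subst nc.tensor_eq_2_iff) (simp_all add: S.map_comult[OF K])
  qed (simp_all add: S.map_smult S.map_counit S.map_antipode)
  fix n assume "n \<in> letters \<nu>"
  then show "gen n \<in> carrier (H_vee_prime \<nu> :: ('k poly, _) hopf)"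
    by (simp add: quant.gen)
  then show "spec_map (spec_class 1 (H_vee_prime \<nu>) (gen n)) = (gen n :: 'k free_alg)"
    by (simp add: spec_map_class ev_gen)
qed

end
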